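(* Let $k$ be a field of characteristic zero, let $(R,\mathfrak n)$ be a commutative $k$-algebra that is a local ring with maximal ideal $\mathfrak n$, let $I\subsetneq R$ be a proper ideal, and assume that the quotient ring $A=R/I$ is Noetherian. Let $f\in R$ and write $a=[f]\in A$ for its class. If $a$ is nilpotent and $d_{A/k}a=0$ in $\Omega_{A/k}$, then $$I:f\not\subseteq (I,f)+\mathfrak n\,(I:f).$$
   Context: $I:f=\{g\in R: gf\in I\}$ is the colon ideal, and $(I,f)=I+fR$. $d_{A/k}:A\to\Omega_{A/k}$ denotes the universal Kähler derivation of the $k$-algebra $A$. The ring $R$ itself is not assumed Noetherian. *)

theory Defs
  imports "HOL-Algebra.Module" "HOL-Algebra.Ideal_Product" "HOL-Algebra.Ring_Divisibility"
begin

definition char_zero :: "('k, 'm) ring_scheme \<Rightarrow> bool"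
  where "char_zero K \<longleftrightarrow> (\<forall>n::nat. [n] \<cdot>\<^bsub>K\<^esub> \<one>\<^bsub>K\<^esub> = \<zero>\<^bsub>K\<^esub> \<longrightarrow> n = 0)"

definition local_ring :: "('r, 'm) ring_scheme \<Rightarrow> 'r set \<Rightarrow> bool"
  where "local_ring R \<nn> \<longleftrightarrow>
    cring R \<and> maximalideal \<nn> R \<and> (\<forall>\<mm>. maximalideal \<mm> R \<longrightarrow> \<mm> = \<nn>)"

definition nilpotent :: "('r, 'm) ring_scheme \<Rightarrow> 'r \<Rightarrow> bool"
  where "nilpotent R a \<longleftrightarrow> a \<in> carrier R \<and> (\<exists>n::nat. a [^]\<^bsub>R\<^esub> n = \<zero>\<^bsub>R\<^esub>)"

definition colon_ideal :: "('r, 'm) ring_scheme \<Rightarrow> 'r set \<Rightarrow> 'r \<Rightarrow> 'r set"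
  where "colon_ideal R I f = {g \<in> carrier R. g \<otimes>\<^bsub>R\<^esub> f \<in> I}"


section \<open>Quotients and free modules\<close>

text \<open>
  The library quotient \<^term>\<open>M Quot N\<close> is extended by the induced scalar multiplication.
  For an ideal of an algebra this is the quotient algebra.  For a submodule of a module it is
  the quotient module; the fields \<^const>\<open>monoid.mult\<close> and \<^const>\<open>one\<close> of the record are
  then without meaning, as they are for every \<^locale>\<open>module\<close>.
\<close>

definition quot_mod :: "('k, 'a, 'm) module_scheme \<Rightarrow> 'a set \<Rightarrow> ('k, 'a set) module"
  where "quot_mod M N =
    ring.extend (M Quot N) (module.fields (\<lambda>c U. \<Union>x\<in>U. N +>\<^bsub>M\<^esub> (c \<odot>\<^bsub>M\<^esub> x)))"

text \<open>
  Elements of the free module are the finitely supported coefficient functions on \<open>S\<close>,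
  extended by zero outside \<open>S\<close>.  The fields \<^const>\<open>monoid.mult\<close> and \<^const>\<open>one\<close> are dummies.
\<close>

definition free_mod :: "('a, 'm) ring_scheme \<Rightarrow> 'b set \<Rightarrow> ('a, 'b \<Rightarrow> 'a) module"
  where "free_mod A S =
    \<lparr>carrier = {u. (\<forall>x\<in>S. u x \<in> carrier A) \<and> (\<forall>x. x \<notin> S \<longrightarrow> u x = \<zero>\<^bsub>A\<^esub>)
                 \<and> finite {x. u x \<noteq> \<zero>\<^bsub>A\<^esub>}},
     monoid.mult = (\<lambda>u v x. \<zero>\<^bsub>A\<^esub>),
     one = (\<lambda>x. \<zero>\<^bsub>A\<^esub>),
     zero = (\<lambda>x. \<zero>\<^bsub>A\<^esub>),
     add = (\<lambda>u v x. u x \<oplus>\<^bsub>A\<^esub> v x),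
     smult = (\<lambda>a u x. a \<otimes>\<^bsub>A\<^esub> u x)\<rparr>"

definition basis_vec :: "('a, 'm) ring_scheme \<Rightarrow> 'b \<Rightarrow> 'b \<Rightarrow> 'a"
  where "basis_vec A s = (\<lambda>x. if x = s then \<one>\<^bsub>A\<^esub> else \<zero>\<^bsub>A\<^esub>)"

definition submod_gen ::
    "('a, 'm) ring_scheme \<Rightarrow> ('a, 'b, 'n) module_scheme \<Rightarrow> 'b set \<Rightarrow> 'b set"
  where "submod_gen A M S = \<Inter>{N. submodule N A M \<and> S \<subseteq> N}"


section \<open>Kaehler differentials\<close>

text \<open>
  \<open>\<Omega>\<close> is the free \<open>A\<close>-module on symbols \<open>d x\<close> for \<open>x \<in> A\<close>, modulo
  additivity, \<open>K\<close>-homogeneity and the Leibniz rule.  On an \<open>A\<close>-module the scalar \<open>c \<in> K\<close>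
  acts as \<open>c \<cdot> 1 \<in> A\<close>.
\<close>

abbreviation kaehler_free :: "('k, 'a, 'm) module_scheme \<Rightarrow> ('a, 'a \<Rightarrow> 'a) module"
  where "kaehler_free A \<equiv> free_mod A (carrier A)"

definition kaehler_rels ::
    "('k, 'l) ring_scheme \<Rightarrow> ('k, 'a, 'm) module_scheme \<Rightarrow> ('a \<Rightarrow> 'a) set"
  where "kaehler_rels K A =
    (let F = kaehler_free A; d = basis_vec A in
      {d (x \<oplus>\<^bsub>A\<^esub> y) \<ominus>\<^bsub>F\<^esub> (d x \<oplus>\<^bsub>F\<^esub> d y) | x y. x \<in> carrier A \<and> y \<in> carrier A}
    \<union> {d (c \<odot>\<^bsub>A\<^esub> x) \<ominus>\<^bsub>F\<^esub> ((c \<odot>\<^bsub>A\<^esub> \<one>\<^bsub>A\<^esub>) \<odot>\<^bsub>F\<^esub> d x) | c x. c \<in> carrier K \<and> x \<in> carrier A}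
    \<union> {d (x \<otimes>\<^bsub>A\<^esub> y) \<ominus>\<^bsub>F\<^esub> (x \<odot>\<^bsub>F\<^esub> d y \<oplus>\<^bsub>F\<^esub> y \<odot>\<^bsub>F\<^esub> d x) | x y. x \<in> carrier A \<and> y \<in> carrier A})"

definition kaehler_sub ::
    "('k, 'l) ring_scheme \<Rightarrow> ('k, 'a, 'm) module_scheme \<Rightarrow> ('a \<Rightarrow> 'a) set"
  where "kaehler_sub K A = submod_gen A (kaehler_free A) (kaehler_rels K A)"

definition kaehler ::
    "('k, 'l) ring_scheme \<Rightarrow> ('k, 'a, 'm) module_scheme \<Rightarrow> ('a, ('a \<Rightarrow> 'a) set) module"
    (\<open>\<Omega>\<close>)
  where "\<Omega> K A = quot_mod (kaehler_free A) (kaehler_sub K A)"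

definition kaehler_d ::
    "('k, 'l) ring_scheme \<Rightarrow> ('k, 'a, 'm) module_scheme \<Rightarrow> 'a \<Rightarrow> ('a \<Rightarrow> 'a) set"
  where "kaehler_d K A x = kaehler_sub K A +>\<^bsub>kaehler_free A\<^esub> basis_vec A x"


section \<open>Adequacy of the construction\<close>

lemma quot_mod_simps [simp]:
  "carrier (quot_mod M N) = a_rcosets\<^bsub>M\<^esub> N"
  "monoid.mult (quot_mod M N) = rcoset_mult M N"
  "one (quot_mod M N) = N +>\<^bsub>M\<^esub> \<one>\<^bsub>M\<^esub>"
  "zero (quot_mod M N) = N"
  "add (quot_mod M N) = set_add M"
  "smult (quot_mod M N) = (\<lambda>c U. \<Union>x\<in>U. N +>\<^bsub>M\<^esub> (c \<odot>\<^bsub>M\<^esub> x))"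
  by (simp_all add: quot_mod_def ring.extend_def module.fields_def FactRing_def)

lemma free_mod_simps [simp]:
  "zero (free_mod A S) = (\<lambda>x. \<zero>\<^bsub>A\<^esub>)"
  "add (free_mod A S) = (\<lambda>u v x. u x \<oplus>\<^bsub>A\<^esub> v x)"
  "smult (free_mod A S) = (\<lambda>a u x. a \<otimes>\<^bsub>A\<^esub> u x)"
  by (simp_all add: free_mod_def)

lemma free_mod_carrier:
  "u \<in> carrier (free_mod A S) \<longleftrightarrow>
    (\<forall>x\<in>S. u x \<in> carrier A) \<and> (\<forall>x. x \<notin> S \<longrightarrow> u x = \<zero>\<^bsub>A\<^esub>) \<and> finite {x. u x \<noteq> \<zero>\<^bsub>A\<^esub>}"
  by (simp add: free_mod_def)

lemma free_mod_module:
  assumes "cring A"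
  shows "module A (free_mod A S)"
proof -
  interpret cring A by fact
  let ?F = "free_mod A S"
  have cl: "u x \<in> carrier A" if "u \<in> carrier ?F" for u x
    using that by (cases "x \<in> S") (auto simp: free_mod_carrier)
  have fin: "finite {x. u x \<noteq> \<zero>\<^bsub>A\<^esub>}" if "u \<in> carrier ?F" for u
    using that by (simp add: free_mod_carrier)
  show ?thesis
  proof (rule moduleI)
    show "abelian_group ?F"
    proof (rule abelian_groupI)
      fix u v assume uv: "u \<in> carrier ?F" "v \<in> carrier ?F"
      have "finite {x. u x \<oplus>\<^bsub>A\<^esub> v x \<noteq> \<zero>\<^bsub>A\<^esub>}"
        by (rule finite_subset[OF _ finite_UnI[OF fin[OF uv(1)] fin[OF uv(2)]]]) auto
      with uv show "u \<oplus>\<^bsub>?F\<^esub> v \<in> carrier ?F" by (auto simp: free_mod_carrier)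
      show "u \<oplus>\<^bsub>?F\<^esub> v = v \<oplus>\<^bsub>?F\<^esub> u" using cl[OF uv(1)] cl[OF uv(2)] by (simp add: a_comm)
    next
      fix u assume u: "u \<in> carrier ?F"
      have "finite {x. \<ominus>\<^bsub>A\<^esub> u x \<noteq> \<zero>\<^bsub>A\<^esub>}"
        by (rule finite_subset[OF _ fin[OF u]]) auto
      with u have "(\<lambda>x. \<ominus>\<^bsub>A\<^esub> u x) \<in> carrier ?F" by (auto simp: free_mod_carrier)
      moreover have "(\<lambda>x. \<ominus>\<^bsub>A\<^esub> u x) \<oplus>\<^bsub>?F\<^esub> u = \<zero>\<^bsub>?F\<^esub>" using cl[OF u] by (simp add: l_neg)
      ultimately show "\<exists>v\<in>carrier ?F. v \<oplus>\<^bsub>?F\<^esub> u = \<zero>\<^bsub>?F\<^esub>" by blast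
    qed (auto simp: free_mod_carrier cl a_assoc)
  next
    fix a u assume au: "a \<in> carrier A" "u \<in> carrier ?F"
    have "finite {x. a \<otimes>\<^bsub>A\<^esub> u x \<noteq> \<zero>\<^bsub>A\<^esub>}"
      by (rule finite_subset[OF _ fin[OF au(2)]]) (use au in auto)
    with au show "a \<odot>\<^bsub>?F\<^esub> u \<in> carrier ?F" by (auto simp: free_mod_carrier)
  qed (auto simp: cl l_distr r_distr m_assoc is_cring)
qed

lemma basis_vec_closed:
  assumes "cring A" "s \<in> S"
  shows "basis_vec A s \<in> carrier (free_mod A S)"
proof -
  interpret cring A by fact
  have "finite {x. basis_vec A s x \<noteq> \<zero>\<^bsub>A\<^esub>}"
    by (rule finite_subset[of _ "{s}"]) (auto simp: basis_vec_def)
  with assms show ?thesis by (auto simp: free_mod_carrier basis_vec_def)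
qed

context module
begin

lemma submod_abelian_subgroup: "submodule N R M \<Longrightarrow> abelian_subgroup N M"
  by (intro abelian_subgroupI3 additive_subgroupI M.abelian_group_axioms) (rule submodule.axioms(1))

lemma quot_mod_add:
  assumes "submodule N R M" "x \<in> carrier M" "y \<in> carrier M"
  shows "(N +>\<^bsub>M\<^esub> x) \<oplus>\<^bsub>quot_mod M N\<^esub> (N +>\<^bsub>M\<^esub> y) = N +>\<^bsub>M\<^esub> (x \<oplus>\<^bsub>M\<^esub> y)"
  using abelian_subgroup.a_rcos_sum[OF submod_abelian_subgroup] assms by simp

lemma quot_mod_smult:
  assumes N: "submodule N R M" and c: "c \<in> carrier R" and x: "x \<in> carrier M"
  shows "c \<odot>\<^bsub>quot_mod M N\<^esub> (N +>\<^bsub>M\<^esub> x) = N +>\<^bsub>M\<^esub> (c \<odot>\<^bsub>M\<^esub> x)"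
proof -
  interpret N: abelian_subgroup N M by (rule submod_abelian_subgroup[OF N])
  have "N +>\<^bsub>M\<^esub> (c \<odot>\<^bsub>M\<^esub> y) = N +>\<^bsub>M\<^esub> (c \<odot>\<^bsub>M\<^esub> x)" if y: "y \<in> N +>\<^bsub>M\<^esub> x" for y
  proof -
    from y obtain h where h: "h \<in> N" "y = h \<oplus>\<^bsub>M\<^esub> x" by (auto simp: a_r_coset_def')
    have hM: "h \<in> carrier M" and ch: "c \<odot>\<^bsub>M\<^esub> h \<in> N"
      using h(1) c submoduleE(4)[OF N] by auto
    have "c \<odot>\<^bsub>M\<^esub> y = c \<odot>\<^bsub>M\<^esub> h \<oplus>\<^bsub>M\<^esub> c \<odot>\<^bsub>M\<^esub> x" using h(2) hM c x by (simp add: smult_r_distr)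
    then have "c \<odot>\<^bsub>M\<^esub> y \<in> N +>\<^bsub>M\<^esub> (c \<odot>\<^bsub>M\<^esub> x)" using ch by (auto simp: a_r_coset_def')
    then show ?thesis using c x N.a_repr_independence' by auto
  qed
  then have "c \<odot>\<^bsub>quot_mod M N\<^esub> (N +>\<^bsub>M\<^esub> x)
      = (\<Union>y\<in>N +>\<^bsub>M\<^esub> x. N +>\<^bsub>M\<^esub> (c \<odot>\<^bsub>M\<^esub> x))"
    by (simp only: quot_mod_simps cong: SUP_cong)
  then show ?thesis using N.a_rcos_self[OF x] by (simp only: UN_constant) auto
qed

lemma quot_mod_module:
  assumes N: "submodule N R M"
  shows "module R (quot_mod M N)"
proof -
  let ?Q = "quot_mod M N"
  interpret N: abelian_subgroup N M by (rule submod_abelian_subgroup[OF N])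
  note add = quot_mod_add[OF N] and smult = quot_mod_smult[OF N]
  have ex: "\<exists>x\<in>carrier M. U = N +>\<^bsub>M\<^esub> x" if "U \<in> carrier (quot_mod M N)" for U
    using that by (auto simp: A_RCOSETS_defs a_r_coset_def)
  have cos: "N +>\<^bsub>M\<^esub> x \<in> carrier (quot_mod M N)" if "x \<in> carrier M" for x
    using that by (auto simp: A_RCOSETS_defs a_r_coset_def)
  have ze: "\<zero>\<^bsub>quot_mod M N\<^esub> = N +>\<^bsub>M\<^esub> \<zero>\<^bsub>M\<^esub>"
    by (simp add: M.a_coset_add_zero[OF N.a_subset])
  show ?thesis
  proof (rule moduleI)
    show "abelian_group (quot_mod M N)"
    proof (rule abelian_groupI)
      fix U assume "U \<in> carrier (quot_mod M N)"
      with ex obtain x where x: "x \<in> carrier M" "U = N +>\<^bsub>M\<^esub> x" by blast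
      then show "\<zero>\<^bsub>quot_mod M N\<^esub> \<oplus>\<^bsub>quot_mod M N\<^esub> U = U" unfolding ze by (simp add: add del: quot_mod_simps)
      have "(N +>\<^bsub>M\<^esub> (\<ominus>\<^bsub>M\<^esub> x)) \<oplus>\<^bsub>quot_mod M N\<^esub> U = \<zero>\<^bsub>quot_mod M N\<^esub>"
        unfolding ze using x by (simp add: add M.l_neg del: quot_mod_simps)
      then show "\<exists>V\<in>carrier (quot_mod M N). V \<oplus>\<^bsub>quot_mod M N\<^esub> U = \<zero>\<^bsub>quot_mod M N\<^esub>"
        using cos x by (meson M.a_inv_closed)
    next
      show "\<zero>\<^bsub>quot_mod M N\<^esub> \<in> carrier (quot_mod M N)" unfolding ze by (rule cos) simp
    next
      fix U V assume "U \<in> carrier ?Q" "V \<in> carrier ?Q"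
      then obtain x y where "x \<in> carrier M" "U = N +>\<^bsub>M\<^esub> x" "y \<in> carrier M" "V = N +>\<^bsub>M\<^esub> y"
        using ex by metis
      then show "U \<oplus>\<^bsub>?Q\<^esub> V \<in> carrier ?Q" "U \<oplus>\<^bsub>?Q\<^esub> V = V \<oplus>\<^bsub>?Q\<^esub> U"
        by (simp_all add: add cos M.a_comm del: quot_mod_simps)
    next
      fix U V W assume "U \<in> carrier ?Q" "V \<in> carrier ?Q" "W \<in> carrier ?Q"
      then obtain x y z where "x \<in> carrier M" "U = N +>\<^bsub>M\<^esub> x" "y \<in> carrier M" "V = N +>\<^bsub>M\<^esub> y"
          "z \<in> carrier M" "W = N +>\<^bsub>M\<^esub> z"
        using ex by metis
      then show "U \<oplus>\<^bsub>?Q\<^esub> V \<oplus>\<^bsub>?Q\<^esub> W = U \<oplus>\<^bsub>?Q\<^esub> (V \<oplus>\<^bsub>?Q\<^esub> W)"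
        by (simp add: add M.a_assoc del: quot_mod_simps)
    qed
  next
    fix a b U V assume ab: "a \<in> carrier R" "b \<in> carrier R" and "U \<in> carrier ?Q" "V \<in> carrier ?Q"
    then obtain x y where "x \<in> carrier M" "U = N +>\<^bsub>M\<^esub> x" "y \<in> carrier M" "V = N +>\<^bsub>M\<^esub> y"
      using ex by metis
    with ab show "a \<odot>\<^bsub>?Q\<^esub> (U \<oplus>\<^bsub>?Q\<^esub> V) = a \<odot>\<^bsub>?Q\<^esub> U \<oplus>\<^bsub>?Q\<^esub> a \<odot>\<^bsub>?Q\<^esub> V"
      by (simp add: add smult smult_r_distr del: quot_mod_simps)
  next
    fix a b U assume ab: "a \<in> carrier R" "b \<in> carrier R" and "U \<in> carrier ?Q"
    then obtain x where "x \<in> carrier M" "U = N +>\<^bsub>M\<^esub> x" using ex by blast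
    with ab show "a \<odot>\<^bsub>?Q\<^esub> U \<in> carrier ?Q"
        "(a \<oplus>\<^bsub>R\<^esub> b) \<odot>\<^bsub>?Q\<^esub> U = a \<odot>\<^bsub>?Q\<^esub> U \<oplus>\<^bsub>?Q\<^esub> b \<odot>\<^bsub>?Q\<^esub> U"
        "(a \<otimes>\<^bsub>R\<^esub> b) \<odot>\<^bsub>?Q\<^esub> U = a \<odot>\<^bsub>?Q\<^esub> (b \<odot>\<^bsub>?Q\<^esub> U)"
      by (simp_all add: add smult cos smult_l_distr smult_assoc1 del: quot_mod_simps)
  next
    fix U assume "U \<in> carrier ?Q"
    then obtain x where "x \<in> carrier M" "U = N +>\<^bsub>M\<^esub> x" using ex by blast
    then show "\<one>\<^bsub>R\<^esub> \<odot>\<^bsub>?Q\<^esub> U = U" by (simp add: smult del: quot_mod_simps)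
  qed (rule R.cring_axioms)
qed

lemma submod_gen_submodule:
  assumes S: "S \<subseteq> carrier M"
  shows "submodule (submod_gen R M S) R M"
proof (rule submoduleI)
  show "submod_gen R M S \<subseteq> carrier M"
    using carrier_is_submodule S by (auto simp: submod_gen_def)
  show "\<zero>\<^bsub>M\<^esub> \<in> submod_gen R M S"
    using subgroup.one_closed[OF submodule.axioms(1)] by (fastforce simp: submod_gen_def)
next
  show "\<And>a. a \<in> submod_gen R M S \<Longrightarrow> \<ominus>\<^bsub>M\<^esub> a \<in> submod_gen R M S"
    unfolding submod_gen_def using submoduleE(3) by blast
  show "\<And>a b. \<lbrakk>a \<in> submod_gen R M S; b \<in> submod_gen R M S\<rbrakk> \<Longrightarrow> a \<oplus>\<^bsub>M\<^esub> b \<in> submod_gen R M S"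
    unfolding submod_gen_def using submoduleE(5) by blast
  show "\<And>a x. \<lbrakk>a \<in> carrier R; x \<in> submod_gen R M S\<rbrakk> \<Longrightarrow> a \<odot>\<^bsub>M\<^esub> x \<in> submod_gen R M S"
    unfolding submod_gen_def using submoduleE(4) by blast
qed

end

lemma kaehler_rels_carrier:
  assumes "algebra K A"
  shows "kaehler_rels K A \<subseteq> carrier (kaehler_free A)"
proof -
  interpret algebra K A by fact
  interpret F: module A "kaehler_free A" by (rule free_mod_module[OF M_cring])
  note b = basis_vec_closed[OF M_cring, where S = "carrier A"]
  show ?thesis unfolding kaehler_rels_def Let_def
    by (auto intro!: F.M.minus_closed F.M.add.m_closed F.smult_closed b simp del: free_mod_simps)
qed

lemma kaehler_sub_submodule:
  assumes "algebra K A"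
  shows "submodule (kaehler_sub K A) A (kaehler_free A)"
proof -
  interpret algebra K A by fact
  show ?thesis unfolding kaehler_sub_def
    by (intro module.submod_gen_submodule free_mod_module M_cring kaehler_rels_carrier assms)
qed

theorem kaehler_module: "algebra K A \<Longrightarrow> module A (\<Omega> K A)"
  unfolding kaehler_def
  by (intro module.quot_mod_module free_mod_module kaehler_sub_submodule algebra.M_cring)

lemma quot_algebra:
  assumes "algebra K R" "ideal I R"
  shows "algebra K (quot_mod R I)"
proof -
  interpret algebra K R by fact
  interpret I: ideal I R by fact
  have one: "c \<odot>\<^bsub>R\<^esub> x = (c \<odot>\<^bsub>R\<^esub> \<one>\<^bsub>R\<^esub>) \<otimes>\<^bsub>R\<^esub> x" if "c \<in> carrier K" "x \<in> carrier R" for c x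
    using smult_assoc2[of c "\<one>\<^bsub>R\<^esub>" x] that by simp
  have sub: "submodule I K R"
  proof (intro submodule.intro submodule_axioms.intro)
    fix c x assume c: "c \<in> carrier K" and x: "x \<in> I"
    then have "x \<in> carrier R" by simp
    with c x show "c \<odot>\<^bsub>R\<^esub> x \<in> I" by (subst one) (auto intro: I.I_l_closed)
  qed (rule I.a_subgroup)
  interpret Q: module K "quot_mod R I" by (rule quot_mod_module[OF sub])
  have ex: "\<exists>x\<in>carrier R. U = I +>\<^bsub>R\<^esub> x" if "U \<in> carrier (quot_mod R I)" for U
    using that by (auto simp: A_RCOSETS_defs a_r_coset_def)
  have q: "cring (R Quot I)" by (rule I.quotient_is_cring[OF M_cring])
  interpret Q0: cring "R Quot I" by (rule q)
  have cr: "cring (quot_mod R I)"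
  proof (rule cringI)
    show "Group.comm_monoid (quot_mod R I)"
      by (rule Group.comm_monoidI)
        (use Q0.m_closed Q0.one_closed Q0.m_assoc Q0.l_one Q0.m_comm in \<open>simp_all add: FactRing_def\<close>)
    show "\<And>x y z. \<lbrakk>x \<in> carrier (quot_mod R I); y \<in> carrier (quot_mod R I); z \<in> carrier (quot_mod R I)\<rbrakk>
      \<Longrightarrow> (x \<oplus>\<^bsub>quot_mod R I\<^esub> y) \<otimes>\<^bsub>quot_mod R I\<^esub> z
        = x \<otimes>\<^bsub>quot_mod R I\<^esub> z \<oplus>\<^bsub>quot_mod R I\<^esub> y \<otimes>\<^bsub>quot_mod R I\<^esub> z"
      using ring.ring_simprules(13)[OF cring.axioms(1)[OF q]] by (simp add: FactRing_def)
  qed (rule Q.abelian_group_axioms)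
  have mul: "(I +>\<^bsub>R\<^esub> x) \<otimes>\<^bsub>quot_mod R I\<^esub> (I +>\<^bsub>R\<^esub> y) = I +>\<^bsub>R\<^esub> (x \<otimes>\<^bsub>R\<^esub> y)"
    if "x \<in> carrier R" "y \<in> carrier R" for x y
    using I.rcoset_mult_add[OF that] by simp
  show ?thesis
  proof (intro algebra.intro algebra_axioms.intro)
    fix c U V assume "c \<in> carrier K" "U \<in> carrier (quot_mod R I)" "V \<in> carrier (quot_mod R I)"
    then show "(c \<odot>\<^bsub>quot_mod R I\<^esub> U) \<otimes>\<^bsub>quot_mod R I\<^esub> V = c \<odot>\<^bsub>quot_mod R I\<^esub> (U \<otimes>\<^bsub>quot_mod R I\<^esub> V)"
      by (auto dest!: ex simp: mul quot_mod_smult[OF sub] smult_assoc2 simp del: quot_mod_simps)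
  qed (fact Q.module_axioms cr)+
qed

locale derivation = A: algebra K A + M: module A M
  for K :: "('k, 'l) ring_scheme" and A :: "('k, 'a, 'm) module_scheme" (structure)
    and M :: "('a, 'b, 'n) module_scheme" +
  fixes D :: "'a \<Rightarrow> 'b"
  assumes D_closed: "x \<in> carrier A \<Longrightarrow> D x \<in> carrier M"
    and D_add: "\<lbrakk>x \<in> carrier A; y \<in> carrier A\<rbrakk> \<Longrightarrow> D (x \<oplus> y) = D x \<oplus>\<^bsub>M\<^esub> D y"
    and D_smult: "\<lbrakk>c \<in> carrier K; x \<in> carrier A\<rbrakk> \<Longrightarrow> D (c \<odot> x) = (c \<odot> \<one>) \<odot>\<^bsub>M\<^esub> D x"
    and D_mult: "\<lbrakk>x \<in> carrier A; y \<in> carrier A\<rbrakk> \<Longrightarrow>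
      D (x \<otimes> y) = x \<odot>\<^bsub>M\<^esub> D y \<oplus>\<^bsub>M\<^esub> y \<odot>\<^bsub>M\<^esub> D x"

theorem kaehler_d_derivation:
  assumes "algebra K A"
  shows "derivation K A (\<Omega> K A) (kaehler_d K A)"
proof -
  interpret algebra K A by fact
  let ?F = "kaehler_free A" and ?N = "kaehler_sub K A"
  interpret F: module A ?F by (rule free_mod_module[OF M_cring])
  note N = kaehler_sub_submodule[OF assms]
  interpret N: abelian_subgroup ?N ?F by (rule F.submod_abelian_subgroup[OF N])
  note b = basis_vec_closed[OF M_cring, where S = "carrier A"]
  have rels: "kaehler_rels K A \<subseteq> ?N" by (auto simp: kaehler_sub_def submod_gen_def)
  have eq: "?N +>\<^bsub>?F\<^esub> u = ?N +>\<^bsub>?F\<^esub> v"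
    if "u \<ominus>\<^bsub>?F\<^esub> v \<in> kaehler_rels K A" "u \<in> carrier ?F" "v \<in> carrier ?F" for u v
    using that rels N.a_rcos_module[of v u] N.a_repr_independence'[of u v]
    by (auto simp: a_minus_def)
  show ?thesis
  proof (intro derivation.intro derivation_axioms.intro)
    show "algebra K A" by fact
    show "module A (\<Omega> K A)" by (rule kaehler_module) fact
  next
    fix x assume "x \<in> carrier A"
    then show "kaehler_d K A x \<in> carrier (\<Omega> K A)"
      using b[of x] by (auto simp: kaehler_d_def kaehler_def A_RCOSETS_defs a_r_coset_def)
  next
    fix x y assume xy: "x \<in> carrier A" "y \<in> carrier A"
    show "kaehler_d K A (x \<oplus>\<^bsub>A\<^esub> y) = kaehler_d K A x \<oplus>\<^bsub>\<Omega> K A\<^esub> kaehler_d K A y"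
      unfolding kaehler_d_def kaehler_def F.quot_mod_add[OF N b[OF xy(1)] b[OF xy(2)]]
      by (rule eq) (use xy b in \<open>auto simp: kaehler_rels_def Let_def simp del: free_mod_simps\<close>)
    have "kaehler_d K A (x \<otimes>\<^bsub>A\<^esub> y) =
      ?N +>\<^bsub>?F\<^esub> (x \<odot>\<^bsub>?F\<^esub> basis_vec A y \<oplus>\<^bsub>?F\<^esub> y \<odot>\<^bsub>?F\<^esub> basis_vec A x)"
      unfolding kaehler_d_def
      by (rule eq) (use xy b in \<open>auto simp: kaehler_rels_def Let_def simp del: free_mod_simps\<close>)
    then show "kaehler_d K A (x \<otimes>\<^bsub>A\<^esub> y) =
      x \<odot>\<^bsub>\<Omega> K A\<^esub> kaehler_d K A y \<oplus>\<^bsub>\<Omega> K A\<^esub> y \<odot>\<^bsub>\<Omega> K A\<^esub> kaehler_d K A x"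
      using xy b by (simp add: kaehler_d_def kaehler_def F.quot_mod_add[OF N] F.quot_mod_smult[OF N]
          del: free_mod_simps quot_mod_simps)
  next
    fix c x assume cx: "c \<in> carrier K" "x \<in> carrier A"
    have "kaehler_d K A (c \<odot>\<^bsub>A\<^esub> x) = ?N +>\<^bsub>?F\<^esub> ((c \<odot>\<^bsub>A\<^esub> \<one>\<^bsub>A\<^esub>) \<odot>\<^bsub>?F\<^esub> basis_vec A x)"
      unfolding kaehler_d_def
      by (rule eq) (use cx b in \<open>auto simp: kaehler_rels_def Let_def simp del: free_mod_simps\<close>)
    then show "kaehler_d K A (c \<odot>\<^bsub>A\<^esub> x) = (c \<odot>\<^bsub>A\<^esub> \<one>\<^bsub>A\<^esub>) \<odot>\<^bsub>\<Omega> K A\<^esub> kaehler_d K A x"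
      using cx b by (simp add: kaehler_d_def kaehler_def F.quot_mod_smult[OF N]
          del: free_mod_simps quot_mod_simps)
  qed
qed

end

theory Submission
  imports Defs "HOL-Algebra.Subrings"
begin

text \<open>
  Suppose the inclusion holds. By Nakayama's lemma the annihilator of \<open>a\<close> in \<open>A\<close> is contained
  in \<open>aA\<close>; equivalently, \<open>A/a\<^sup>2A\<close> is flat over the dual numbers \<open>k[\<epsilon>]\<close> with \<open>\<epsilon>\<close> acting as \<open>a\<close>.
  This property and the equation \<open>da = 0\<close> survive localization, so \<open>A\<close> may be replaced by its
  localization \<open>B\<close> at a maximal multiplicative set avoiding \<open>0\<close>. In \<open>B\<close> every element is a unit
  or nilpotent, and as the characteristic is zero, \<open>B\<close> has a coefficient field \<open>L \<supseteq> k\<close>, over which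
  \<open>B/aB\<close> has a finite basis \<open>v\<^sub>1, \<dots>, v\<^sub>n\<close>. Modulo \<open>a\<^sup>2\<close>, multiplication by \<open>y \<in> B\<close> is a matrix
  \<open>M\<^sub>0(y) + a M\<^sub>1(y)\<close> in this basis, and \<open>T(x, y) = tr (M\<^sub>0(x) M\<^sub>1(y))\<close> defines a derivation
  \<open>y \<mapsto> T(\<cdot>, y)\<close> into \<open>Hom\<^sub>L(B, L)\<close> that vanishes on \<open>k\<close>. Since \<open>T(1, a) = n \<noteq> 0\<close>, we get \<open>da \<noteq> 0\<close>.
\<close>

text \<open>The construction is designed so that n appears as a trace: the first-order matrix M1(a)
  is the identity. A trace requires A/aA to be finite over a field, which can fail when A has
  positive dimension; hence the passage to B, which is the localization at a minimal prime and is
  Artinian. Being nilpotent, a stays a nonunit there, so B/aB is nonzero and n > 0. Comparing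
  first-order terms in the action of a product gives M1(yz) = M0(y)M1(z) + M1(y)M0(z). After
  multiplication by M0(x), cyclicity of the trace and multiplicativity of M0 turn this into T(x, yz)
  = T(xy, z) + T(xz, y), which is the Leibniz rule for maps into Hom. The annihilator condition is
  what makes M1 meaningful: an equation ap = aq determines p modulo a. Characteristic zero is used
  twice, once to make minimal polynomials over the coefficient field separable and once to conclude
  that n is nonzero in B.\<close>

lemma noetherian_maximal:
  assumes "noetherian_ring A" "\<F> \<noteq> {}"
    and ideal: "\<And>J. J \<in> \<F> \<Longrightarrow> ideal (h J) A"
    and mono: "\<And>J J'. \<lbrakk>J \<in> \<F>; J' \<in> \<F>\<rbrakk> \<Longrightarrow> h J \<subseteq> h J' \<longleftrightarrow> J \<subseteq> J'"
  obtains J where "J \<in> \<F>" "\<And>J'. \<lbrakk>J' \<in> \<F>; J \<subseteq> J'\<rbrakk> \<Longrightarrow> J' = J"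
proof -
  interpret noetherian_ring A by fact
  \<comment> \<open>The union of a chain of ideals of \<open>A\<close> belongs to the chain, so
    Zorn's lemma applies to the images. The family itself may live in another ring: \<open>h\<close>
    will be contraction from a localization or the image in a quotient, and \<open>mono\<close>
    carries maximality back.\<close>
  have "\<exists>M\<in>h ` \<F>. \<forall>X\<in>h ` \<F>. M \<subseteq> X \<longrightarrow> X = M"
  proof (rule subset_Zorn_nonempty)
    show "h ` \<F> \<noteq> {}" using \<open>\<F> \<noteq> {}\<close> by simp
    fix C assume C: "C \<noteq> {}" "subset.chain (h ` \<F>) C"
    then have "subset.chain {I. ideal I A} C"
      using ideal by (auto simp: subset.chain_def)
    then have "\<Union>C \<in> C" using ideal_chain_is_trivial C(1) by blast
    then show "\<Union>C \<in> h ` \<F>" using C(2) by (auto simp: subset.chain_def)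
  qed
  then obtain J where "J \<in> \<F>" "\<And>J'. J' \<in> \<F> \<Longrightarrow> h J \<subseteq> h J' \<Longrightarrow> h J' = h J" by blast
  then show thesis using mono by (metis that subset_refl subset_antisym)
qed

section \<open>Coefficient fields\<close>

context cring
begin

lemma nilpotent_closed: "nilpotent R x \<Longrightarrow> x \<in> carrier R"
  by (simp add: nilpotent_def)

lemma nilpotent_zero: "nilpotent R \<zero>"
  unfolding nilpotent_def by (auto intro: exI[of _ "1::nat"])

lemma nat_pow_zero_mono:
  fixes n m :: nat
  assumes "x \<in> carrier R" "x [^] n = \<zero>" "n \<le> m"
  shows "x [^] m = \<zero>"
  using nat_pow_mult[of x n "m - n"] assms by simp

lemma nilpotent_mult:
  assumes "nilpotent R x" "y \<in> carrier R"
  shows "nilpotent R (y \<otimes> x)"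
proof -
  obtain n :: nat where "x [^] n = \<zero>" and x: "x \<in> carrier R" using assms(1) by (auto simp: nilpotent_def)
  then have "(y \<otimes> x) [^] n = \<zero>" using assms(2) by (simp add: nat_pow_distrib)
  then show ?thesis using x assms(2) unfolding nilpotent_def by blast
qed

lemma Units_dvd:
  assumes "x \<otimes> y \<in> Units R" "x \<in> carrier R" "y \<in> carrier R"
  shows "x \<in> Units R"
  using assms by (rule unit_factor)

lemma diff_squares:
  assumes "u \<in> carrier R" "x \<in> carrier R"
  shows "u \<otimes> u \<ominus> x \<otimes> x = (u \<ominus> x) \<otimes> (u \<oplus> x)"
proof -
  have "(u \<ominus> x) \<otimes> (u \<oplus> x) = u \<otimes> u \<oplus> (u \<otimes> x \<oplus> (\<ominus> (u \<otimes> x) \<oplus> \<ominus> (x \<otimes> x)))"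
    using assms by (simp add: a_minus_def l_distr r_distr l_minus m_comm[of x u] a_ac)
  also have "\<dots> = u \<otimes> u \<ominus> x \<otimes> x" using assms by (simp add: r_neg1 r_neg2 a_minus_def)
  finally show ?thesis by simp
qed

lemma map2_add_closed:
  assumes "subring L R" "set cs \<subseteq> L" "set ds \<subseteq> L"
  shows "set (map2 (\<oplus>) cs ds) \<subseteq> L"
proof
  fix z assume "z \<in> set (map2 (\<oplus>) cs ds)"
  then obtain p where p: "p \<in> set (zip cs ds)" "z = fst p \<oplus> snd p" by force
  then have "fst p \<in> set cs" "snd p \<in> set ds"
    by (metis prod.collapse set_zip_leftD, metis prod.collapse set_zip_rightD)
  then show "z \<in> L" using subringE(7)[OF assms(1), of "fst p" "snd p"] assms(2,3) p(2) by auto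
qed

text \<open>Squaring replaces the geometric series:
  \<open>u \<otimes> u \<ominus> x \<otimes> x\<close> has the factor \<open>u \<ominus> x\<close>,
  and \<open>x \<otimes> x\<close> has a smaller nilpotency exponent. For n >= 2 the exponent
  \<open>n - 1\<close> serves, since 2(n - 1) >= n.\<close>

lemma Units_minus_nilpotent:
  assumes "u \<in> Units R" "nilpotent R x"
  shows "u \<ominus> x \<in> Units R"
proof -
  obtain n :: nat where "x [^] n = \<zero>" "x \<in> carrier R" using assms(2) by (auto simp: nilpotent_def)
  then show ?thesis using assms(1)
  proof (induction n arbitrary: u x rule: less_induct)
    case (less n)
    note u = Units_closed[OF less.prems(3)]
    show ?case
    proof (cases "n \<le> 1")
      case True
      then have "x [^] (1::nat) = \<zero>" using nat_pow_zero_mono less.prems by blast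
      then show ?thesis using less.prems u by (simp add: a_minus_def)
    next
      case False
      have "(x \<otimes> x) [^] (n - 1) = x [^] (2 * (n - 1))"
        using less.prems nat_pow_pow[of x 2 "n - 1"] by (simp add: numeral_2_eq_2)
      also have "\<dots> = \<zero>" using False by (intro nat_pow_zero_mono[OF less.prems(2,1)]) auto
      finally have "u \<otimes> u \<ominus> x \<otimes> x \<in> Units R"
        using False less.prems by (intro less.IH[of "n - 1"]) auto
      moreover have "u \<otimes> u \<ominus> x \<otimes> x = (u \<ominus> x) \<otimes> (u \<oplus> x)"
        using less.prems(2) u by (intro diff_squares)
      ultimately have "(u \<ominus> x) \<otimes> (u \<oplus> x) \<in> Units R" by simp
      then show ?thesis using less.prems(2) u Units_dvd[of "u \<ominus> x" "u \<oplus> x"] by simp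
    qed
  qed
qed

section \<open>Polynomials as coefficient lists, their derivatives and Taylor expansion\<close>

primrec horner :: "'a list \<Rightarrow> 'a \<Rightarrow> 'a" where
  "horner [] x = \<zero>"
| "horner (c # cs) x = c \<oplus> x \<otimes> horner cs x"

primrec horner_deriv :: "'a list \<Rightarrow> 'a \<Rightarrow> 'a" where
  "horner_deriv [] x = \<zero>"
| "horner_deriv (c # cs) x = horner cs x \<oplus> x \<otimes> horner_deriv cs x"

lemma horner_closed [simp]:
  "\<lbrakk>set cs \<subseteq> carrier R; x \<in> carrier R\<rbrakk> \<Longrightarrow> horner cs x \<in> carrier R"
  by (induction cs) auto

lemma horner_deriv_closed [simp]:
  "\<lbrakk>set cs \<subseteq> carrier R; x \<in> carrier R\<rbrakk> \<Longrightarrow> horner_deriv cs x \<in> carrier R"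
  by (induction cs) auto

lemma horner_snoc:
  "\<lbrakk>set cs \<subseteq> carrier R; c \<in> carrier R; x \<in> carrier R\<rbrakk> \<Longrightarrow>
    horner (cs @ [c]) x = horner cs x \<oplus> x [^] length cs \<otimes> c"
  by (induction cs) (auto simp: r_distr a_assoc m_ac)

lemma horner_zeros:
  "\<lbrakk>set cs \<subseteq> carrier R; x \<in> carrier R\<rbrakk> \<Longrightarrow> horner (cs @ replicate n \<zero>) x = horner cs x"
proof (induction n)
  case (Suc n)
  have "horner ((cs @ replicate n \<zero>) @ [\<zero>]) x = horner (cs @ replicate n \<zero>) x"
    using Suc.prems by (subst horner_snoc) (auto intro!: r_zero horner_closed)
  then show ?case using Suc by (simp add: replicate_append_same)
qed simp

lemma horner_map_mult:
  "\<lbrakk>set cs \<subseteq> carrier R; x \<in> carrier R; c \<in> carrier R\<rbrakk> \<Longrightarrow>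
    horner (map ((\<otimes>) c) cs) x = c \<otimes> horner cs x"
  by (induction cs) (auto simp: r_distr m_ac)

lemma horner_map2_add:
  "\<lbrakk>length cs = length ds; set cs \<subseteq> carrier R; set ds \<subseteq> carrier R; x \<in> carrier R\<rbrakk> \<Longrightarrow>
    horner (map2 (\<oplus>) cs ds) x = horner cs x \<oplus> horner ds x"
  by (induction cs ds rule: list_induct2) (auto simp: r_distr a_ac)

text \<open>Second-order precision is what a Newton step needs: once \<open>h\<close> times the
  derivative cancels the value at \<open>x\<close>, only a multiple of the square of
  \<open>h\<close> remains.\<close>

lemma horner_taylor:
  assumes "set cs \<subseteq> carrier R" "x \<in> carrier R" "h \<in> carrier R"
  shows "\<exists>t\<in>carrier R. horner cs (x \<oplus> h) = horner cs x \<oplus> h \<otimes> (horner_deriv cs x \<oplus> h \<otimes> t)"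
  using assms(1)
proof (induction cs)
  case Nil
  show ?case using assms by (auto intro!: bexI[of _ \<zero>])
next
  case (Cons c cs)
  then obtain t where t: "t \<in> carrier R"
    "horner cs (x \<oplus> h) = horner cs x \<oplus> h \<otimes> (horner_deriv cs x \<oplus> h \<otimes> t)" by auto
  \<comment> \<open>The witness collects the terms of order at least two in (x + h)(q + h q' + h^2
    t), where q and q' are the values at x of the polynomial \<open>cs\<close> and its
    derivative.\<close>
  show ?case
    by (rule bexI[of _ "horner_deriv cs x \<oplus> (x \<oplus> h) \<otimes> t"])
      (use Cons.prems assms t in \<open>simp_all add: l_distr r_distr a_ac m_ac\<close>)
qed

lemma horner_add_nilpotent:
  assumes "set cs \<subseteq> carrier R" "x \<in> carrier R" "nilpotent R h"
  shows "\<exists>h'. nilpotent R h' \<and> horner cs (x \<oplus> h) = horner cs x \<oplus> h'"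
proof -
  note h = nilpotent_closed[OF assms(3)]
  obtain t where t: "t \<in> carrier R"
    "horner cs (x \<oplus> h) = horner cs x \<oplus> h \<otimes> (horner_deriv cs x \<oplus> h \<otimes> t)"
    using horner_taylor assms h by blast
  have "nilpotent R ((horner_deriv cs x \<oplus> h \<otimes> t) \<otimes> h)"
    using assms t h by (intro nilpotent_mult) auto
  then show ?thesis using t h assms m_comm by (metis a_closed horner_deriv_closed m_closed)
qed

text \<open>In the minimality argument the derivative must compete as a polynomial over
  \<open>L\<close>, of degree one less and with a positive multiple of the old leading coefficient.
  The guard \<open>2 \<le> length cs\<close> keeps \<open>last ds\<close> off the empty
  list.\<close>

lemma horner_deriv_list:
  assumes L: "subring L R" and "set cs \<subseteq> L"
  shows "\<exists>ds. set ds \<subseteq> L \<and> length ds = length cs - 1 \<and>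
    (\<forall>x\<in>carrier R. horner ds x = horner_deriv cs x) \<and>
    (2 \<le> length cs \<longrightarrow> last ds = [(length cs - 1)] \<cdot>\<^bsub>R\<^esub> last cs)"
  using assms(2)
proof (induction cs)
  case Nil
  then show ?case by auto
next
  case (Cons c cs)
  note LR = subringE(1)[OF L]
  from Cons obtain ds where ds: "set ds \<subseteq> L" "length ds = length cs - 1"
    "\<forall>x\<in>carrier R. horner ds x = horner_deriv cs x"
    "2 \<le> length cs \<longrightarrow> last ds = [(length cs - 1)] \<cdot>\<^bsub>R\<^esub> last cs" by auto
  show ?case
  proof (cases "cs = []")
    case True
    then show ?thesis by auto
  next
    case False
    then have len: "length (\<zero> # ds) = length cs" using ds by (cases cs) auto
    have R: "set cs \<subseteq> carrier R" "set ds \<subseteq> carrier R" using Cons.prems ds LR by auto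
    \<comment> \<open>The derivative of c + X p is p + X p', and \<open>\<zero> # ds\<close> is the
      coefficient list of X p'.\<close>
    have "set (map2 (\<oplus>) cs (\<zero> # ds)) \<subseteq> L"
      using Cons.prems ds(1) subringE(2)[OF L] by (intro map2_add_closed[OF L]) auto
    moreover have "\<forall>x\<in>carrier R. horner (map2 (\<oplus>) cs (\<zero> # ds)) x = horner_deriv (c # cs) x"
      using R ds(3) by (auto simp: horner_map2_add[OF len[symmetric]])
    moreover have "last (map2 (\<oplus>) cs (\<zero> # ds)) = [length cs] \<cdot>\<^bsub>R\<^esub> last cs"
    proof -
      have lc: "last cs \<in> carrier R" using False R by auto
      have "last (map2 (\<oplus>) cs (\<zero> # ds)) = last cs \<oplus> last (\<zero> # ds)"
        using False len by (simp add: last_map last_zip)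
      also have "\<dots> = [length cs] \<cdot>\<^bsub>R\<^esub> last cs"
      proof (cases "length cs \<ge> 2")
        case True
        then have "ds \<noteq> []" using ds(2) by auto
        then have "last cs \<oplus> last (\<zero> # ds) = last cs \<oplus> [(length cs - 1)] \<cdot>\<^bsub>R\<^esub> last cs" using True ds by simp
        also have "\<dots> = [Suc (length cs - 1)] \<cdot>\<^bsub>R\<^esub> last cs" using lc by (simp add: a_comm)
        also have "Suc (length cs - 1) = length cs" using True by simp
        finally show ?thesis .
      next
        case F: False
        then have "length cs = 1" using False by (cases cs) (auto simp: not_le less_Suc_eq_le)
        then have "ds = []" using ds(2) by auto
        with \<open>length cs = 1\<close> show ?thesis using lc by simp
      qed
      finally show ?thesis .
    qed
    ultimately show ?thesis using len
      by (intro exI[of _ "map2 (\<oplus>) cs (\<zero> # ds)"]) auto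
  qed
qed

lemma horner_strip:
  assumes "set cs \<subseteq> carrier R" "x \<in> carrier R" "\<not> set cs \<subseteq> {\<zero>}"
  shows "\<exists>ds. set ds \<subseteq> set cs \<and> ds \<noteq> [] \<and> last ds \<noteq> \<zero> \<and> length ds \<le> length cs \<and> horner ds x = horner cs x"
  using assms(1,3)
proof (induction cs rule: rev_induct)
  case (snoc c cs)
  show ?case
  proof (cases "c = \<zero>")
    case True
    have "horner (cs @ [c]) x = horner cs x"
      using True assms(2) snoc.prems by (simp add: horner_snoc)
    moreover obtain ds where "set ds \<subseteq> set cs \<and> ds \<noteq> [] \<and> last ds \<noteq> \<zero> \<and> length ds \<le> length cs \<and> horner ds x = horner cs x"
      using snoc True by auto
    ultimately show ?thesis by (intro exI[of _ ds]) auto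
  next
    case False
    then show ?thesis by (intro exI[of _ "cs @ [c]"]) auto
  qed
qed simp

lemma horner_all_zero: "set cs \<subseteq> {\<zero>} \<Longrightarrow> x \<in> carrier R \<Longrightarrow> horner cs x = \<zero>"
  by (induction cs) auto

section \<open>Adjoining one element to a subring\<close>

definition adjoin :: "'a set \<Rightarrow> 'a \<Rightarrow> 'a set"
  where "adjoin L x = {horner cs x | cs. set cs \<subseteq> L}"

lemma adjoin_subring:
  assumes L: "subring L R" and x: "x \<in> carrier R"
  shows "subring (adjoin L x) R"
proof -
  note LR = subringE(1)[OF L]
  have add: "u \<oplus> v \<in> adjoin L x" if "u \<in> adjoin L x" "v \<in> adjoin L x" for u v
  proof -
    from that obtain cs ds where cs: "u = horner cs x" "set cs \<subseteq> L"
      and ds: "v = horner ds x" "set ds \<subseteq> L" unfolding adjoin_def by blast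
    let ?cs = "cs @ replicate (length ds) \<zero>" and ?ds = "ds @ replicate (length cs) \<zero>"
    have sub: "set ?cs \<subseteq> L" "set ?ds \<subseteq> L" using cs ds subringE(2)[OF L] by auto
    have "u \<oplus> v = horner (map2 (\<oplus>) ?cs ?ds) x"
      using horner_map2_add[of ?cs ?ds x] sub cs ds LR x
      by (simp add: horner_zeros subset_trans[OF _ LR])
    moreover have "set (map2 (\<oplus>) ?cs ?ds) \<subseteq> L" by (rule map2_add_closed[OF L sub])
    ultimately show ?thesis unfolding adjoin_def by blast
  qed
  have smul: "c \<otimes> v \<in> adjoin L x" if "c \<in> L" "v \<in> adjoin L x" for c v
  proof -
    from that obtain cs where cs: "v = horner cs x" "set cs \<subseteq> L" unfolding adjoin_def by blast
    then have "c \<otimes> v = horner (map ((\<otimes>) c) cs) x" using that LR x by (subst horner_map_mult) auto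
    moreover have "set (map ((\<otimes>) c) cs) \<subseteq> L" using cs that subringE(6)[OF L] by auto
    ultimately show ?thesis unfolding adjoin_def by blast
  qed
  have xmul: "x \<otimes> v \<in> adjoin L x" if "v \<in> adjoin L x" for v
  proof -
    from that obtain cs where cs: "v = horner cs x" "set cs \<subseteq> L" unfolding adjoin_def by blast
    then have "x \<otimes> v = horner (\<zero> # cs) x" using x LR by simp
    moreover have "set (\<zero> # cs) \<subseteq> L" using cs subringE(2)[OF L] by auto
    ultimately show ?thesis unfolding adjoin_def by blast
  qed
  have sub: "adjoin L x \<subseteq> carrier R" unfolding adjoin_def using LR x by auto
  show ?thesis
  proof (rule subringI)
    show "adjoin L x \<subseteq> carrier R" by (rule sub)
    have "\<one> = horner [\<one>] x" using x by simp
    moreover have "set [\<one>] \<subseteq> L" using subringE(3)[OF L] by simp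
    ultimately show "\<one> \<in> adjoin L x" unfolding adjoin_def by blast
  next
    fix u assume "u \<in> adjoin L x"
    then show "\<ominus> u \<in> adjoin L x"
      using smul[of "\<ominus> \<one>" u] subringE(3,5)[OF L] sub by (auto simp: l_minus)
  next
    fix u v assume uv: "u \<in> adjoin L x" "v \<in> adjoin L x"
    then obtain cs where cs: "u = horner cs x" "set cs \<subseteq> L" unfolding adjoin_def by blast
    have "horner cs x \<otimes> v \<in> adjoin L x" using cs(2)
    proof (induction cs)
      case Nil
      have "\<zero> = horner [] x" "set [] \<subseteq> L" by simp_all
      then have "\<zero> \<in> adjoin L x" unfolding adjoin_def by blast
      then show ?case using uv sub by auto
    next
      case (Cons c cs)
      have "horner (c # cs) x \<otimes> v = c \<otimes> v \<oplus> x \<otimes> (horner cs x \<otimes> v)"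
        using Cons.prems LR sub uv x
        by (simp add: l_distr m_assoc subset_iff)
      then show ?case using add smul xmul Cons uv by auto
    qed
    then show "u \<otimes> v \<in> adjoin L x" using cs by simp
  qed (rule add)
qed

lemma adjoin_superset:
  assumes "subring L R" "x \<in> carrier R"
  shows "L \<subseteq> adjoin L x" "x \<in> adjoin L x"
proof -
  note LR = subringE(1)[OF assms(1)]
  show "L \<subseteq> adjoin L x"
  proof
    fix c assume "c \<in> L"
    then have "c = horner [c] x" "set [c] \<subseteq> L" using LR assms(2) by auto
    then show "c \<in> adjoin L x" unfolding adjoin_def by blast
  qed
  have "x = horner [\<zero>, \<one>] x" "set [\<zero>, \<one>] \<subseteq> L" using assms subringE(2,3)[OF assms(1)] by auto
  then show "x \<in> adjoin L x" unfolding adjoin_def by blast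
qed

end

section \<open>Coefficient fields in rings whose elements are units or nilpotent\<close>

lemma (in cring) Units_mult_zero:
  assumes "u \<in> Units R" "x \<in> carrier R" "u \<otimes> x = \<zero>"
  shows "x = \<zero>"
  using Units_l_cancel[of u x \<zero>] Units_closed[of u] assms by simp

text \<open>These are the local rings with nil maximal ideal that contain the rational numbers. In
  this form the maximal ideal never has to be named; its closure under addition becomes
  \<open>nilpotent_add\<close>.\<close>

locale nil_local = cring +
  assumes one_nonzero: "\<one> \<noteq> \<zero>"
    and unit_or_nil: "x \<in> carrier R \<Longrightarrow> x \<in> Units R \<or> nilpotent R x"
    and of_nat_Units: "0 < (n::nat) \<Longrightarrow> [n] \<cdot>\<^bsub>R\<^esub> \<one> \<in> Units R"
begin

lemma Units_not_nilpotent: "u \<in> Units R \<Longrightarrow> \<not> nilpotent R u"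
proof
  assume u: "u \<in> Units R" "nilpotent R u"
  then have "u \<ominus> u \<in> Units R" by (rule Units_minus_nilpotent)
  moreover have "u \<ominus> u = \<zero>" using Units_closed[OF u(1)] by (simp add: a_minus_def r_neg)
  ultimately have z: "\<zero> \<in> Units R" by simp
  have "\<zero> \<otimes> inv \<zero> = \<one>" using z by (rule Units_r_inv)
  moreover have "\<zero> \<otimes> inv \<zero> = \<zero>" using Units_inv_closed[OF z] by (rule l_null)
  ultimately show False using one_nonzero by simp
qed

text \<open>A sum that is not nilpotent is a unit, and subtracting \<open>x\<close> from it would
  make the nilpotent \<open>y\<close> a unit.\<close>

lemma nilpotent_add:
  assumes "nilpotent R x" "nilpotent R y"
  shows "nilpotent R (x \<oplus> y)"
proof (rule ccontr)
  note c = nilpotent_closed[OF assms(1)] nilpotent_closed[OF assms(2)]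
  assume "\<not> nilpotent R (x \<oplus> y)"
  then have "x \<oplus> y \<in> Units R" using unit_or_nil c by blast
  then have "x \<oplus> y \<ominus> x \<in> Units R" using Units_minus_nilpotent assms by blast
  moreover have "x \<oplus> y \<ominus> x = y" using c by (simp add: a_minus_def a_comm[of x y] a_assoc r_neg)
  ultimately show False using Units_not_nilpotent assms by simp
qed

lemma nilpotent_minus: "nilpotent R x \<Longrightarrow> nilpotent R (\<ominus> x)"
  using nilpotent_mult[of x "\<ominus> \<one>"] nilpotent_closed[of x] by (simp add: l_minus)

lemma nilpotent_diff: "nilpotent R x \<Longrightarrow> nilpotent R y \<Longrightarrow> nilpotent R (x \<ominus> y)"
  unfolding a_minus_def by (intro nilpotent_add nilpotent_minus)

text \<open>A subring that is maximal among those containing \<open>k\<close> and meeting the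
  nilpotents only in zero is a field and represents every residue class. An element whose class is
  transcendental over it can be adjoined, hence already belongs to it. If the class is algebraic,
  the representative is first moved by Newton's method to an exact root of the minimal polynomial,
  and this root can be adjoined.\<close>

lemma coefficient_field:
  assumes k: "subring k R" "\<And>x. x \<in> k \<Longrightarrow> nilpotent R x \<Longrightarrow> x = \<zero>"
  obtains L where "subring L R" "k \<subseteq> L" "\<And>u. \<lbrakk>u \<in> L; u \<noteq> \<zero>\<rbrakk> \<Longrightarrow> u \<in> Units R \<and> inv u \<in> L"
    "\<And>x. x \<in> carrier R \<Longrightarrow> \<exists>l\<in>L. nilpotent R (x \<ominus> l)"
proof -
  let ?\<F> = "{L. subring L R \<and> k \<subseteq> L \<and> (\<forall>x\<in>L. nilpotent R x \<longrightarrow> x = \<zero>)}"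
  have "\<exists>M\<in>?\<F>. \<forall>X\<in>?\<F>. M \<subseteq> X \<longrightarrow> X = M"
  proof (rule subset_Zorn_nonempty)
    show "?\<F> \<noteq> {}" using k by blast
    fix C assume C: "C \<noteq> {}" "subset.chain ?\<F> C"
    then have sub: "subring L R" if "L \<in> C" for L using that by (auto simp: subset.chain_def)
    have two: "\<exists>L\<in>C. x \<in> L \<and> y \<in> L" if "x \<in> \<Union>C" "y \<in> \<Union>C" for x y
    proof -
      from that obtain X Y where "X \<in> C" "x \<in> X" "Y \<in> C" "y \<in> Y" by blast
      moreover have "X \<subseteq> Y \<or> Y \<subseteq> X"
        using C(2) \<open>X \<in> C\<close> \<open>Y \<in> C\<close> unfolding subset.chain_def by blast
      ultimately show ?thesis by blast
    qed
    have "subring (\<Union>C) R"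
    proof (rule subringI)
      show "\<Union>C \<subseteq> carrier R" using sub subringE(1) by blast
      show "\<one> \<in> \<Union>C" using sub subringE(3) C(1) by blast
      show "\<ominus> h \<in> \<Union>C" if "h \<in> \<Union>C" for h
      proof -
        from that obtain M where M: "M \<in> C" "h \<in> M" by blast
        then show ?thesis using subringE(5)[OF sub[OF M(1)] M(2)] by auto
      qed
      show "x \<otimes> y \<in> \<Union>C" "x \<oplus> y \<in> \<Union>C" if "x \<in> \<Union>C" "y \<in> \<Union>C" for x y
      proof -
        from two[OF that] obtain M where M: "M \<in> C" "x \<in> M" "y \<in> M" by blast
        then show "x \<otimes> y \<in> \<Union>C" "x \<oplus> y \<in> \<Union>C"
          using subringE(6,7)[OF sub[OF M(1)] M(2,3)] by auto
      qed
    qed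
    then show "\<Union>C \<in> ?\<F>" using C by (auto simp: subset.chain_def)
  qed
  then obtain L where LF: "L \<in> ?\<F>" and LM: "\<forall>X\<in>?\<F>. L \<subseteq> X \<longrightarrow> X = L" by (rule bexE)
  have L: "subring L R" and kL: "k \<subseteq> L" and L0: "\<And>x. x \<in> L \<Longrightarrow> nilpotent R x \<Longrightarrow> x = \<zero>"
    using LF by simp_all
  have max: "X = L" if "subring X R" "L \<subseteq> X" "\<And>x. x \<in> X \<Longrightarrow> nilpotent R x \<Longrightarrow> x = \<zero>" for X
  proof -
    have "X \<in> ?\<F>" using that kL by auto
    then show ?thesis using LM that(2) by blast
  qed
  note LR = subringE(1)[OF L]
  have adj: "x \<in> L" if x: "x \<in> carrier R"
    and nil: "\<And>cs. set cs \<subseteq> L \<Longrightarrow> nilpotent R (horner cs x) \<Longrightarrow> horner cs x = \<zero>" for x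
  proof -
    have "adjoin L x = L"
      using adjoin_subring[OF L x] adjoin_superset(1)[OF L x] nil
      by (intro max) (auto simp: adjoin_def)
    then show ?thesis using adjoin_superset(2)[OF L x] by simp
  qed
  have L_Units: "u \<in> Units R" if "u \<in> L" "u \<noteq> \<zero>" for u
    using that L0 unit_or_nil LR by blast
  have L_inv: "inv u \<in> L" if u: "u \<in> L" "u \<noteq> \<zero>" for u
  proof (rule adj)
    note uU = L_Units[OF u]
    have uR: "u \<in> carrier R" using u LR by blast
    show "inv u \<in> carrier R" using uU by simp
    fix cs assume cs: "set cs \<subseteq> L" "nilpotent R (horner cs (inv u))"
    \<comment> \<open>Multiplying by a power of \<open>u\<close> clears the denominators of a
      polynomial in \<open>inv u\<close>. The value then lies in \<open>L\<close>, where nilpotent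
      means zero, and the unit \<open>u [^] length cs\<close> cancels.\<close>
    have "u [^] length cs \<otimes> horner cs (inv u) \<in> L" using cs(1)
    proof (induction cs)
      case Nil
      then show ?case using subringE(2)[OF L] by simp
    next
      case (Cons c cs)
      let ?h = "horner cs (inv u)"
      have cl: "c \<in> carrier R" "?h \<in> carrier R" "u [^] length cs \<in> L"
        using Cons.prems LR uU u subringE(3,6)[OF L] by (auto intro!: horner_closed) (induction cs, auto)
      have "u [^] length (c # cs) \<otimes> horner (c # cs) (inv u)
        = (u [^] length cs \<otimes> u) \<otimes> c \<oplus> (u \<otimes> inv u) \<otimes> (u [^] length cs \<otimes> ?h)"
        using cl uU uR by (simp add: r_distr m_ac del: Units_r_inv Units_l_inv)
      also have "\<dots> = (u [^] length cs \<otimes> u) \<otimes> c \<oplus> u [^] length cs \<otimes> ?h"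
        using cl uU uR by simp
      also have "\<dots> \<in> L" using Cons cl u subringE(6,7)[OF L] by auto
      finally show ?case .
    qed
    moreover have "nilpotent R (u [^] length cs \<otimes> horner cs (inv u))"
      using cs uR by (intro nilpotent_mult) auto
    ultimately have "u [^] length cs \<otimes> horner cs (inv u) = \<zero>" using L0 by blast
    moreover have "u [^] length cs \<in> Units R" using uU by (rule Units_pow_closed)
    ultimately show "horner cs (inv u) = \<zero>"
      using Units_mult_zero nilpotent_closed[OF cs(2)] by blast
  qed
  have "\<exists>l\<in>L. nilpotent R (x \<ominus> l)" if x: "x \<in> carrier R" for x
  \<comment> \<open>The case \<open>True\<close> says that the class of \<open>x\<close> is
    algebraic over \<open>L\<close> in the residue field. Otherwise only the zero polynomial over
    \<open>L\<close> has a nilpotent value at \<open>x\<close>, so adjoining \<open>x\<close>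
    creates no new nilpotents.\<close>
  proof (cases "\<exists>cs. set cs \<subseteq> L \<and> cs \<noteq> [] \<and> last cs \<noteq> \<zero> \<and> nilpotent R (horner cs x)")
    case False
    have "x \<in> L"
    proof (rule adj[OF x])
      fix cs assume cs: "set cs \<subseteq> L" "nilpotent R (horner cs x)"
      show "horner cs x = \<zero>"
      proof (cases "set cs \<subseteq> {\<zero>}")
        case True
        then show ?thesis using horner_all_zero x by blast
      next
        case F: False
        have "set cs \<subseteq> carrier R" using cs LR by blast
        from horner_strip[OF this x F] show ?thesis using False cs by (metis order_trans)
      qed
    qed
    moreover have "nilpotent R (x \<ominus> x)" using x nilpotent_zero by (simp add: a_minus_def r_neg)
    ultimately show ?thesis by blast
  next
    case True
    \<comment> \<open>\<open>n\<close> will be the degree of a minimal polynomial \<open>q\<close>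
      of the residue class of \<open>x\<close>. A polynomial of degree \<open>n\<close> is a list of
      length \<open>Suc n\<close>, so \<open>length cs \<le> n\<close> in \<open>min\<close> means
      smaller degree.\<close>
    define P where "P n \<longleftrightarrow> (\<exists>cs. set cs \<subseteq> L \<and> cs \<noteq> [] \<and> last cs \<noteq> \<zero> \<and> length cs = Suc n
      \<and> nilpotent R (horner cs x))" for n
    have "\<exists>n. P n" using True unfolding P_def by (metis length_0_conv not0_implies_Suc)
    define n where "n = (LEAST n. P n)"
    have "P n" unfolding n_def using \<open>\<exists>n. P n\<close> by (auto intro: LeastI)
    then obtain q where q: "set q \<subseteq> L" "q \<noteq> []" "last q \<noteq> \<zero>" "length q = Suc n" "nilpotent R (horner q x)"
      unfolding P_def by blast
    have qR: "set q \<subseteq> carrier R" using q LR by blast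
    have lq: "last q \<in> L" using q by auto
    \<comment> \<open>Minimality was stated at \<open>x\<close>, but values at \<open>y\<close>
      differ from those at \<open>x\<close> by nilpotents, so it holds throughout the residue class,
      in which the Newton iteration moves.\<close>
    have min: "set cs \<subseteq> {\<zero>}" if cs: "set cs \<subseteq> L" "length cs \<le> n"
      and y: "y \<in> carrier R" "nilpotent R (x \<ominus> y)" and nil: "nilpotent R (horner cs y)" for cs y
    proof (rule ccontr)
      assume "\<not> set cs \<subseteq> {\<zero>}"
      then obtain ds where ds: "set ds \<subseteq> set cs" "ds \<noteq> []" "last ds \<noteq> \<zero>" "length ds \<le> length cs"
        "horner ds y = horner cs y"
        using horner_strip[OF subset_trans[OF cs(1) LR] y(1)] by blast
      have dR: "set ds \<subseteq> carrier R" using ds cs LR by blast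
      obtain h' where h': "nilpotent R h'" "horner ds (y \<oplus> (x \<ominus> y)) = horner ds y \<oplus> h'"
        using horner_add_nilpotent[OF dR y] by blast
      have "y \<oplus> (x \<ominus> y) = x" using x y(1) by (simp add: a_minus_def a_lcomm[of y x] r_neg)
      then have "nilpotent R (horner ds x)" using h' nil ds(5) nilpotent_add by simp
      then have "P (length ds - 1)" unfolding P_def using ds cs by (intro exI[of _ ds]) auto
      then have "n \<le> length ds - 1" unfolding n_def by (rule Least_le)
      moreover have "0 < length ds" using ds(2) by simp
      ultimately show False using ds(4) cs(2) by linarith
    qed
    obtain ds where ds: "set ds \<subseteq> L" "length ds = n" "\<And>x. x \<in> carrier R \<Longrightarrow> horner ds x = horner_deriv q x"
      "2 \<le> length q \<longrightarrow> last ds = [n] \<cdot>\<^bsub>R\<^esub> last q"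
      using horner_deriv_list[OF L q(1)] q(4) by auto
    have "n \<noteq> 0"
    proof
      assume "n = 0"
      then obtain c where c: "q = [c]" using q(4) by (metis length_0_conv length_Suc_conv)
      then show False using q x LR L0[of c] by auto
    qed
    \<comment> \<open>Separability in characteristic zero: a nilpotent value of the derivative at
      \<open>y\<close> would force all its coefficients to vanish, but the leading one is
      \<open>n\<close> times that of \<open>q\<close>, and \<open>n\<close> is invertible.\<close>
    have deriv: "horner_deriv q y \<in> Units R" if y: "y \<in> carrier R" "nilpotent R (x \<ominus> y)" for y
    proof (rule ccontr)
      assume "horner_deriv q y \<notin> Units R"
      then have "nilpotent R (horner_deriv q y)"
        using unit_or_nil horner_deriv_closed[OF qR y(1)] by blast
      then have "nilpotent R (horner ds y)" using ds(3)[OF y(1)] by simp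
      then have "set ds \<subseteq> {\<zero>}" using min[of ds y] ds(1,2) y by simp
      moreover have "ds \<noteq> []" using ds \<open>n \<noteq> 0\<close> by auto
      ultimately have "last ds = \<zero>" using last_in_set by blast
      then have "[n] \<cdot>\<^bsub>R\<^esub> last q = \<zero>" using ds q \<open>n \<noteq> 0\<close> by auto
      then have "([n] \<cdot>\<^bsub>R\<^esub> \<one>) \<otimes> last q = \<zero>" using lq LR add_pow_ldistr[of \<one> "last q" n] by auto
      moreover have "[n] \<cdot>\<^bsub>R\<^esub> \<one> \<in> Units R" using of_nat_Units \<open>n \<noteq> 0\<close> by simp
      ultimately have "last q = \<zero>" using lq LR Units_mult_zero by blast
      then show False using q by simp
    qed
    \<comment> \<open>The Newton iteration is organised as a descent: among all \<open>y\<close> in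
      the residue class, one is chosen whose value \<open>horner q y\<close> has the least exponent
      \<open>N\<close>. A Newton step would lower \<open>N\<close> unless
      \<open>N \<le> 1\<close>.\<close>
    define Q where "Q N \<longleftrightarrow> (\<exists>y. y \<in> carrier R \<and> nilpotent R (x \<ominus> y) \<and> horner q y [^] N = \<zero>)" for N :: nat
    define N where "N = (LEAST N. Q N)"
    have ex: "\<exists>N. Q N"
    proof -
      have "nilpotent R (x \<ominus> x)" using x nilpotent_zero by (simp add: a_minus_def r_neg)
      moreover obtain N :: nat where "horner q x [^] N = \<zero>" using q(5) by (auto simp: nilpotent_def)
      ultimately show ?thesis using x unfolding Q_def by blast
    qed
    then have "Q N" unfolding N_def by (rule LeastI_ex)
    then obtain y where y: "y \<in> carrier R" "nilpotent R (x \<ominus> y)" "horner q y [^] N = \<zero>"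
      unfolding Q_def by blast
    have "N \<le> 1"
    proof (rule ccontr)
      assume "\<not> N \<le> 1"
      let ?v = "inv (horner_deriv q y)" and ?q = "horner q y"
      \<comment> \<open>The Newton correction -q(y)/q'(y). It cancels the linear term, so the new
        value is divisible by the square of the old one, and the exponent \<open>N - 1\<close>
        suffices because 2(N - 1) >= N.\<close>
      define h where "h = \<ominus> (?v \<otimes> ?q)"
      have dU: "horner_deriv q y \<in> Units R" using deriv y by blast
      have cl: "?v \<in> carrier R" "?q \<in> carrier R" "horner_deriv q y \<in> carrier R"
        using dU qR y by auto
      then have h: "h \<in> carrier R" by (simp add: h_def)
      have hn: "nilpotent R h" unfolding h_def
        using cl y(3) by (intro nilpotent_minus nilpotent_mult) (auto simp: nilpotent_def)
      obtain t where t: "t \<in> carrier R"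
        "horner q (y \<oplus> h) = ?q \<oplus> h \<otimes> (horner_deriv q y \<oplus> h \<otimes> t)"
        using horner_taylor[OF qR y(1) h] by blast
      have "h \<otimes> horner_deriv q y = \<ominus> ?q"
      proof -
        have "h \<otimes> horner_deriv q y = \<ominus> ((horner_deriv q y \<otimes> ?v) \<otimes> ?q)"
          unfolding h_def using cl by (simp add: l_minus r_minus m_ac del: Units_r_inv)
        then show ?thesis using dU cl by simp
      qed
      then have "horner q (y \<oplus> h) = h \<otimes> (h \<otimes> t)"
        using t cl h by (simp add: r_distr r_neg2)
      also have "\<dots> = (?q \<otimes> ?q) \<otimes> (?v \<otimes> ?v \<otimes> t)"
        unfolding h_def using cl t by (simp add: l_minus r_minus m_ac)
      finally have eq: "horner q (y \<oplus> h) = (?q \<otimes> ?q) \<otimes> (?v \<otimes> ?v \<otimes> t)" .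
      have "(?q \<otimes> ?q) [^] (N - 1) = ?q [^] (2 * (N - 1))"
        using cl nat_pow_pow[of ?q 2 "N - 1"] by (simp add: numeral_2_eq_2)
      also have "\<dots> = \<zero>" 
      proof (rule nat_pow_zero_mono[OF cl(2) y(3)])
        show "N \<le> 2 * (N - 1)" using \<open>\<not> N \<le> 1\<close> by linarith
      qed
      finally have "horner q (y \<oplus> h) [^] (N - 1) = \<zero>"
        unfolding eq using cl t by (simp add: nat_pow_distrib)
      moreover have "nilpotent R (x \<ominus> (y \<oplus> h))"
      proof -
        have "x \<ominus> (y \<oplus> h) = (x \<ominus> y) \<ominus> h" using x y(1) h by (simp add: a_minus_def minus_add a_assoc)
        then show ?thesis using nilpotent_diff y hn by simp
      qed
      ultimately have "Q (N - 1)" unfolding Q_def using y(1) h by (intro exI[of _ "y \<oplus> h"]) simp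
      then have "N \<le> N - 1" unfolding N_def by (rule Least_le)
      then show False using \<open>\<not> N \<le> 1\<close> by simp
    qed
    then have root: "horner q y = \<zero>"
      using nat_pow_zero_mono[of "horner q y" N 1] y qR by simp
    \<comment> \<open>Division with remainder by \<open>q\<close>: since \<open>y\<close> is a root,
      every element of L[y] is the value of a list of length \<open>n\<close>.\<close>
    have reduce: "\<exists>r. set r \<subseteq> L \<and> length r = n \<and> horner r y = horner cs y" if "set cs \<subseteq> L" for cs
      using that
    proof (induction cs)
      case Nil
      have z: "set (replicate n \<zero>) \<subseteq> {\<zero>}" by auto
      then have "set (replicate n \<zero>) \<subseteq> L" using subringE(2)[OF L] by blast
      then show ?case using horner_all_zero[OF z y(1)]
        by (intro exI[of _ "replicate n \<zero>"]) simp
    next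
      case (Cons c cs)
      then obtain r where r: "set r \<subseteq> L" "length r = n" "horner r y = horner cs y" by auto
      \<comment> \<open>\<open>c # r\<close> and \<open>q\<close> both have length
        \<open>Suc n\<close>. The multiple of \<open>q\<close> is chosen to cancel the top
        coefficient; adding it does not change the value at the root \<open>y\<close>.\<close>
      define l where "l = \<ominus> (last (c # r) \<otimes> inv (last q))"
      define p where "p = map2 (\<oplus>) (c # r) (map ((\<otimes>) l) q)"
      have lr: "last (c # r) \<in> L" using r(1) Cons.prems by auto
      have liq: "inv (last q) \<in> L" using L_inv[OF lq q(3)] .
      have l: "l \<in> L" unfolding l_def using lr liq subringE(5,6)[OF L] by auto
      have crR: "set (c # r) \<subseteq> carrier R" using r(1) Cons.prems LR by auto
      have lqm: "set (map ((\<otimes>) l) q) \<subseteq> L" using l q(1) subringE(6)[OF L] by auto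
      have "horner p y = horner (c # r) y \<oplus> horner (map ((\<otimes>) l) q) y"
        unfolding p_def using r(2) q(4) crR subset_trans[OF lqm LR] y(1) by (intro horner_map2_add) simp_all
      also have "\<dots> = horner (c # r) y"
        using horner_closed[OF crR y(1)] subsetD[OF LR l]
        by (simp add: horner_map_mult[OF qR y(1)] root del: horner.simps)
      also have "\<dots> = horner (c # cs) y" using r by simp
      finally have hp: "horner p y = horner (c # cs) y" .
      have pL: "set p \<subseteq> L" unfolding p_def using r(1) Cons.prems lqm by (intro map2_add_closed[OF L]) auto
      have pn: "length p = Suc n" unfolding p_def using r(2) q(4) by simp
      have "last p = last (c # r) \<oplus> l \<otimes> last q"
        unfolding p_def using r(2) q(2,4) by (simp add: last_map last_zip del: last.simps)
      also have "l \<otimes> last q = \<ominus> (last (c # r) \<otimes> (inv (last q) \<otimes> last q))"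
        unfolding l_def using lr liq lq LR by (simp add: l_minus m_assoc subset_iff del: last.simps)
      also have "inv (last q) \<otimes> last q = \<one>" using L_Units[OF lq q(3)] by simp
      also have "last (c # r) \<oplus> \<ominus> (last (c # r) \<otimes> \<one>) = \<zero>"
        using lr LR by (simp add: r_neg subset_iff del: last.simps)
      finally have "last p = \<zero>" .
      then have "p = butlast p @ [\<zero>]" using pn by (metis append_butlast_last_id length_0_conv nat.simps(3))
      moreover have "set (butlast p) \<subseteq> L" using pL by (meson in_set_butlastD subset_iff)
      ultimately have "horner p y = horner (butlast p) y"
        using horner_snoc[of "butlast p" \<zero> y] y LR by auto
      then show ?case using hp pn \<open>set (butlast p) \<subseteq> L\<close> by (intro exI[of _ "butlast p"]) auto
    qed
    \<comment> \<open>A nilpotent element of L[y] reduces to a polynomial of degree below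
      \<open>n\<close>, which \<open>min\<close> forces to vanish; so \<open>y\<close> can be
      adjoined without creating nilpotents.\<close>
    have "y \<in> L"
    proof (rule adj[OF y(1)])
      fix cs assume cs: "set cs \<subseteq> L" "nilpotent R (horner cs y)"
      then obtain r where r: "set r \<subseteq> L" "length r = n" "horner r y = horner cs y" using reduce by blast
      then have "set r \<subseteq> {\<zero>}" using min[of r y] y cs(2) by simp
      then show "horner cs y = \<zero>" using horner_all_zero[of r y] y(1) r(3) by simp
    qed
    then show ?thesis using y by blast
  qed
  then show thesis using L_Units L_inv by (intro that[OF L kL]) simp_all
qed

end

section \<open>Localization at a maximal multiplicative set\<close>

lemma (in ring_hom_cring) hom_Units:
  assumes "u \<in> Units R" shows "h u \<in> Units S"
proof -
  have "h (u \<otimes> inv u) = \<one>\<^bsub>S\<^esub>" using R.Units_r_inv[OF assms] by simp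
  then have "h u \<otimes>\<^bsub>S\<^esub> h (inv u) = \<one>\<^bsub>S\<^esub>"
    using R.Units_closed[OF assms] R.Units_inv_closed[OF assms] by simp
  then have "h u \<otimes>\<^bsub>S\<^esub> h (inv u) \<in> Units S" by simp
  then show ?thesis
    using S.unit_factor R.Units_closed[OF assms] R.Units_inv_closed[OF assms] by blast
qed

lemma (in ring_hom_cring) hom_nilpotent:
  assumes "nilpotent R x" shows "nilpotent S (h x)"
proof -
  obtain n :: nat where x: "x \<in> carrier R" "x [^] n = \<zero>" using assms by (auto simp: nilpotent_def)
  then have "h x [^]\<^bsub>S\<^esub> n = \<zero>\<^bsub>S\<^esub>" using ring.hom_nat_pow[OF x(1), of n] by simp
  then show ?thesis using x unfolding nilpotent_def by auto
qed

lemma (in ring_hom_cring) hom_add_pow: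
  "x \<in> carrier R \<Longrightarrow> h ([(n::nat)] \<cdot>\<^bsub>R\<^esub> x) = [n] \<cdot>\<^bsub>S\<^esub> h x"
  by (induction n) auto

section \<open>Rings of fractions, with zero divisors allowed as denominators\<close>

definition (in cring) frac_rel :: "'a set \<Rightarrow> ('a \<times> 'a) \<Rightarrow> ('a \<times> 'a) \<Rightarrow> bool"
  where "frac_rel S p q \<longleftrightarrow> (\<exists>u\<in>S. u \<otimes> (fst p \<otimes> snd q) = u \<otimes> (fst q \<otimes> snd p))"

definition (in cring) frac :: "'a set \<Rightarrow> 'a \<Rightarrow> 'a \<Rightarrow> ('a \<times> 'a) set"
  where "frac S x s = {q \<in> carrier R \<times> S. frac_rel S (x, s) q}"

text \<open>Sum and product are unions over all representatives, so no representative has to be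
  chosen. \<open>frac_Union\<close> collapses such a union to one fraction once independence of the
  representatives is shown.\<close>

definition (in cring) loc :: "'a set \<Rightarrow> ('a \<times> 'a) set ring"
  where "loc S =
    \<lparr>carrier = {frac S x s | x s. x \<in> carrier R \<and> s \<in> S},
     monoid.mult = (\<lambda>X Y. \<Union>(x, s)\<in>X. \<Union>(y, t)\<in>Y. frac S (x \<otimes> y) (s \<otimes> t)),
     one = frac S \<one> \<one>,
     zero = frac S \<zero> \<one>,
     add = (\<lambda>X Y. \<Union>(x, s)\<in>X. \<Union>(y, t)\<in>Y. frac S (x \<otimes> t \<oplus> y \<otimes> s) (s \<otimes> t))\<rparr>"

locale localization = cring +
  fixes S :: "'a set"
  assumes S_sub: "S \<subseteq> carrier R" and S_one: "\<one> \<in> S"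
    and S_mult: "\<lbrakk>s \<in> S; t \<in> S\<rbrakk> \<Longrightarrow> s \<otimes> t \<in> S"
begin

lemma S_carrier [simp]: "s \<in> S \<Longrightarrow> s \<in> carrier R" using S_sub by auto

lemmas S_closed [simp] = S_one S_mult

lemma frac_rel_refl: "frac_rel S p p"
  unfolding frac_rel_def using S_one by blast

lemma frac_rel_sym: "frac_rel S p q \<Longrightarrow> frac_rel S q p"
  unfolding frac_rel_def by (metis)

lemma frac_rel_trans:
  assumes "frac_rel S p q" "frac_rel S q r"
    and c: "fst p \<in> carrier R" "fst q \<in> carrier R" "fst r \<in> carrier R"
      "snd p \<in> S" "snd q \<in> S" "snd r \<in> S"
  shows "frac_rel S p r"
proof -
  obtain u v where u: "u \<in> S" "u \<otimes> (fst p \<otimes> snd q) = u \<otimes> (fst q \<otimes> snd p)"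
    and v: "v \<in> S" "v \<otimes> (fst q \<otimes> snd r) = v \<otimes> (fst r \<otimes> snd q)"
    using assms(1,2) unfolding frac_rel_def by blast
  have "(u \<otimes> v \<otimes> snd q) \<otimes> (fst p \<otimes> snd r) = v \<otimes> snd r \<otimes> (u \<otimes> (fst p \<otimes> snd q))"
    using u(1) v(1) c by (simp add: m_ac)
  also have "\<dots> = u \<otimes> snd p \<otimes> (v \<otimes> (fst q \<otimes> snd r))"
    unfolding u(2) using u(1) v(1) c by (simp add: m_ac)
  also have "\<dots> = (u \<otimes> v \<otimes> snd q) \<otimes> (fst r \<otimes> snd p)"
    unfolding v(2) using u(1) v(1) c by (simp add: m_ac)
  finally show ?thesis unfolding frac_rel_def using u(1) v(1) c by (meson S_mult)
qed

lemma frac_eq_iff: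
  assumes "x \<in> carrier R" "y \<in> carrier R" "s \<in> S" "t \<in> S"
  shows "frac S x s = frac S y t \<longleftrightarrow> (\<exists>u\<in>S. u \<otimes> (x \<otimes> t) = u \<otimes> (y \<otimes> s))"
proof
  assume "frac S x s = frac S y t"
  moreover have "(y, t) \<in> frac S y t" using assms frac_rel_refl by (simp add: frac_def)
  ultimately have "(y, t) \<in> frac S x s" by simp
  then show "\<exists>u\<in>S. u \<otimes> (x \<otimes> t) = u \<otimes> (y \<otimes> s)"
    by (simp add: frac_def frac_rel_def)
next
  assume "\<exists>u\<in>S. u \<otimes> (x \<otimes> t) = u \<otimes> (y \<otimes> s)"
  then have r: "frac_rel S (x, s) (y, t)" by (simp add: frac_rel_def)
  show "frac S x s = frac S y t"
    unfolding frac_def using frac_rel_trans[OF r] frac_rel_trans[OF frac_rel_sym[OF r]] assms by auto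
qed

lemma in_fracD:
  assumes "p \<in> frac S x s" "x \<in> carrier R" "s \<in> S"
  obtains y t where "p = (y, t)" "y \<in> carrier R" "t \<in> S" "frac S y t = frac S x s"
proof -
  obtain y t where p: "p = (y, t)" "y \<in> carrier R" "t \<in> S" "frac_rel S (x, s) (y, t)"
    using assms(1) unfolding frac_def by auto
  then have "frac S x s = frac S y t"
    using frac_eq_iff[of x y s t] assms by (simp add: frac_rel_def)
  with p show thesis using that by simp
qed

lemma frac_self: "\<lbrakk>x \<in> carrier R; s \<in> S\<rbrakk> \<Longrightarrow> (x, s) \<in> frac S x s"
  using frac_rel_refl by (simp add: frac_def)

lemma frac_Union:
  assumes "x \<in> carrier R" "y \<in> carrier R" "s \<in> S" "t \<in> S"
    and "\<And>x' y' s' t'. \<lbrakk>x' \<in> carrier R; y' \<in> carrier R; s' \<in> S; t' \<in> S;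
      frac S x' s' = frac S x s; frac S y' t' = frac S y t\<rbrakk> \<Longrightarrow> F x' s' y' t' = F x s y t"
  shows "(\<Union>(x, s)\<in>frac S x s. \<Union>(y, t)\<in>frac S y t. F x s y t) = F x s y t"
proof -
  have "F x' s' y' t' = F x s y t" if "(x', s') \<in> frac S x s" "(y', t') \<in> frac S y t" for x' s' y' t'
    using in_fracD[OF that(1)] in_fracD[OF that(2)] assms by (metis prod.inject)
  moreover have "(x, s) \<in> frac S x s" "(y, t) \<in> frac S y t" using assms frac_self by auto
  ultimately show ?thesis by fast
qed

lemma frac_mult:
  assumes "x \<in> carrier R" "y \<in> carrier R" "s \<in> S" "t \<in> S"
  shows "frac S x s \<otimes>\<^bsub>loc S\<^esub> frac S y t = frac S (x \<otimes> y) (s \<otimes> t)"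
proof -
  have "frac S (x' \<otimes> y') (s' \<otimes> t') = frac S (x \<otimes> y) (s \<otimes> t)"
    if c: "x' \<in> carrier R" "y' \<in> carrier R" "s' \<in> S" "t' \<in> S"
      and eq: "frac S x' s' = frac S x s" "frac S y' t' = frac S y t" for x' y' s' t'
  proof -
    obtain u v where u: "u \<in> S" "u \<otimes> (x' \<otimes> s) = u \<otimes> (x \<otimes> s')"
      and v: "v \<in> S" "v \<otimes> (y' \<otimes> t) = v \<otimes> (y \<otimes> t')"
      using eq c assms by (auto simp: frac_eq_iff)
    have "(u \<otimes> v) \<otimes> ((x' \<otimes> y') \<otimes> (s \<otimes> t)) = (u \<otimes> (x' \<otimes> s)) \<otimes> (v \<otimes> (y' \<otimes> t))"
      using u(1) v(1) c assms by (simp add: m_ac)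
    also have "\<dots> = (u \<otimes> v) \<otimes> ((x \<otimes> y) \<otimes> (s' \<otimes> t'))"
      unfolding u(2) v(2) using u(1) v(1) c assms by (simp add: m_ac)
    finally show ?thesis using u(1) v(1) c assms by (intro frac_eq_iff[THEN iffD2] bexI[of _ "u \<otimes> v"]) simp_all
  qed
  then have "(\<Union>(x, s)\<in>frac S x s. \<Union>(y, t)\<in>frac S y t. frac S (x \<otimes> y) (s \<otimes> t))
    = frac S (x \<otimes> y) (s \<otimes> t)"
    by (intro frac_Union assms)
  then show ?thesis by (simp add: loc_def)
qed

lemma frac_add:
  assumes "x \<in> carrier R" "y \<in> carrier R" "s \<in> S" "t \<in> S"
  shows "frac S x s \<oplus>\<^bsub>loc S\<^esub> frac S y t = frac S (x \<otimes> t \<oplus> y \<otimes> s) (s \<otimes> t)"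
proof -
  have "frac S (x' \<otimes> t' \<oplus> y' \<otimes> s') (s' \<otimes> t') = frac S (x \<otimes> t \<oplus> y \<otimes> s) (s \<otimes> t)"
    if c: "x' \<in> carrier R" "y' \<in> carrier R" "s' \<in> S" "t' \<in> S"
      and eq: "frac S x' s' = frac S x s" "frac S y' t' = frac S y t" for x' y' s' t'
  proof -
    obtain u v where u: "u \<in> S" "u \<otimes> (x' \<otimes> s) = u \<otimes> (x \<otimes> s')"
      and v: "v \<in> S" "v \<otimes> (y' \<otimes> t) = v \<otimes> (y \<otimes> t')"
      using eq c assms by (auto simp: frac_eq_iff)
    have "(u \<otimes> v) \<otimes> ((x' \<otimes> t' \<oplus> y' \<otimes> s') \<otimes> (s \<otimes> t))
      = (u \<otimes> (x' \<otimes> s)) \<otimes> (v \<otimes> t \<otimes> t') \<oplus> (v \<otimes> (y' \<otimes> t)) \<otimes> (u \<otimes> s \<otimes> s')"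
      using u(1) v(1) c assms by (simp add: m_ac l_distr r_distr)
    also have "\<dots> = (u \<otimes> v) \<otimes> ((x \<otimes> t \<oplus> y \<otimes> s) \<otimes> (s' \<otimes> t'))"
      unfolding u(2) v(2) using u(1) v(1) c assms by (simp add: m_ac l_distr r_distr)
    finally show ?thesis using u(1) v(1) c assms by (intro frac_eq_iff[THEN iffD2] bexI[of _ "u \<otimes> v"]) simp_all
  qed
  then have "(\<Union>(x, s)\<in>frac S x s. \<Union>(y, t)\<in>frac S y t. frac S (x \<otimes> t \<oplus> y \<otimes> s) (s \<otimes> t))
    = frac S (x \<otimes> t \<oplus> y \<otimes> s) (s \<otimes> t)"
    by (intro frac_Union assms)
  then show ?thesis by (simp add: loc_def)
qed

lemma frac_closed [simp]: "\<lbrakk>x \<in> carrier R; s \<in> S\<rbrakk> \<Longrightarrow> frac S x s \<in> carrier (loc S)"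
  unfolding loc_def by auto

lemma loc_cases:
  assumes "X \<in> carrier (loc S)"
  obtains x s where "x \<in> carrier R" "s \<in> S" "X = frac S x s"
  using assms unfolding loc_def by auto

lemma loc_one: "\<one>\<^bsub>loc S\<^esub> = frac S \<one> \<one>" and loc_zero: "\<zero>\<^bsub>loc S\<^esub> = frac S \<zero> \<one>"
  unfolding loc_def by auto

lemma frac_eqI:
  assumes "x \<otimes> t = y \<otimes> s" "x \<in> carrier R" "y \<in> carrier R" "s \<in> S" "t \<in> S"
  shows "frac S x s = frac S y t"
  using assms S_one by (subst frac_eq_iff) auto

lemma loc_cring: "cring (loc S)"
proof (rule cringI)
  show "abelian_group (loc S)"
  proof (rule abelian_groupI)
    fix X assume "X \<in> carrier (loc S)"
    then obtain x s where X: "x \<in> carrier R" "s \<in> S" "X = frac S x s" by (rule loc_cases)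
    then have "frac S (\<ominus> x) s \<oplus>\<^bsub>loc S\<^esub> X = frac S (\<ominus> x \<otimes> s \<oplus> x \<otimes> s) (s \<otimes> s)"
      by (simp add: frac_add)
    also have "\<dots> = \<zero>\<^bsub>loc S\<^esub>" unfolding loc_zero using X by (intro frac_eqI) (simp_all add: l_minus l_neg)
    finally show "\<exists>Y\<in>carrier (loc S). Y \<oplus>\<^bsub>loc S\<^esub> X = \<zero>\<^bsub>loc S\<^esub>" using X by (meson a_inv_closed frac_closed)
    show "\<zero>\<^bsub>loc S\<^esub> \<oplus>\<^bsub>loc S\<^esub> X = X"
      unfolding loc_zero X(3) using X by (simp add: frac_add)
  next
    fix X Y assume "X \<in> carrier (loc S)" "Y \<in> carrier (loc S)"
    then obtain x s y t where X: "x \<in> carrier R" "s \<in> S" "X = frac S x s"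
      "y \<in> carrier R" "t \<in> S" "Y = frac S y t" by (metis loc_cases)
    then show "X \<oplus>\<^bsub>loc S\<^esub> Y \<in> carrier (loc S)" by (simp add: frac_add)
    show "X \<oplus>\<^bsub>loc S\<^esub> Y = Y \<oplus>\<^bsub>loc S\<^esub> X"
      using X by (simp add: frac_add a_comm m_comm)
  next
    fix X Y Z assume "X \<in> carrier (loc S)" "Y \<in> carrier (loc S)" "Z \<in> carrier (loc S)"
    then obtain x s y t z u where X: "x \<in> carrier R" "s \<in> S" "X = frac S x s"
      "y \<in> carrier R" "t \<in> S" "Y = frac S y t" "z \<in> carrier R" "u \<in> S" "Z = frac S z u"
      by (metis loc_cases)
    then show "X \<oplus>\<^bsub>loc S\<^esub> Y \<oplus>\<^bsub>loc S\<^esub> Z = X \<oplus>\<^bsub>loc S\<^esub> (Y \<oplus>\<^bsub>loc S\<^esub> Z)"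
      by (simp add: frac_add l_distr r_distr m_ac a_ac)
  qed (simp add: loc_zero)
  show "Group.comm_monoid (loc S)"
  proof (rule Group.comm_monoidI)
    fix X Y assume "X \<in> carrier (loc S)" "Y \<in> carrier (loc S)"
    then obtain x s y t where X: "x \<in> carrier R" "s \<in> S" "X = frac S x s"
      "y \<in> carrier R" "t \<in> S" "Y = frac S y t" by (metis loc_cases)
    then show "X \<otimes>\<^bsub>loc S\<^esub> Y \<in> carrier (loc S)" "X \<otimes>\<^bsub>loc S\<^esub> Y = Y \<otimes>\<^bsub>loc S\<^esub> X"
      "\<one>\<^bsub>loc S\<^esub> \<otimes>\<^bsub>loc S\<^esub> X = X"
      by (simp_all add: frac_mult m_comm loc_one)
  next
    fix X Y Z assume "X \<in> carrier (loc S)" "Y \<in> carrier (loc S)" "Z \<in> carrier (loc S)"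
    then obtain x s y t z u where X: "x \<in> carrier R" "s \<in> S" "X = frac S x s"
      "y \<in> carrier R" "t \<in> S" "Y = frac S y t" "z \<in> carrier R" "u \<in> S" "Z = frac S z u"
      by (metis loc_cases)
    then show "X \<otimes>\<^bsub>loc S\<^esub> Y \<otimes>\<^bsub>loc S\<^esub> Z = X \<otimes>\<^bsub>loc S\<^esub> (Y \<otimes>\<^bsub>loc S\<^esub> Z)"
      by (simp add: frac_mult m_assoc)
  qed (simp add: loc_one)
next
  fix X Y Z assume "X \<in> carrier (loc S)" "Y \<in> carrier (loc S)" "Z \<in> carrier (loc S)"
  then obtain x s y t z u where X: "x \<in> carrier R" "s \<in> S" "X = frac S x s"
    "y \<in> carrier R" "t \<in> S" "Y = frac S y t" "z \<in> carrier R" "u \<in> S" "Z = frac S z u"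
    by (metis loc_cases)
  then show "(X \<oplus>\<^bsub>loc S\<^esub> Y) \<otimes>\<^bsub>loc S\<^esub> Z = X \<otimes>\<^bsub>loc S\<^esub> Z \<oplus>\<^bsub>loc S\<^esub> Y \<otimes>\<^bsub>loc S\<^esub> Z"
    by (simp add: frac_mult frac_add) (rule frac_eqI; simp add: l_distr r_distr m_ac)
qed

definition \<phi> :: "'a \<Rightarrow> ('a \<times> 'a) set" where "\<phi> x = frac S x \<one>"

lemma \<phi>_hom: "ring_hom_cring R (loc S) \<phi>"
  by (intro ring_hom_cring.intro is_cring loc_cring ring_hom_cring_axioms.intro ring_hom_memI)
    (auto simp: \<phi>_def frac_mult frac_add loc_one)

lemma \<phi>_eq_zero_iff: "x \<in> carrier R \<Longrightarrow> \<phi> x = \<zero>\<^bsub>loc S\<^esub> \<longleftrightarrow> (\<exists>s\<in>S. s \<otimes> x = \<zero>)"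
  unfolding \<phi>_def loc_zero by (subst frac_eq_iff) auto

lemma \<phi>_unit: assumes "s \<in> S" shows "\<phi> s \<in> Units (loc S)"
proof -
  have "\<phi> s \<otimes>\<^bsub>loc S\<^esub> frac S \<one> s = frac S s s" "frac S \<one> s \<otimes>\<^bsub>loc S\<^esub> \<phi> s = frac S s s"
    using assms by (simp_all add: \<phi>_def frac_mult)
  moreover have "frac S s s = \<one>\<^bsub>loc S\<^esub>"
    unfolding loc_one using assms by (intro frac_eqI) simp_all
  moreover have "\<phi> s \<in> carrier (loc S)" "frac S \<one> s \<in> carrier (loc S)"
    using assms by (simp_all add: \<phi>_def)
  ultimately show ?thesis unfolding Units_def by (metis (mono_tags, lifting) mem_Collect_eq)
qed

lemma loc_num:
  assumes "z \<in> carrier (loc S)"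
  obtains x s where "x \<in> carrier R" "s \<in> S" "z \<otimes>\<^bsub>loc S\<^esub> \<phi> s = \<phi> x"
proof -
  obtain x s where X: "x \<in> carrier R" "s \<in> S" "z = frac S x s" using assms by (rule loc_cases)
  then have "z \<otimes>\<^bsub>loc S\<^esub> \<phi> s = \<phi> x"
    unfolding \<phi>_def by (simp add: frac_mult) (rule frac_eqI; simp)
  with X that show thesis by blast
qed

end

section \<open>What passes to the ring of fractions\<close>

context localization
begin

lemma loc_num_Units:
  assumes "z \<in> carrier (loc S)"
  obtains x u where "x \<in> carrier R" "u \<in> Units (loc S)" "\<phi> x = z \<otimes>\<^bsub>loc S\<^esub> u"
    "z = \<phi> x \<otimes>\<^bsub>loc S\<^esub> inv\<^bsub>loc S\<^esub> u"
proof -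
  interpret B: cring "loc S" by (rule loc_cring)
  obtain x s where xs: "x \<in> carrier R" "s \<in> S" "z \<otimes>\<^bsub>loc S\<^esub> \<phi> s = \<phi> x" using assms by (rule loc_num)
  note u = \<phi>_unit[OF xs(2)]
  have "z = (z \<otimes>\<^bsub>loc S\<^esub> \<phi> s) \<otimes>\<^bsub>loc S\<^esub> inv\<^bsub>loc S\<^esub> (\<phi> s)"
    using B.m_assoc[OF assms B.Units_closed[OF u] B.Units_inv_closed[OF u]] B.Units_r_inv[OF u] assms by simp
  then show thesis using xs by (intro that[of x "\<phi> s"] u) auto
qed

text \<open>Elements of \<open>S\<close> become units. An element outside \<open>S\<close> has a
  power killed by an element of \<open>S\<close>, so its image is nilpotent. Every fraction is one
  of these images up to a unit.\<close>

lemma nil_local_loc: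
  assumes "\<zero> \<notin> S" and max: "\<And>x. \<lbrakk>x \<in> carrier R; x \<notin> S\<rbrakk> \<Longrightarrow> \<exists>s\<in>S. \<exists>n::nat. s \<otimes> x [^] n = \<zero>"
    and nat: "\<And>n. 0 < (n::nat) \<Longrightarrow> [n] \<cdot>\<^bsub>R\<^esub> \<one> \<in> Units R"
  shows "nil_local (loc S)"
proof -
  interpret \<phi>: ring_hom_cring R "loc S" \<phi> by (rule \<phi>_hom)
  show ?thesis
  proof (intro nil_local.intro loc_cring nil_local_axioms.intro)
    show "\<one>\<^bsub>loc S\<^esub> \<noteq> \<zero>\<^bsub>loc S\<^esub>"
      using \<phi>_eq_zero_iff[of \<one>] assms(1) by auto
  next
    fix n :: nat assume n: "0 < n"
    then show "[n] \<cdot>\<^bsub>loc S\<^esub> \<one>\<^bsub>loc S\<^esub> \<in> Units (loc S)"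
      using \<phi>.hom_Units[OF nat[OF n]] \<phi>.hom_add_pow[of \<one> n] by simp
  next
    fix z assume "z \<in> carrier (loc S)"
    then obtain x u where xu: "x \<in> carrier R" "u \<in> Units (loc S)" "\<phi> x = z \<otimes>\<^bsub>loc S\<^esub> u"
      "z = \<phi> x \<otimes>\<^bsub>loc S\<^esub> inv\<^bsub>loc S\<^esub> u" by (rule loc_num_Units)
    show "z \<in> Units (loc S) \<or> nilpotent (loc S) z"
    proof (cases "x \<in> S")
      case True
      then show ?thesis using xu(2,4) \<phi>_unit by simp
    next
      case False
      then obtain s and n :: nat where s: "s \<in> S" "s \<otimes> x [^] n = \<zero>" using max xu(1) by blast
      then have "\<phi> (x [^] n) = \<zero>\<^bsub>loc S\<^esub>" using \<phi>_eq_zero_iff[of "x [^] n"] xu(1) by auto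
      then have "\<phi> x [^]\<^bsub>loc S\<^esub> n = \<zero>\<^bsub>loc S\<^esub>"
        using \<phi>.ring.hom_nat_pow[OF xu(1), of n] by simp
      then have "nilpotent (loc S) (\<phi> x)" using xu(1) unfolding nilpotent_def by auto
      then have "nilpotent (loc S) (inv\<^bsub>loc S\<^esub> u \<otimes>\<^bsub>loc S\<^esub> \<phi> x)"
        using xu(2) by (intro \<phi>.S.nilpotent_mult) auto
      then show ?thesis
        using xu(4) \<phi>.S.m_comm[OF \<phi>.S.Units_inv_closed[OF xu(2)] \<phi>.hom_closed[OF xu(1)]] by metis
    qed
  qed
qed

text \<open>An ideal of the localization is determined by its contraction, because each of its
  elements is a unit times the image of a numerator. So the maximal condition is read off in
  \<open>R\<close>. It is stated for families of ideals because \<open>finite_codimension\<close>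
  consumes it in that form.\<close>

lemma loc_maximal_ideal:
  assumes "noetherian_ring R" "\<F> \<noteq> {}" and ideal: "\<And>J. J \<in> \<F> \<Longrightarrow> ideal J (loc S)"
  shows "\<exists>J\<in>\<F>. \<forall>J'\<in>\<F>. J \<subseteq> J' \<longrightarrow> J' = J"
proof -
  interpret \<phi>: ring_hom_cring R "loc S" \<phi> by (rule \<phi>_hom)
  let ?h = "\<lambda>J. {x \<in> carrier R. \<phi> x \<in> J}"
  have mono: "?h J \<subseteq> ?h J' \<longleftrightarrow> J \<subseteq> J'" if J: "J \<in> \<F>" "J' \<in> \<F>" for J J'
  proof
    assume sub: "?h J \<subseteq> ?h J'"
    interpret J: ideal J "loc S" using ideal J by blast
    interpret J': ideal J' "loc S" using ideal J by blast
    show "J \<subseteq> J'"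
    proof
      fix z assume z: "z \<in> J"
      then have "z \<in> carrier (loc S)" by (rule J.a_Hcarr)
      then obtain x u where xu: "x \<in> carrier R" "u \<in> Units (loc S)" "\<phi> x = z \<otimes>\<^bsub>loc S\<^esub> u"
        "z = \<phi> x \<otimes>\<^bsub>loc S\<^esub> inv\<^bsub>loc S\<^esub> u" by (rule loc_num_Units)
      have "\<phi> x \<in> J" unfolding xu(3) using z xu(2) by (intro J.I_r_closed) auto
      then have "\<phi> x \<in> J'" using sub xu(1) by blast
      then show "z \<in> J'" by (subst xu(4)) (use xu(2) in \<open>auto intro: J'.I_r_closed\<close>)
    qed
  qed auto
  have "ideal (?h J) R" if "J \<in> \<F>" for J
    using \<phi>.ring.ideal_vimage ideal that by blast
  then obtain J where "J \<in> \<F>" "\<And>J'. \<lbrakk>J' \<in> \<F>; J \<subseteq> J'\<rbrakk> \<Longrightarrow> J' = J"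
    using noetherian_maximal[OF assms(1,2), of ?h] mono by blast
  then show ?thesis by blast
qed

text \<open>If \<open>x\<close> is a numerator of \<open>z\<close>, then
  \<open>a \<otimes> x\<close> vanishes in the localization, so some \<open>t\<close> in
  \<open>S\<close> kills it in \<open>R\<close>. The hypothesis then applies to
  \<open>t \<otimes> x\<close>, and \<open>t\<close> can be divided out again.\<close>

lemma loc_annihilator:
  assumes a: "a \<in> carrier R" and ann: "\<And>z. \<lbrakk>z \<in> carrier R; a \<otimes> z = \<zero>\<rbrakk> \<Longrightarrow> \<exists>w\<in>carrier R. z = a \<otimes> w"
    and z: "z \<in> carrier (loc S)" "\<phi> a \<otimes>\<^bsub>loc S\<^esub> z = \<zero>\<^bsub>loc S\<^esub>"
  shows "\<exists>w\<in>carrier (loc S). z = \<phi> a \<otimes>\<^bsub>loc S\<^esub> w"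
proof -
  interpret \<phi>: ring_hom_cring R "loc S" \<phi> by (rule \<phi>_hom)
  obtain x u where xu: "x \<in> carrier R" "u \<in> Units (loc S)" "\<phi> x = z \<otimes>\<^bsub>loc S\<^esub> u"
    "z = \<phi> x \<otimes>\<^bsub>loc S\<^esub> inv\<^bsub>loc S\<^esub> u" using z(1) by (rule loc_num_Units)
  note uc = \<phi>.S.Units_closed[OF xu(2)] \<phi>.S.Units_inv_closed[OF xu(2)]
  have "\<phi> (a \<otimes> x) = (\<phi> a \<otimes>\<^bsub>loc S\<^esub> z) \<otimes>\<^bsub>loc S\<^esub> u"
    using a xu(1,3) z(1) uc by (simp add: \<phi>.S.m_assoc)
  then have "\<phi> (a \<otimes> x) = \<zero>\<^bsub>loc S\<^esub>" using z(2) uc by simp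
  then obtain t where t: "t \<in> S" "t \<otimes> (a \<otimes> x) = \<zero>"
    using \<phi>_eq_zero_iff[of "a \<otimes> x"] a xu(1) by auto
  then have "a \<otimes> (t \<otimes> x) = \<zero>" using a xu(1) by (simp add: m_lcomm)
  then obtain w where w: "w \<in> carrier R" "t \<otimes> x = a \<otimes> w" using ann[of "t \<otimes> x"] t xu(1) by auto
  let ?v = "inv\<^bsub>loc S\<^esub> (\<phi> t)"
  have tU: "\<phi> t \<in> Units (loc S)" by (rule \<phi>_unit[OF t(1)])
  note tc = \<phi>.S.Units_closed[OF tU] \<phi>.S.Units_inv_closed[OF tU]
  have xR: "\<phi> x \<in> carrier (loc S)" "\<phi> a \<in> carrier (loc S)" "\<phi> w \<in> carrier (loc S)" using xu w a by auto
  have "\<phi> x = ?v \<otimes>\<^bsub>loc S\<^esub> (\<phi> t \<otimes>\<^bsub>loc S\<^esub> \<phi> x)"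
    using tU tc xR by (simp add: \<phi>.S.m_assoc[symmetric])
  also have "\<phi> t \<otimes>\<^bsub>loc S\<^esub> \<phi> x = \<phi> a \<otimes>\<^bsub>loc S\<^esub> \<phi> w" using w a t xu(1) by (simp flip: \<phi>.hom_mult)
  finally have "\<phi> x = \<phi> a \<otimes>\<^bsub>loc S\<^esub> (?v \<otimes>\<^bsub>loc S\<^esub> \<phi> w)" using tc xR by (simp add: \<phi>.S.m_lcomm)
  then have "z = \<phi> a \<otimes>\<^bsub>loc S\<^esub> (?v \<otimes>\<^bsub>loc S\<^esub> \<phi> w \<otimes>\<^bsub>loc S\<^esub> inv\<^bsub>loc S\<^esub> u)"
    using xu(4) tc xR uc by (simp add: \<phi>.S.m_assoc)
  then show ?thesis using tc xR uc by blast
qed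

end

text \<open>The complement of such a set is a minimal prime. The last property is maximality in
  usable form: adjoining an element outside \<open>S\<close> must bring in zero.\<close>

lemma (in cring) ex_maximal_multiplicative:
  assumes "\<one> \<noteq> \<zero>"
  obtains S where "localization R S" "\<zero> \<notin> S"
    "\<And>x. \<lbrakk>x \<in> carrier R; x \<notin> S\<rbrakk> \<Longrightarrow> \<exists>s\<in>S. \<exists>n::nat. s \<otimes> x [^] n = \<zero>"
proof -
  let ?\<F> = "{S. S \<subseteq> carrier R \<and> \<one> \<in> S \<and> (\<forall>s\<in>S. \<forall>t\<in>S. s \<otimes> t \<in> S) \<and> \<zero> \<notin> S}"
  have "\<exists>M\<in>?\<F>. \<forall>X\<in>?\<F>. M \<subseteq> X \<longrightarrow> X = M"
  proof (rule subset_Zorn_nonempty)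
    have "{\<one>} \<in> ?\<F>" using assms by simp
    then show "?\<F> \<noteq> {}" by blast
    fix C assume C: "C \<noteq> {}" "subset.chain ?\<F> C"
    have "s \<otimes> t \<in> \<Union>C" if "s \<in> \<Union>C" "t \<in> \<Union>C" for s t
    proof -
      from that obtain X Y where XY: "X \<in> C" "s \<in> X" "Y \<in> C" "t \<in> Y" by blast
      moreover have "X \<subseteq> Y \<or> Y \<subseteq> X" using C(2) XY(1,3) unfolding subset.chain_def by blast
      ultimately obtain Z where Z: "Z \<in> C" "s \<in> Z" "t \<in> Z" by blast
      then have "Z \<in> ?\<F>" using C(2) unfolding subset.chain_def by blast
      then have "s \<otimes> t \<in> Z" using Z by simp
      then show ?thesis using Z(1) by blast
    qed
    moreover have "\<Union>C \<subseteq> carrier R" "\<one> \<in> \<Union>C" "\<zero> \<notin> \<Union>C"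
      using C unfolding subset.chain_def by blast+
    ultimately show "\<Union>C \<in> ?\<F>" by simp
  qed
  then obtain S where SF: "S \<in> ?\<F>" and max: "\<forall>X\<in>?\<F>. S \<subseteq> X \<longrightarrow> X = S" by (rule bexE)
  show thesis
  proof (rule that[of S])
    show "localization R S"
      using SF by (intro localization.intro localization_axioms.intro is_cring) auto
    show "\<zero> \<notin> S" using SF by simp
    fix x assume x: "x \<in> carrier R" "x \<notin> S"
    \<comment> \<open>The multiplicative set generated by \<open>S\<close> and
      \<open>x\<close>.\<close>
    let ?X = "{s \<otimes> x [^] n | s (n::nat). s \<in> S}"
    show "\<exists>s\<in>S. \<exists>n::nat. s \<otimes> x [^] n = \<zero>"
    proof (rule ccontr)
      assume no: "\<not> (\<exists>s\<in>S. \<exists>n::nat. s \<otimes> x [^] n = \<zero>)"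
      have SR: "s \<in> carrier R" if "s \<in> S" for s using SF that by blast
      have mem: "s \<otimes> x [^] n \<in> ?X" if "s \<in> S" for s and n :: nat using that by blast
      have sub: "S \<subseteq> ?X"
      proof
        fix s assume s: "s \<in> S"
        show "s \<in> ?X" using mem[OF s, of 0] SR[OF s] by simp
      qed
      have "?X \<in> ?\<F>"
      proof (rule CollectI, intro conjI ballI)
        show "?X \<subseteq> carrier R" using SR x by auto
        show "\<one> \<in> ?X" using sub SF by blast
        show "\<zero> \<notin> ?X"
        proof
          assume "\<zero> \<in> ?X"
          then obtain s and n :: nat where "s \<in> S" "s \<otimes> x [^] n = \<zero>" by force
          then show False using no by blast
        qed
        fix p q assume "p \<in> ?X" "q \<in> ?X"
        then obtain s t and n m :: nat where st: "s \<in> S" "t \<in> S" "p = s \<otimes> x [^] n" "q = t \<otimes> x [^] m" by blast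
        have "p \<otimes> q = (s \<otimes> t) \<otimes> x [^] (n + m)"
          unfolding st using SR[OF st(1)] SR[OF st(2)] x(1) by (simp add: nat_pow_mult[symmetric] m_ac)
        moreover have "s \<otimes> t \<in> S" using SF st(1,2) by simp
        ultimately show "p \<otimes> q \<in> ?X" by blast
      qed
      then have "?X = S" using max sub by blast
      moreover have "\<one> \<in> S" using SF by simp
      then have "x \<in> ?X" using mem[of \<one> 1] x by simp
      ultimately show False using x(2) by simp
    qed
  qed
qed

section \<open>The trace form\<close>

lemma (in abelian_monoid) finsum_remove:
  assumes "finite V" "u \<in> V" "f \<in> V \<rightarrow> carrier G"
  shows "finsum G f V = f u \<oplus> finsum G f (V - {u})"
proof -
  have "finsum G f (insert u (V - {u})) = f u \<oplus> finsum G f (V - {u})"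
    using assms by (intro finsum_insert) auto
  then show ?thesis using assms(2) by (simp add: insert_absorb)
qed

lemma set_addI: "\<lbrakk>x \<in> H; y \<in> K\<rbrakk> \<Longrightarrow> x \<oplus>\<^bsub>G\<^esub> y \<in> H <+>\<^bsub>G\<^esub> K"
  unfolding set_add_def' by blast

lemma (in cring) ideal_add_cgenideal:
  assumes I: "ideal I R" and x: "x \<in> carrier R"
  shows "ideal (I <+>\<^bsub>R\<^esub> PIdl x) R" "I \<subseteq> I <+>\<^bsub>R\<^esub> PIdl x" "x \<in> I <+>\<^bsub>R\<^esub> PIdl x"
proof -
  interpret I: ideal I R by fact
  show "ideal (I <+>\<^bsub>R\<^esub> PIdl x) R" by (intro add_ideals I cgenideal_ideal x)
  have z: "\<zero> \<in> PIdl x" using cgenideal_ideal[OF x]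
    by (simp add: additive_subgroup.zero_closed ideal.axioms(1))
  show "I \<subseteq> I <+>\<^bsub>R\<^esub> PIdl x"
  proof
    fix i assume i: "i \<in> I"
    then have "i \<oplus> \<zero> \<in> I <+>\<^bsub>R\<^esub> PIdl x" using z by (rule set_addI)
    then show "i \<in> I <+>\<^bsub>R\<^esub> PIdl x" using I.a_Hcarr[OF i] by simp
  qed
  have "\<zero> \<oplus> x \<in> I <+>\<^bsub>R\<^esub> PIdl x" using cgenideal_self[OF x] I.zero_closed by (intro set_addI)
  then show "x \<in> I <+>\<^bsub>R\<^esub> PIdl x" using x by simp
qed

section \<open>Dimension over the coefficient field modulo an ideal\<close>

locale coefficient_field = nil_local +
  fixes L
  assumes L_subring: "subring L R"
    and L_inv: "\<lbrakk>u \<in> L; u \<noteq> \<zero>\<rbrakk> \<Longrightarrow> u \<in> Units R \<and> inv u \<in> L"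
    and L_dense: "x \<in> carrier R \<Longrightarrow> \<exists>l\<in>L. nilpotent R (x \<ominus> l)"
begin

lemma L_carrier [simp]: "l \<in> L \<Longrightarrow> l \<in> carrier R"
  using subringE(1)[OF L_subring] by blast

lemmas L_simps [simp] = subringE(2,3)[OF L_subring] subringE(5-7)[OF L_subring]

text \<open>The preimage in \<open>R\<close> of the \<open>L\<close>-span of \<open>V\<close> in the
  quotient by \<open>J\<close>, when \<open>J\<close> is an ideal. The inductive form permits rule
  induction; finite sums appear only when coordinates are extracted in
  \<open>lspan_coords\<close>.\<close>

inductive_set lspan :: "'a set \<Rightarrow> 'a set \<Rightarrow> 'a set" for J V where
  base: "j \<in> J \<Longrightarrow> j \<in> lspan J V"
| step: "\<lbrakk>v \<in> V; c \<in> L; z \<in> lspan J V\<rbrakk> \<Longrightarrow> c \<otimes> v \<oplus> z \<in> lspan J V"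

context
  fixes J assumes J: "ideal J R"
begin

interpretation J: ideal J R by (rule J)

lemma lspan_closed:
  assumes "z \<in> lspan J V" "V \<subseteq> carrier R"
  shows "z \<in> carrier R"
  using assms by induction auto

lemma lspan_add:
  assumes "z \<in> lspan J V" "w \<in> lspan J V" and V: "V \<subseteq> carrier R"
  shows "z \<oplus> w \<in> lspan J V"
  using assms(1)
proof induction
  case (base j)
  show ?case using assms(2)
  proof induction
    case (base k)
    then show ?case using \<open>j \<in> J\<close> by (intro lspan.base) simp
  next
    case (step v c z)
    have "j \<oplus> (c \<otimes> v \<oplus> z) = c \<otimes> v \<oplus> (j \<oplus> z)"
      using step \<open>j \<in> J\<close> V lspan_closed[OF step(3) V] by (intro a_lcomm) auto
    then show ?case using lspan.step[OF step(1,2,4)] by simp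
  qed
next
  case (step v c z)
  have "c \<otimes> v \<oplus> z \<oplus> w = c \<otimes> v \<oplus> (z \<oplus> w)"
    using step V lspan_closed[OF step(3) V] lspan_closed[OF assms(2) V] by (intro a_assoc) auto
  then show ?case using lspan.step[OF step(1,2,4)] by simp
qed

lemma lspan_smult:
  assumes "z \<in> lspan J V" "l \<in> L" and V: "V \<subseteq> carrier R"
  shows "l \<otimes> z \<in> lspan J V"
  using assms(1)
proof induction
  case (base j)
  then show ?case using assms by (intro lspan.base J.I_l_closed) auto
next
  case (step v c z)
  have "l \<otimes> (c \<otimes> v \<oplus> z) = (l \<otimes> c) \<otimes> v \<oplus> l \<otimes> z"
    using step assms V lspan_closed[OF step(3) V] by (auto simp: r_distr m_assoc subset_iff)
  then show ?case using lspan.step[OF step(1) _ step(4), of "l \<otimes> c"] step assms by simp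
qed

lemma lspan_gen: assumes "v \<in> V" "V \<subseteq> carrier R" shows "v \<in> lspan J V"
proof -
  have "\<one> \<otimes> v \<oplus> \<zero> \<in> lspan J V" using assms by (intro lspan.intros) auto
  then show ?thesis using assms by (simp add: subset_iff)
qed

lemma lspan_trans:
  assumes "V \<subseteq> lspan J W" "W \<subseteq> carrier R" "z \<in> lspan J V"
  shows "z \<in> lspan J W"
  using assms(3)
proof induction
  case (step v c z)
  then show ?case using assms by (intro lspan_add lspan_smult) auto
qed (rule lspan.base)

lemma lspan_finsum:
  assumes "finite U" "U \<subseteq> V" "V \<subseteq> carrier R" "\<And>v. v \<in> U \<Longrightarrow> c v \<in> L"
  shows "(\<Oplus>v\<in>U. c v \<otimes> v) \<in> lspan J V"
  using assms(1,2,4)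
proof (induction U)
  case empty
  then show ?case by (simp add: lspan.base)
next
  case (insert u U)
  have "(\<Oplus>v\<in>insert u U. c v \<otimes> v) = c u \<otimes> u \<oplus> (\<Oplus>v\<in>U. c v \<otimes> v)"
    using insert assms(3) by (intro finsum_insert) auto
  then show ?case using insert lspan.step[of u V "c u" _ J] by simp
qed

lemma lspan_coords:
  assumes "finite V" "V \<subseteq> carrier R" "z \<in> lspan J V"
  shows "\<exists>c j. (\<forall>v\<in>V. c v \<in> L) \<and> j \<in> J \<and> z = (\<Oplus>v\<in>V. c v \<otimes> v) \<oplus> j"
  using assms(3)
proof induction
  case (base j)
  have "(\<Oplus>v\<in>V. \<zero> \<otimes> v) = (\<Oplus>v\<in>V. \<zero>)" using assms by (intro finsum_cong') auto
  then show ?case using base by (intro exI[of _ "\<lambda>_. \<zero>"] exI[of _ j]) auto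
next
  case (step u b z)
  then obtain c j where c: "\<forall>v\<in>V. c v \<in> L" "j \<in> J" "z = (\<Oplus>v\<in>V. c v \<otimes> v) \<oplus> j" by blast
  let ?d = "\<lambda>v. if v = u then b \<oplus> c u else c v"
  have cl: "(\<lambda>v. c v \<otimes> v) \<in> V - {u} \<rightarrow> carrier R" using c(1) assms by auto
  have u: "b \<in> carrier R" "c u \<in> carrier R" "u \<in> carrier R" "j \<in> carrier R" using step c assms by auto
  have uV: "u \<in> V" using step by blast
  have "(\<Oplus>v\<in>V. ?d v \<otimes> v) = (b \<oplus> c u) \<otimes> u \<oplus> (\<Oplus>v\<in>V - {u}. ?d v \<otimes> v)"
    using c(1) step assms by (subst finsum_remove[OF assms(1) uV]) (auto intro!: m_closed)
  also have "(\<Oplus>v\<in>V - {u}. ?d v \<otimes> v) = (\<Oplus>v\<in>V - {u}. c v \<otimes> v)"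
    using cl by (intro finsum_cong') auto
  also have "(b \<oplus> c u) \<otimes> u \<oplus> (\<Oplus>v\<in>V - {u}. c v \<otimes> v) = b \<otimes> u \<oplus> (c u \<otimes> u \<oplus> (\<Oplus>v\<in>V - {u}. c v \<otimes> v))"
    using u finsum_closed[OF cl] by (simp add: l_distr a_assoc)
  also have "c u \<otimes> u \<oplus> (\<Oplus>v\<in>V - {u}. c v \<otimes> v) = (\<Oplus>v\<in>V. c v \<otimes> v)"
    using c(1) assms by (subst finsum_remove[OF assms(1) uV, of "\<lambda>v. c v \<otimes> v"]) auto
  finally have "b \<otimes> u \<oplus> z = (\<Oplus>v\<in>V. ?d v \<otimes> v) \<oplus> j"
    using u c assms by (simp add: a_assoc finsum_closed Pi_def subset_iff)
  then show ?case using c step by (intro exI[of _ ?d] exI[of _ j]) auto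
qed

text \<open>A spanning set of least cardinality is independent: a relation with a nonzero
  coefficient at \<open>u\<close> can be solved for \<open>u\<close>, because \<open>L\<close> is a
  field, and then \<open>u\<close> could be dropped.\<close>

lemma ex_basis_mod:
  assumes "finite V" "V \<subseteq> carrier R" "lspan J V = carrier R"
  obtains B where "finite B" "B \<subseteq> carrier R"
    "\<forall>z\<in>carrier R. \<exists>c j. (\<forall>v\<in>B. c v \<in> L) \<and> j \<in> J \<and> z = (\<Oplus>v\<in>B. c v \<otimes> v) \<oplus> j"
    "\<forall>c. (\<forall>v\<in>B. c v \<in> L) \<longrightarrow> (\<Oplus>v\<in>B. c v \<otimes> v) \<in> J \<longrightarrow> (\<forall>v\<in>B. c v = \<zero>)"
proof -
  let ?P = "\<lambda>V. finite V \<and> V \<subseteq> carrier R \<and> lspan J V = carrier R"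
  have "?P V" using assms by blast
  then obtain B where B: "?P B" and min: "\<And>V. ?P V \<Longrightarrow> card B \<le> card V"
    using ex_has_least_nat[of ?P V card] by blast
  show thesis
  proof (rule that[of B])
    show "\<forall>z\<in>carrier R. \<exists>c j. (\<forall>v\<in>B. c v \<in> L) \<and> j \<in> J \<and> z = (\<Oplus>v\<in>B. c v \<otimes> v) \<oplus> j"
      using B by (intro ballI lspan_coords) auto
    have "c u = \<zero>" if c: "\<And>v. v \<in> B \<Longrightarrow> c v \<in> L" "(\<Oplus>v\<in>B. c v \<otimes> v) \<in> J" and u: "u \<in> B" for c u
    proof (rule ccontr)
      assume cu: "c u \<noteq> \<zero>"
      have B': "B - {u} \<subseteq> carrier R" "finite (B - {u})" and uR: "u \<in> carrier R" using B u by auto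
      have cl: "(\<lambda>v. c v \<otimes> v) \<in> B - {u} \<rightarrow> carrier R" using c(1) B by auto
      let ?s = "\<Oplus>v\<in>B - {u}. c v \<otimes> v" and ?i = "inv (c u)"
      have i: "?i \<in> L" "c u \<in> Units R" using L_inv[OF c(1)[OF u] cu] by auto
      have s: "?s \<in> lspan J (B - {u})" using B' c by (intro lspan_finsum) auto
      have sR: "?s \<in> carrier R" using cl by (rule finsum_closed)
      have "(\<Oplus>v\<in>B. c v \<otimes> v) = c u \<otimes> u \<oplus> ?s"
        using B c(1) by (intro finsum_remove u) auto
      then have j: "c u \<otimes> u \<oplus> ?s \<in> J" using c(2) by simp
      \<comment> \<open>The relation lies in \<open>J\<close>, hence in the span. Subtracting the
        other terms and dividing by \<open>c u\<close> leaves \<open>u\<close>.\<close>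
      have "?i \<otimes> ((c u \<otimes> u \<oplus> ?s) \<oplus> (\<ominus> \<one>) \<otimes> ?s) \<in> lspan J (B - {u})"
        by (rule lspan_smult[OF lspan_add[OF lspan.base[OF j] lspan_smult[OF s _ B'(1)] B'(1)] i(1) B'(1)]) simp
      also have "(c u \<otimes> u \<oplus> ?s) \<oplus> (\<ominus> \<one>) \<otimes> ?s = c u \<otimes> u"
        using sR c(1)[OF u] uR by (simp add: l_minus a_assoc r_neg)
      also have "?i \<otimes> (c u \<otimes> u) = u"
        using i c(1)[OF u] uR by (simp add: m_assoc[symmetric])
      finally have "u \<in> lspan J (B - {u})" .
      then have "B \<subseteq> lspan J (B - {u})" using lspan_gen[OF _ B'(1)] by (metis Diff_iff insertE subsetI insert_iff empty_iff)
      then have "lspan J B \<subseteq> lspan J (B - {u})" using lspan_trans[OF _ B'(1)] by blast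
      moreover have "lspan J (B - {u}) \<subseteq> carrier R" using lspan_closed[OF _ B'(1)] by blast
      ultimately have "?P (B - {u})" using B' B by simp
      then have "card B \<le> card (B - {u})" by (rule min)
      then show False using u B by (meson card_Diff1_less not_less)
    qed
    then show "\<forall>c. (\<forall>v\<in>B. c v \<in> L) \<longrightarrow> (\<Oplus>v\<in>B. c v \<otimes> v) \<in> J \<longrightarrow> (\<forall>v\<in>B. c v = \<zero>)" by blast
  qed (use B in auto)
qed

end

text \<open>A maximal counterexample is a prime ideal, hence contains all nilpotent elements.\<close>

lemma finite_codimension:
  assumes noeth: "\<And>\<F>. \<lbrakk>\<F> \<noteq> {}; \<And>J. J \<in> \<F> \<Longrightarrow> ideal J R\<rbrakk> \<Longrightarrow> \<exists>J\<in>\<F>. \<forall>J'\<in>\<F>. J \<subseteq> J' \<longrightarrow> J' = J"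
    and "ideal J0 R"
  shows "\<exists>V. finite V \<and> V \<subseteq> carrier R \<and> lspan J0 V = carrier R"
proof (rule ccontr)
  let ?cof = "\<lambda>J. \<exists>V. finite V \<and> V \<subseteq> carrier R \<and> lspan J V = carrier R"
  let ?\<F> = "{J. ideal J R \<and> \<not> ?cof J}"
  assume "\<not> ?cof J0"
  then have "?\<F> \<noteq> {}" using assms(2) by blast
  then have "\<exists>J\<in>?\<F>. \<forall>J'\<in>?\<F>. J \<subseteq> J' \<longrightarrow> J' = J" by (rule noeth) simp
  then obtain J where JF: "J \<in> ?\<F>" and max: "\<forall>J'\<in>?\<F>. J \<subseteq> J' \<longrightarrow> J' = J" by (rule bexE)
  have J: "ideal J R" and nJ: "\<not> ?cof J" using JF by simp_all
  interpret J: ideal J R by (rule J)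
  have cof: "?cof J'" if "ideal J' R" "J \<subseteq> J'" "J' \<noteq> J" for J' using max that by blast
  have prime: "x \<in> J \<or> y \<in> J" if xy: "x \<in> carrier R" "y \<in> carrier R" "x \<otimes> y \<in> J" for x y
  proof (rule ccontr)
    assume n: "\<not> (x \<in> J \<or> y \<in> J)"
    \<comment> \<open>With \<open>?J1\<close> = J + xR and \<open>?J2\<close> = (J : x), the
      sequence 0 -> R/(J : x) -> R/J -> R/(J + xR) -> 0, whose first map is multiplication by
      \<open>x\<close>, has finite-dimensional ends, as both ideals are strictly larger than
      \<open>J\<close>. So R/J would be finite-dimensional, spanned by \<open>V\<close> and the
      multiples of \<open>W\<close> by \<open>x\<close>.\<close>
    let ?J1 = "J <+>\<^bsub>R\<^esub> PIdl x" and ?J2 = "{z \<in> carrier R. x \<otimes> z \<in> J}"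
    note J1 = ideal_add_cgenideal[OF J xy(1)]
    have I2: "ideal ?J2 R"
    proof (rule idealI[OF ring_axioms])
      show "subgroup ?J2 (add_monoid R)"
      proof (rule add.subgroupI)
        have "\<zero> \<in> ?J2" using xy(1) by simp
        then show "?J2 \<noteq> {}" by blast
        fix p assume p: "p \<in> ?J2"
        then show "\<ominus> p \<in> ?J2" using xy(1) by (simp add: r_minus)
        fix q assume q: "q \<in> ?J2"
        show "p \<oplus> q \<in> ?J2" using p q xy(1) by (simp add: r_distr)
      qed auto
      fix p q assume p: "p \<in> ?J2" and q: "q \<in> carrier R"
      then have "x \<otimes> (q \<otimes> p) = q \<otimes> (x \<otimes> p)" "x \<otimes> (p \<otimes> q) = (x \<otimes> p) \<otimes> q"
        using xy(1) by (simp_all add: m_lcomm m_assoc)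
      then show "q \<otimes> p \<in> ?J2" "p \<otimes> q \<in> ?J2"
        using p q J.I_l_closed J.I_r_closed by simp_all
    qed
    have sub2: "J \<subseteq> ?J2" using xy by (auto intro: J.I_l_closed)
    obtain V where V: "finite V" "V \<subseteq> carrier R" "lspan ?J1 V = carrier R"
      using cof[OF J1(1,2)] J1(3) n by blast
    obtain W where W: "finite W" "W \<subseteq> carrier R" "lspan ?J2 W = carrier R"
      using cof[OF I2 sub2] xy n by blast
    let ?U = "V \<union> (\<lambda>w. x \<otimes> w) ` W"
    have U: "finite ?U" "?U \<subseteq> carrier R" using V W xy by auto
    have *: "x \<otimes> r \<in> lspan J ?U" if "r \<in> lspan ?J2 W" for r
      using that
    proof induction
      case (base j)
      then show ?case by (intro lspan.base) auto
    next
      case (step w c z)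
      have zR: "z \<in> carrier R" using step W by simp
      have "x \<otimes> (c \<otimes> w \<oplus> z) = c \<otimes> (x \<otimes> w) \<oplus> x \<otimes> z"
        using step W zR xy by (auto simp: r_distr m_lcomm subset_iff)
      then show ?case using step lspan.step[of "x \<otimes> w" ?U c _ J] by simp
    qed
    have "z \<in> lspan J ?U" if "z \<in> lspan ?J1 V" for z
      using that
    proof induction
      case (base z)
      then obtain j r where jr: "j \<in> J" "r \<in> carrier R" "z = j \<oplus> r \<otimes> x"
        unfolding set_add_def' cgenideal_def by blast
      then have "z = j \<oplus> x \<otimes> r" using xy by (simp add: m_comm)
      moreover have "x \<otimes> r \<in> lspan J ?U" using * jr W by simp
      ultimately show ?case using lspan_add[OF J lspan.base[OF jr(1)] _ U(2)] by simp
    next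
      case (step v c z)
      then show ?case by (intro lspan.step) auto
    qed
    then have "lspan J ?U = carrier R" using V lspan_closed[OF J] U by blast
    then show False using nJ U by blast
  qed
  have nil: "x \<in> J" if x: "nilpotent R x" for x
  proof -
    obtain n :: nat where n: "x [^] n = \<zero>" "x \<in> carrier R" using x by (auto simp: nilpotent_def)
    \<comment> \<open>The disjunct \<open>\<one> \<in> J\<close> absorbs the exponent 0 and the unit
      ideal, which \<open>prime\<close> does not exclude; in that case \<open>x \<in> J\<close> as
      well.\<close>
    have "x [^] n \<in> J \<Longrightarrow> \<one> \<in> J \<or> x \<in> J"
    proof (induction n)
      case (Suc n)
      then show ?case using prime[of "x [^] n" x] n by auto
    qed simp
    then have "\<one> \<in> J \<or> x \<in> J" using n J.zero_closed by simp
    then show ?thesis using J.one_imp_carrier n by blast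
  qed
  \<comment> \<open>\<open>L\<close> represents the residue field, so once \<open>J\<close> contains
    the nilpotents the quotient is spanned by 1, contrary to the choice of \<open>J\<close>.\<close>
  have "z \<in> lspan J {\<one>}" if z: "z \<in> carrier R" for z
  proof -
    obtain l where l: "l \<in> L" "nilpotent R (z \<ominus> l)" using L_dense z by blast
    have "l \<otimes> \<one> \<oplus> (z \<ominus> l) \<in> lspan J {\<one>}" using l nil by (intro lspan.intros) auto
    also have "l \<otimes> \<one> \<oplus> (z \<ominus> l) = z" using l z by (simp add: a_minus_def a_lcomm[of l z] r_neg)
    finally show ?thesis .
  qed
  then have "lspan J {\<one>} = carrier R" using lspan_closed[OF J, of _ "{\<one>}"] by auto
  then show False using nJ by (metis empty_subsetI finite.intros insert_subset one_closed)
qed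

end

section \<open>First-order expansions in a basis modulo \<open>a\<close>\<close>

lemma (in abelian_monoid) finsum_swap:
  assumes "finite U" "finite V" "\<And>u v. u \<in> U \<Longrightarrow> v \<in> V \<Longrightarrow> g u v \<in> carrier G"
  shows "(\<Oplus>u\<in>U. \<Oplus>v\<in>V. g u v) = (\<Oplus>v\<in>V. \<Oplus>u\<in>U. g u v)"
  using assms(1,3)
proof (induction U)
  case empty
  then show ?case by simp
next
  case (insert u U)
  then have IH: "(\<Oplus>u\<in>U. \<Oplus>v\<in>V. g u v) = (\<Oplus>v\<in>V. \<Oplus>u\<in>U. g u v)" by simp
  have "(\<Oplus>u\<in>insert u U. \<Oplus>v\<in>V. g u v) = (\<Oplus>v\<in>V. g u v) \<oplus> (\<Oplus>u\<in>U. \<Oplus>v\<in>V. g u v)"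
    using insert by (intro finsum_insert) (auto intro!: finsum_closed)
  also have "\<dots> = (\<Oplus>v\<in>V. g u v \<oplus> (\<Oplus>u\<in>U. g u v))"
    unfolding IH using insert by (intro finsum_addf[symmetric]) (auto intro!: finsum_closed)
  also have "\<dots> = (\<Oplus>v\<in>V. \<Oplus>u\<in>insert u U. g u v)"
    using insert by (intro finsum_cong' finsum_insert[symmetric]) (auto intro!: finsum_closed)
  finally show ?case .
qed

text \<open>\<open>B\<close> represents an \<open>L\<close>-basis of \<open>R/aR\<close>,
  \<open>c\<close> gives the coordinates of a residue class, and \<open>W\<close> is the next
  coefficient in an expansion along powers of \<open>a\<close>. \<open>W\<close> is an arbitrary
  choice; \<open>ann\<close> determines it modulo \<open>a\<close>, and traces read nothing
  finer.\<close>

locale basis_mod = coefficient_field +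
  fixes a B c W
  assumes a_closed [simp]: "a \<in> carrier R"
    and ann: "\<lbrakk>z \<in> carrier R; a \<otimes> z = \<zero>\<rbrakk> \<Longrightarrow> \<exists>w\<in>carrier R. z = a \<otimes> w"
    and finite_B: "finite B" and B_sub: "B \<subseteq> carrier R"
    and c_L: "\<lbrakk>z \<in> carrier R; v \<in> B\<rbrakk> \<Longrightarrow> c z v \<in> L"
    and W_closed [simp]: "z \<in> carrier R \<Longrightarrow> W z \<in> carrier R"
    and decomp: "z \<in> carrier R \<Longrightarrow> z = (\<Oplus>v\<in>B. c z v \<otimes> v) \<oplus> a \<otimes> W z"
    and indep: "\<lbrakk>\<And>v. v \<in> B \<Longrightarrow> e v \<in> L; w \<in> carrier R; (\<Oplus>v\<in>B. e v \<otimes> v) = a \<otimes> w; v \<in> B\<rbrakk> \<Longrightarrow> e v = \<zero>"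
begin

lemma B_carrier [simp]: "v \<in> B \<Longrightarrow> v \<in> carrier R" using B_sub by auto

lemma c_closed [simp]: "\<lbrakk>z \<in> carrier R; v \<in> B\<rbrakk> \<Longrightarrow> c z v \<in> carrier R" using c_L by simp

definition \<sigma> where "\<sigma> z = (\<Oplus>v\<in>B. c z v \<otimes> v)"

definition cong (infix \<open>\<approx>\<close> 50) where "x \<approx> y \<longleftrightarrow> (\<exists>w\<in>carrier R. x = y \<oplus> a \<otimes> w)"

lemma \<sigma>_closed [simp]: "z \<in> carrier R \<Longrightarrow> \<sigma> z \<in> carrier R"
  unfolding \<sigma>_def by (auto intro: finsum_closed)

lemma \<sigma>_decomp: "z \<in> carrier R \<Longrightarrow> z = \<sigma> z \<oplus> a \<otimes> W z"
  unfolding \<sigma>_def by (rule decomp)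

lemma cong_refl [simp]: "x \<in> carrier R \<Longrightarrow> x \<approx> x"
  unfolding cong_def by (auto intro!: bexI[of _ \<zero>])

lemma cong_sym: "\<lbrakk>x \<approx> y; y \<in> carrier R\<rbrakk> \<Longrightarrow> y \<approx> x"
  unfolding cong_def
proof (elim bexE)
  fix w assume "w \<in> carrier R" "x = y \<oplus> a \<otimes> w" "y \<in> carrier R"
  then show "\<exists>w\<in>carrier R. y = x \<oplus> a \<otimes> w"
    by (intro bexI[of _ "\<ominus> w"]) (simp_all add: r_minus a_assoc r_neg)
qed

lemma cong_trans: "\<lbrakk>x \<approx> y; y \<approx> z; z \<in> carrier R\<rbrakk> \<Longrightarrow> x \<approx> z"
  unfolding cong_def
proof (elim bexE)
  fix w w' assume "w \<in> carrier R" "w' \<in> carrier R" "x = y \<oplus> a \<otimes> w" "y = z \<oplus> a \<otimes> w'" "z \<in> carrier R"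
  then show "\<exists>w\<in>carrier R. x = z \<oplus> a \<otimes> w"
    by (intro bexI[of _ "w' \<oplus> w"]) (simp_all add: r_distr a_assoc)
qed

lemma cong_add:
  assumes "x \<approx> y" "x' \<approx> y'" "y \<in> carrier R" "y' \<in> carrier R"
  shows "x \<oplus> x' \<approx> y \<oplus> y'"
proof -
  obtain w w' where "w \<in> carrier R" "w' \<in> carrier R" "x = y \<oplus> a \<otimes> w" "x' = y' \<oplus> a \<otimes> w'"
    using assms(1,2) unfolding cong_def by blast
  then show ?thesis unfolding cong_def using assms(3,4)
    by (intro bexI[of _ "w \<oplus> w'"]) (simp_all add: r_distr a_ac)
qed

lemma cong_mult:
  assumes "x \<approx> y" "z \<in> carrier R" "y \<in> carrier R"
  shows "z \<otimes> x \<approx> z \<otimes> y"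
proof -
  obtain w where "w \<in> carrier R" "x = y \<oplus> a \<otimes> w" using assms(1) unfolding cong_def by blast
  then show ?thesis unfolding cong_def using assms
    by (intro bexI[of _ "z \<otimes> w"]) (simp_all add: r_distr m_lcomm)
qed

lemma cong_a: "w \<in> carrier R \<Longrightarrow> a \<otimes> w \<approx> \<zero>"
  unfolding cong_def by (rule bexI[of _ w]) simp_all

text \<open>Flatness in working form: \<open>a\<close> may be cancelled, at the cost of knowing the
  result only modulo \<open>a\<close>. This makes the first-order part \<open>W\<close> unique
  modulo \<open>a\<close>.\<close>

lemma a_cancel:
  assumes "p \<in> carrier R" "q \<in> carrier R" "a \<otimes> p = a \<otimes> q"
  shows "p \<approx> q"
proof -
  have "a \<otimes> (p \<ominus> q) = \<zero>" using assms by (simp add: a_minus_def r_distr r_minus r_neg)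
  then obtain w where "w \<in> carrier R" "p \<ominus> q = a \<otimes> w" using ann[of "p \<ominus> q"] assms by auto
  moreover have "p = q \<oplus> (p \<ominus> q)" using assms by (simp add: a_minus_def a_lcomm[of q p] r_neg)
  ultimately show ?thesis unfolding cong_def by metis
qed

text \<open>Two expansions of \<open>z\<close> differ by a relation whose other side is a multiple
  of \<open>a\<close>, so \<open>indep\<close> applies. The algebraic rules for \<open>c\<close>
  follow by exhibiting an expansion and reading off its coordinates.\<close>

lemma coords:
  assumes e: "\<And>v. v \<in> B \<Longrightarrow> e v \<in> L" and w: "w \<in> carrier R"
    and z: "z = (\<Oplus>v\<in>B. e v \<otimes> v) \<oplus> a \<otimes> w" and v: "v \<in> B"
  shows "c z v = e v"
proof -
  have zR: "z \<in> carrier R" unfolding z using e w by (auto intro!: finsum_closed)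
  let ?S = "\<Oplus>v\<in>B. c z v \<otimes> v" and ?E = "\<Oplus>v\<in>B. e v \<otimes> v"
  have cl: "?S \<in> carrier R" "?E \<in> carrier R" using zR e by (auto intro!: finsum_closed)
  have neg: "(\<Oplus>v\<in>B. \<ominus> (e v \<otimes> v)) = \<ominus> ?E"
  proof -
    have "(\<Oplus>v\<in>B. \<ominus> \<one> \<otimes> (e v \<otimes> v)) = \<ominus> \<one> \<otimes> ?E"
      using e finite_B by (intro finsum_rdistr[symmetric]) auto
    moreover have "(\<Oplus>v\<in>B. \<ominus> \<one> \<otimes> (e v \<otimes> v)) = (\<Oplus>v\<in>B. \<ominus> (e v \<otimes> v))"
      using e by (intro finsum_cong') (auto simp: l_minus)
    ultimately show ?thesis using cl by (simp add: l_minus)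
  qed
  have "(\<Oplus>v\<in>B. (c z v \<ominus> e v) \<otimes> v) = (\<Oplus>v\<in>B. c z v \<otimes> v \<oplus> \<ominus> (e v \<otimes> v))"
    using zR e by (intro finsum_cong') (auto simp: a_minus_def l_distr l_minus)
  also have "\<dots> = ?S \<ominus> ?E"
    unfolding a_minus_def neg[symmetric] using zR e by (intro finsum_addf) auto
  also have "\<dots> = a \<otimes> (w \<ominus> W z)"
  proof -
    have eq: "?S \<oplus> a \<otimes> W z = ?E \<oplus> a \<otimes> w" using decomp[OF zR] z by simp
    have "?S \<ominus> ?E = (?S \<oplus> a \<otimes> W z) \<oplus> (\<ominus> ?E \<oplus> \<ominus> (a \<otimes> W z))"
      using cl zR by (simp add: a_minus_def a_assoc a_lcomm[of "a \<otimes> W z"] r_neg)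
    also have "\<dots> = a \<otimes> w \<oplus> \<ominus> (a \<otimes> W z)"
      unfolding eq using cl zR w by (simp add: a_assoc a_lcomm[of "a \<otimes> w"] r_neg2)
    finally show ?thesis using w zR by (simp add: a_minus_def r_distr r_minus)
  qed
  finally have "c z v \<ominus> e v = \<zero>"
    using indep[of "\<lambda>v. c z v \<ominus> e v" "w \<ominus> W z" v] c_L[OF zR] e w zR v by (simp add: a_minus_def)
  then show ?thesis using zR v e by (simp add: r_right_minus_eq)
qed

lemma c_cong:
  assumes "x \<approx> y" "y \<in> carrier R" "v \<in> B"
  shows "c x v = c y v"
proof -
  obtain w where w: "w \<in> carrier R" "x = y \<oplus> a \<otimes> w" using assms(1) unfolding cong_def by blast
  have "x = (\<Oplus>v\<in>B. c y v \<otimes> v) \<oplus> a \<otimes> (W y \<oplus> w)"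
    using decomp[OF assms(2)] w assms(2) unfolding w(2)
    by (metis (no_types, lifting) a_assoc a_closed W_closed \<sigma>_closed \<sigma>_def m_closed r_distr)
  then show ?thesis using coords[of "c y" "W y \<oplus> w" x v] c_L assms w by simp
qed

lemma c_add:
  assumes "x \<in> carrier R" "y \<in> carrier R" "v \<in> B"
  shows "c (x \<oplus> y) v = c x v \<oplus> c y v"
proof (rule coords)
  have "(\<Oplus>v\<in>B. (c x v \<oplus> c y v) \<otimes> v) = (\<Oplus>v\<in>B. c x v \<otimes> v \<oplus> c y v \<otimes> v)"
    using assms by (intro finsum_cong') (auto simp: l_distr)
  also have "\<dots> = \<sigma> x \<oplus> \<sigma> y" unfolding \<sigma>_def using assms by (intro finsum_addf) auto
  finally have "(\<Oplus>v\<in>B. (c x v \<oplus> c y v) \<otimes> v) \<oplus> a \<otimes> (W x \<oplus> W y) = (\<sigma> x \<oplus> a \<otimes> W x) \<oplus> (\<sigma> y \<oplus> a \<otimes> W y)"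
    using assms by (simp add: r_distr a_ac)
  then show "x \<oplus> y = (\<Oplus>v\<in>B. (c x v \<oplus> c y v) \<otimes> v) \<oplus> a \<otimes> (W x \<oplus> W y)"
    using \<sigma>_decomp assms(1,2) by simp
qed (use assms c_L in auto)

lemma c_smult:
  assumes "x \<in> carrier R" "l \<in> L" "v \<in> B"
  shows "c (l \<otimes> x) v = l \<otimes> c x v"
proof (rule coords)
  have "(\<Oplus>v\<in>B. (l \<otimes> c x v) \<otimes> v) = (\<Oplus>v\<in>B. l \<otimes> (c x v \<otimes> v))"
    using assms by (intro finsum_cong') (auto simp: m_assoc)
  also have "\<dots> = l \<otimes> \<sigma> x" unfolding \<sigma>_def using assms finite_B by (intro finsum_rdistr[symmetric]) auto
  finally have "(\<Oplus>v\<in>B. (l \<otimes> c x v) \<otimes> v) \<oplus> a \<otimes> (l \<otimes> W x) = l \<otimes> (\<sigma> x \<oplus> a \<otimes> W x)"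
    using assms by (simp add: r_distr m_lcomm)
  then show "l \<otimes> x = (\<Oplus>v\<in>B. (l \<otimes> c x v) \<otimes> v) \<oplus> a \<otimes> (l \<otimes> W x)"
    using \<sigma>_decomp assms(1) by simp
qed (use assms c_L in auto)

lemma c_zero: "v \<in> B \<Longrightarrow> c \<zero> v = \<zero>"
  using c_smult[of \<zero> \<zero> v] by simp

lemma c_finsum:
  assumes "finite U" "f \<in> U \<rightarrow> carrier R" "v \<in> B"
  shows "c (\<Oplus>u\<in>U. f u) v = (\<Oplus>u\<in>U. c (f u) v)"
  using assms
proof (induction U)
  case (insert u U)
  then have f: "f \<in> U \<rightarrow> carrier R" "f u \<in> carrier R" by auto
  have "c (\<Oplus>u\<in>insert u U. f u) v = c (f u \<oplus> (\<Oplus>u\<in>U. f u)) v"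
    using insert f by (subst finsum_insert) auto
  also have "\<dots> = c (f u) v \<oplus> (\<Oplus>u\<in>U. c (f u) v)"
    using insert f by (subst c_add) (auto intro!: finsum_closed)
  also have "\<dots> = (\<Oplus>u\<in>insert u U. c (f u) v)"
    using insert f by (intro finsum_insert[symmetric]) (auto intro!: c_closed)
  finally show ?case .
qed (simp add: c_zero)

lemma c_basis:
  assumes "u \<in> B" "v \<in> B"
  shows "c u v = (if v = u then \<one> else \<zero>)"
proof (rule coords)
  have "(\<Oplus>v\<in>B. (if v = u then \<one> else \<zero>) \<otimes> v) = (\<Oplus>v\<in>B. if u = v then v else \<zero>)"
    by (intro finsum_cong') auto
  also have "\<dots> = u" using finsum_singleton[OF assms(1) finite_B, of "\<lambda>v. v"] by auto
  finally show "u = (\<Oplus>v\<in>B. (if v = u then \<one> else \<zero>) \<otimes> v) \<oplus> a \<otimes> \<zero>" using assms by simp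
qed (use assms in auto)

lemma \<sigma>_cong: "x \<approx> y \<Longrightarrow> y \<in> carrier R \<Longrightarrow> \<sigma> x = \<sigma> y"
  unfolding \<sigma>_def by (intro finsum_cong') (auto simp: c_cong)

lemma \<sigma>_approx: assumes "x \<in> carrier R" shows "\<sigma> x \<approx> x"
proof -
  have "x \<approx> \<sigma> x" unfolding cong_def by (rule bexI[of "\<lambda>w. x = \<sigma> x \<oplus> a \<otimes> w", OF \<sigma>_decomp[OF assms] W_closed[OF assms]])
  then show ?thesis using \<sigma>_closed[OF assms] by (rule cong_sym)
qed

lemma \<sigma>_add: "\<lbrakk>x \<in> carrier R; y \<in> carrier R\<rbrakk> \<Longrightarrow> \<sigma> (x \<oplus> y) = \<sigma> x \<oplus> \<sigma> y"
proof -
  assume xy: "x \<in> carrier R" "y \<in> carrier R"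
  have "\<sigma> (x \<oplus> y) = (\<Oplus>v\<in>B. c x v \<otimes> v \<oplus> c y v \<otimes> v)"
    unfolding \<sigma>_def using xy by (intro finsum_cong') (auto simp: c_add l_distr)
  also have "\<dots> = \<sigma> x \<oplus> \<sigma> y" unfolding \<sigma>_def using xy by (intro finsum_addf) auto
  finally show ?thesis .
qed

lemma \<sigma>_smult: "\<lbrakk>x \<in> carrier R; l \<in> L\<rbrakk> \<Longrightarrow> \<sigma> (l \<otimes> x) = l \<otimes> \<sigma> x"
proof -
  assume x: "x \<in> carrier R" "l \<in> L"
  have "\<sigma> (l \<otimes> x) = (\<Oplus>v\<in>B. l \<otimes> (c x v \<otimes> v))"
    unfolding \<sigma>_def using x by (intro finsum_cong') (auto simp: c_smult m_assoc)
  also have "\<dots> = l \<otimes> \<sigma> x" unfolding \<sigma>_def using x finite_B by (intro finsum_rdistr[symmetric]) auto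
  finally show ?thesis .
qed

text \<open>The counterpart of \<open>coords\<close> for the first-order part:
  \<open>\<sigma> q = q\<close> identifies \<open>q\<close> with \<open>\<sigma> p\<close>, and the
  remaining equation between multiples of \<open>a\<close> is settled by
  \<open>a_cancel\<close>.\<close>

lemma W_eq:
  assumes "p = q \<oplus> a \<otimes> r" "q \<in> carrier R" "\<sigma> q = q" "r \<in> carrier R"
  shows "W p \<approx> r"
proof (rule a_cancel)
  have p: "p \<in> carrier R" using assms by simp
  then show "W p \<in> carrier R" by simp
  have "p \<approx> q" unfolding cong_def using assms by blast
  then have "\<sigma> p = q" using \<sigma>_cong assms by simp
  then have "q \<oplus> a \<otimes> W p = q \<oplus> a \<otimes> r" using \<sigma>_decomp[OF p] assms(1) by simp
  then show "a \<otimes> W p = a \<otimes> r" using p assms by simp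
qed (rule assms)

lemma \<sigma>_idem: "x \<in> carrier R \<Longrightarrow> \<sigma> (\<sigma> x) = \<sigma> x"
  by (rule \<sigma>_cong[OF \<sigma>_approx])

lemma W_add:
  assumes "x \<in> carrier R" "y \<in> carrier R" shows "W (x \<oplus> y) \<approx> W x \<oplus> W y"
proof (rule W_eq)
  have "x \<oplus> y = (\<sigma> x \<oplus> a \<otimes> W x) \<oplus> (\<sigma> y \<oplus> a \<otimes> W y)" using \<sigma>_decomp assms by simp
  also have "\<dots> = (\<sigma> x \<oplus> \<sigma> y) \<oplus> a \<otimes> (W x \<oplus> W y)" using assms by (simp add: r_distr a_ac)
  finally show "x \<oplus> y = (\<sigma> x \<oplus> \<sigma> y) \<oplus> a \<otimes> (W x \<oplus> W y)" .
qed (use assms in \<open>auto simp: \<sigma>_add \<sigma>_idem\<close>)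

lemma W_smult:
  assumes "x \<in> carrier R" "l \<in> L" shows "W (l \<otimes> x) \<approx> l \<otimes> W x"
proof (rule W_eq)
  have "l \<otimes> x = l \<otimes> (\<sigma> x \<oplus> a \<otimes> W x)" using \<sigma>_decomp assms by simp
  also have "\<dots> = l \<otimes> \<sigma> x \<oplus> a \<otimes> (l \<otimes> W x)" using assms by (simp add: r_distr m_lcomm)
  finally show "l \<otimes> x = l \<otimes> \<sigma> x \<oplus> a \<otimes> (l \<otimes> W x)" .
qed (use assms in \<open>auto simp: \<sigma>_smult \<sigma>_idem\<close>)

lemma W_zero: "W \<zero> \<approx> \<zero>"
  using W_smult[of \<zero> \<zero>] by simp

text \<open>These are the maps that induce an \<open>L\<close>-linear endomorphism of \<open>R/aR\<close>.\<close>

definition lin where "lin f \<longleftrightarrow> (\<forall>x\<in>carrier R. f x \<in> carrier R) \<and>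
  (\<forall>x\<in>carrier R. \<forall>y\<in>carrier R. f (x \<oplus> y) \<approx> f x \<oplus> f y) \<and>
  (\<forall>l\<in>L. \<forall>x\<in>carrier R. f (l \<otimes> x) \<approx> l \<otimes> f x) \<and>
  (\<forall>x\<in>carrier R. f (a \<otimes> x) \<approx> \<zero>)"

definition trace where "trace f = (\<Oplus>v\<in>B. c (f v) v)"

lemma trace_cong:
  assumes "\<And>v. v \<in> B \<Longrightarrow> f v \<approx> g v" "\<And>v. v \<in> B \<Longrightarrow> g v \<in> carrier R"
  shows "trace f = trace g"
  unfolding trace_def using assms by (intro finsum_cong') (auto simp: c_cong)

lemma trace_add:
  assumes "\<And>v. v \<in> B \<Longrightarrow> f v \<in> carrier R" "\<And>v. v \<in> B \<Longrightarrow> g v \<in> carrier R"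
  shows "trace (\<lambda>v. f v \<oplus> g v) = trace f \<oplus> trace g"
proof -
  have "trace (\<lambda>v. f v \<oplus> g v) = (\<Oplus>v\<in>B. c (f v) v \<oplus> c (g v) v)"
    unfolding trace_def using assms by (intro finsum_cong') (auto simp: c_add)
  also have "\<dots> = trace f \<oplus> trace g" unfolding trace_def using assms by (intro finsum_addf) auto
  finally show ?thesis .
qed

lemma lin_cong:
  assumes f: "lin f" and "x \<approx> y" "y \<in> carrier R" shows "f x \<approx> f y"
proof -
  obtain w where w: "w \<in> carrier R" "x = y \<oplus> a \<otimes> w" using assms(2) unfolding cong_def by blast
  have "f x \<approx> f y \<oplus> f (a \<otimes> w)" unfolding w(2) using f w assms(3) by (simp add: lin_def)
  moreover have "f y \<oplus> f (a \<otimes> w) \<approx> f y \<oplus> \<zero>"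
    using f w assms(3) by (intro cong_add) (simp_all add: lin_def)
  ultimately show ?thesis using f assms(3) cong_trans[of "f x" _ "f y"] by (simp add: lin_def)
qed

lemma lin_finsum:
  assumes f: "lin f" and "finite U" "U \<subseteq> B" "\<And>u. u \<in> U \<Longrightarrow> e u \<in> L"
  shows "f (\<Oplus>u\<in>U. e u \<otimes> u) \<approx> (\<Oplus>u\<in>U. e u \<otimes> f u)"
  using assms(2-4)
proof (induction U)
  case empty
  have "f (a \<otimes> \<zero>) \<approx> \<zero>" using f unfolding lin_def by blast
  then show ?case by simp
next
  case (insert u U)
  have fc: "f x \<in> carrier R" if "x \<in> carrier R" for x using f that unfolding lin_def by blast
  have u: "u \<in> carrier R" "e u \<in> L" using insert by auto
  have cl: "(\<lambda>u. e u \<otimes> u) \<in> U \<rightarrow> carrier R" "(\<lambda>u. e u \<otimes> f u) \<in> U \<rightarrow> carrier R"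
    using insert fc by auto
  note s = finsum_closed[OF cl(1)] finsum_closed[OF cl(2)]
  have "(\<Oplus>u\<in>insert u U. e u \<otimes> u) = e u \<otimes> u \<oplus> (\<Oplus>u\<in>U. e u \<otimes> u)"
    using insert cl u by (intro finsum_insert) auto
  moreover have "f (e u \<otimes> u \<oplus> (\<Oplus>u\<in>U. e u \<otimes> u)) \<approx> f (e u \<otimes> u) \<oplus> f (\<Oplus>u\<in>U. e u \<otimes> u)"
    using f u s unfolding lin_def by simp
  moreover have "f (e u \<otimes> u) \<oplus> f (\<Oplus>u\<in>U. e u \<otimes> u) \<approx> e u \<otimes> f u \<oplus> (\<Oplus>u\<in>U. e u \<otimes> f u)"
    using insert f u s fc by (intro cong_add) (auto simp: lin_def)
  moreover have "(\<Oplus>u\<in>insert u U. e u \<otimes> f u) = e u \<otimes> f u \<oplus> (\<Oplus>u\<in>U. e u \<otimes> f u)"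
    using insert cl u fc by (intro finsum_insert) auto
  ultimately show ?case using u s fc
    by (metis (no_types, lifting) L_carrier a_closed add.m_closed cong_trans m_closed)
qed

text \<open>Taking coordinates turns the congruences in \<open>lin\<close> into equalities, so
  \<open>f\<close> acts through the matrix with entries \<open>c (f u) v\<close>.\<close>

lemma lin_coords:
  assumes f: "lin f" and x: "x \<in> carrier R" and v: "v \<in> B"
  shows "c (f x) v = (\<Oplus>u\<in>B. c x u \<otimes> c (f u) v)"
proof -
  have fc: "f x \<in> carrier R" if "x \<in> carrier R" for x using f that unfolding lin_def by blast
  have "f (\<sigma> x) \<approx> (\<Oplus>u\<in>B. c x u \<otimes> f u)"
    unfolding \<sigma>_def using f finite_B x c_L by (intro lin_finsum) auto
  moreover have cl: "(\<lambda>u. c x u \<otimes> f u) \<in> B \<rightarrow> carrier R" using x fc by auto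
  ultimately have "c (f (\<sigma> x)) v = c (\<Oplus>u\<in>B. c x u \<otimes> f u) v"
    using v by (intro c_cong finsum_closed)
  also have "\<dots> = (\<Oplus>u\<in>B. c (c x u \<otimes> f u) v)" by (rule c_finsum[OF finite_B cl v])
  also have "\<dots> = (\<Oplus>u\<in>B. c x u \<otimes> c (f u) v)"
    using x v fc c_L by (intro finsum_cong') (auto simp: c_smult)
  also have "c (f (\<sigma> x)) v = c (f x) v"
    using lin_cong[OF f \<sigma>_approx] x v fc by (intro c_cong) auto
  finally show ?thesis .
qed

lemma lin_mult: "z \<in> carrier R \<Longrightarrow> lin (\<lambda>x. z \<otimes> x)"
  unfolding lin_def using cong_a by (auto simp: r_distr m_lcomm)

lemma lin_mult_comp:
  assumes f: "lin f" and z: "z \<in> carrier R" shows "lin (\<lambda>x. z \<otimes> f x)"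
proof -
  have "z \<otimes> f (x \<oplus> y) \<approx> z \<otimes> f x \<oplus> z \<otimes> f y" if "x \<in> carrier R" "y \<in> carrier R" for x y
    using cong_mult[of "f (x \<oplus> y)" "f x \<oplus> f y" z] f z that by (simp add: lin_def r_distr)
  moreover have "z \<otimes> f (l \<otimes> x) \<approx> l \<otimes> (z \<otimes> f x)" if "x \<in> carrier R" "l \<in> L" for x l
    using cong_mult[of "f (l \<otimes> x)" "l \<otimes> f x" z] f z that by (simp add: lin_def m_lcomm)
  moreover have "z \<otimes> f (a \<otimes> x) \<approx> \<zero>" if "x \<in> carrier R" for x
    using cong_mult[of "f (a \<otimes> x)" "\<zero>" z] f z that by (simp add: lin_def)
  ultimately show ?thesis using f z unfolding lin_def by simp
qed

text \<open>Both sides are the double sum over \<open>u\<close> and \<open>v\<close> of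
  \<open>c (z \<otimes> v) u \<otimes> c (f u) v\<close>, the trace of a product of two matrices
  taken in either order.\<close>

lemma trace_commute:
  assumes f: "lin f" and z: "z \<in> carrier R"
  shows "trace (\<lambda>x. f (z \<otimes> x)) = trace (\<lambda>x. z \<otimes> f x)"
proof -
  have fc: "f x \<in> carrier R" if "x \<in> carrier R" for x using f that unfolding lin_def by blast
  have "trace (\<lambda>x. f (z \<otimes> x)) = (\<Oplus>v\<in>B. \<Oplus>u\<in>B. c (z \<otimes> v) u \<otimes> c (f u) v)"
    unfolding trace_def
  proof (intro finsum_cong')
    show "(\<lambda>v. \<Oplus>u\<in>B. c (z \<otimes> v) u \<otimes> c (f u) v) \<in> B \<rightarrow> carrier R"
      using z fc by (intro Pi_I finsum_closed) auto
    show "c (f (z \<otimes> v)) v = (\<Oplus>u\<in>B. c (z \<otimes> v) u \<otimes> c (f u) v)" if "v \<in> B" for v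
      using that z by (intro lin_coords f) auto
  qed simp
  also have "\<dots> = (\<Oplus>u\<in>B. \<Oplus>v\<in>B. c (z \<otimes> v) u \<otimes> c (f u) v)"
    using z fc finite_B by (intro finsum_swap) auto
  also have "\<dots> = trace (\<lambda>x. z \<otimes> f x)"
    unfolding trace_def
  proof (intro finsum_cong')
    fix u assume u: "u \<in> B"
    have "c (z \<otimes> f u) u = (\<Oplus>v\<in>B. c (f u) v \<otimes> c (z \<otimes> v) u)"
      using u z fc by (intro lin_coords lin_mult) auto
    also have "\<dots> = (\<Oplus>v\<in>B. c (z \<otimes> v) u \<otimes> c (f u) v)"
      using u z fc by (intro finsum_cong') (auto simp: m_comm)
    finally show "(\<Oplus>v\<in>B. c (z \<otimes> v) u \<otimes> c (f u) v) = c (z \<otimes> f u) u" by simp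
  qed (use z fc in auto)
  finally show ?thesis .
qed

text \<open>\<open>\<sigma>\<close> is an \<open>L\<close>-linear section of \<open>R \<rightarrow> R/aR\<close>, and \<open>a \<tau>(y)\<close> is its commutator with
  multiplication by \<open>y\<close>; so \<open>\<tau>(y)\<close> has the matrix \<open>M\<^sub>1(y)\<close>.\<close>

definition \<tau> where "\<tau> y x = W (y \<otimes> \<sigma> x)"

lemma \<tau>_closed [simp]: "\<lbrakk>x \<in> carrier R; y \<in> carrier R\<rbrakk> \<Longrightarrow> \<tau> y x \<in> carrier R"
  unfolding \<tau>_def by simp

lemma lin_\<tau>:
  assumes y: "y \<in> carrier R" shows "lin (\<tau> y)"
proof -
  have "\<sigma> (a \<otimes> x) = \<zero>" if "x \<in> carrier R" for x
  proof -
    \<comment> \<open>Zero is written as a product so that \<open>\<sigma>_smult\<close> with the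
      scalar \<open>\<zero>\<close> yields \<open>\<sigma> \<zero> = \<zero>\<close>; the same
      device serves in \<open>T_a\<close>.\<close>
    have "\<sigma> (a \<otimes> x) = \<sigma> (\<zero> \<otimes> \<zero>)" using \<sigma>_cong[OF cong_a[OF that]] by simp
    also have "\<dots> = \<zero>" by (subst \<sigma>_smult) auto
    finally show ?thesis .
  qed
  then show ?thesis unfolding lin_def \<tau>_def using y W_zero
    by (auto simp: \<sigma>_add \<sigma>_smult r_distr m_lcomm[of y] intro: W_add W_smult)
qed

text \<open>A Leibniz rule for commutators: \<open>z\<close> is moved past \<open>\<sigma>\<close>
  first and \<open>y\<close> second, and each move leaves a multiple of \<open>a\<close>. In
  matrices, M1(yz) = M1(y)M0(z) + M0(y)M1(z).\<close>

lemma \<tau>_mult: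
  assumes "y \<in> carrier R" "z \<in> carrier R" "x \<in> carrier R"
  shows "\<tau> (y \<otimes> z) x \<approx> \<tau> y (z \<otimes> x) \<oplus> y \<otimes> \<tau> z x"
  unfolding \<tau>_def
proof (rule W_eq)
  have "z \<otimes> x \<approx> z \<otimes> \<sigma> x" using assms by (intro cong_mult cong_sym[OF \<sigma>_approx]) auto
  then have "\<sigma> (z \<otimes> x) = \<sigma> (z \<otimes> \<sigma> x)" using assms by (intro \<sigma>_cong) auto
  then have eq: "z \<otimes> \<sigma> x = \<sigma> (z \<otimes> x) \<oplus> a \<otimes> W (z \<otimes> \<sigma> x)"
    using \<sigma>_decomp[of "z \<otimes> \<sigma> x"] assms by simp
  let ?p = "y \<otimes> \<sigma> (z \<otimes> x)"
  have "y \<otimes> z \<otimes> \<sigma> x = y \<otimes> (z \<otimes> \<sigma> x)" using assms by (simp add: m_assoc)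
  also have "\<dots> = ?p \<oplus> a \<otimes> (y \<otimes> W (z \<otimes> \<sigma> x))"
    by (subst eq) (use assms in \<open>simp add: r_distr m_lcomm\<close>)
  also have "?p = \<sigma> ?p \<oplus> a \<otimes> W ?p" using assms by (intro \<sigma>_decomp) auto
  finally show "y \<otimes> z \<otimes> \<sigma> x = \<sigma> ?p \<oplus> a \<otimes> (W ?p \<oplus> y \<otimes> W (z \<otimes> \<sigma> x))"
    using assms by (simp add: r_distr a_assoc)
qed (use assms in \<open>auto simp: \<sigma>_idem\<close>)

section \<open>The trace form and its derivation property\<close>

definition T where "T x y = trace (\<lambda>v. x \<otimes> \<tau> y v)"

lemma trace_closed: "(\<And>v. v \<in> B \<Longrightarrow> f v \<in> carrier R) \<Longrightarrow> trace f \<in> carrier R"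
  unfolding trace_def by (auto intro!: finsum_closed)

lemma T_closed: "\<lbrakk>x \<in> carrier R; y \<in> carrier R\<rbrakk> \<Longrightarrow> T x y \<in> carrier R"
  unfolding T_def by (intro trace_closed) auto

lemma T_add_left: 
  assumes "x \<in> carrier R" "x' \<in> carrier R" "y \<in> carrier R"
  shows "T (x \<oplus> x') y = T x y \<oplus> T x' y"
proof -
  have "T (x \<oplus> x') y = trace (\<lambda>v. x \<otimes> \<tau> y v \<oplus> x' \<otimes> \<tau> y v)"
    unfolding T_def using assms by (intro trace_cong) (auto simp: l_distr)
  also have "\<dots> = T x y \<oplus> T x' y" unfolding T_def using assms by (intro trace_add) auto
  finally show ?thesis .
qed

lemma T_add_right: 
  assumes "x \<in> carrier R" "y \<in> carrier R" "y' \<in> carrier R"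
  shows "T x (y \<oplus> y') = T x y \<oplus> T x y'"
proof -
  have "T x (y \<oplus> y') = trace (\<lambda>v. x \<otimes> \<tau> y v \<oplus> x \<otimes> \<tau> y' v)"
    unfolding T_def
  proof (intro trace_cong)
    fix v assume v: "v \<in> B"
    have "\<tau> (y \<oplus> y') v \<approx> \<tau> y v \<oplus> \<tau> y' v"
      unfolding \<tau>_def using W_add[of "y \<otimes> \<sigma> v" "y' \<otimes> \<sigma> v"] assms v by (simp add: l_distr)
    then show "x \<otimes> \<tau> (y \<oplus> y') v \<approx> x \<otimes> \<tau> y v \<oplus> x \<otimes> \<tau> y' v"
      using cong_mult[of _ "\<tau> y v \<oplus> \<tau> y' v" x] assms v by (simp add: r_distr)
  qed (use assms in auto)
  also have "\<dots> = T x y \<oplus> T x y'" unfolding T_def using assms by (intro trace_add) auto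
  finally show ?thesis .
qed

text \<open>Of the two terms of \<open>\<tau>_mult\<close>, one gives a value of \<open>T\<close> at
  once. In the other, multiplication by \<open>z\<close> stands inside \<open>\<tau> y\<close> and
  is brought outside by \<open>trace_commute\<close>. The result is the Leibniz rule for y \<mapsto>
  T(_, y), where ring elements act on a functional by multiplying its argument.\<close>

lemma T_mult:
  assumes "x \<in> carrier R" "y \<in> carrier R" "z \<in> carrier R"
  shows "T x (y \<otimes> z) = T (x \<otimes> y) z \<oplus> T (x \<otimes> z) y"
proof -
  have "T x (y \<otimes> z) = trace (\<lambda>v. x \<otimes> \<tau> y (z \<otimes> v) \<oplus> x \<otimes> y \<otimes> \<tau> z v)"
    unfolding T_def
  proof (intro trace_cong)
    fix v assume v: "v \<in> B"
    show "x \<otimes> \<tau> (y \<otimes> z) v \<approx> x \<otimes> \<tau> y (z \<otimes> v) \<oplus> x \<otimes> y \<otimes> \<tau> z v"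
      using cong_mult[OF \<tau>_mult[of y z v], of x] assms v by (simp add: r_distr m_assoc)
  qed (use assms in auto)
  also have "\<dots> = trace (\<lambda>v. x \<otimes> \<tau> y (z \<otimes> v)) \<oplus> T (x \<otimes> y) z"
    unfolding T_def using assms by (intro trace_add) auto
  also have "trace (\<lambda>v. x \<otimes> \<tau> y (z \<otimes> v)) = trace (\<lambda>v. z \<otimes> (x \<otimes> \<tau> y v))"
    using trace_commute[OF lin_mult_comp[OF lin_\<tau>], of y x z] assms by simp
  also have "\<dots> = T (x \<otimes> z) y"
    unfolding T_def using assms by (intro trace_cong) (auto simp: m_ac)
  finally show ?thesis using assms T_closed by (simp add: a_comm)
qed

text \<open>\<open>\<sigma>\<close> commutes with scalars from \<open>L\<close>, so
  \<open>l \<otimes> \<sigma> v\<close> is its own normal form and its first-order part is zero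
  modulo \<open>a\<close>.\<close>

lemma T_const:
  assumes "x \<in> carrier R" "l \<in> L" shows "T x l = \<zero>"
proof -
  have "T x l = trace (\<lambda>v. \<zero>)" unfolding T_def
  proof (rule trace_cong)
    fix v assume v: "v \<in> B"
    have "\<tau> l v \<approx> \<zero>" unfolding \<tau>_def
      by (rule W_eq[of _ "l \<otimes> \<sigma> v"]) (use v assms in \<open>auto simp: \<sigma>_smult \<sigma>_idem\<close>)
    then show "x \<otimes> \<tau> l v \<approx> \<zero>" using cong_mult[of _ \<zero> x] assms by fastforce
  qed simp
  also have "\<dots> = (\<Oplus>v\<in>B. \<zero>)" unfolding trace_def by (intro finsum_cong') (auto simp: c_zero)
  finally show ?thesis by simp
qed

text \<open>The expansion of \<open>a \<otimes> \<sigma> v\<close> has zero constant term and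
  first-order part \<open>\<sigma> v\<close>. So \<open>\<tau> a\<close> induces the identity of
  \<open>R/aR\<close>, whose trace is the dimension.\<close>

lemma T_a: "T \<one> a = [card B] \<cdot>\<^bsub>R\<^esub> \<one>"
proof -
  have "T \<one> a = trace (\<lambda>v. v)" unfolding T_def
  proof (rule trace_cong)
    fix v assume v: "v \<in> B"
    have "\<sigma> (\<zero> \<otimes> \<zero>) = \<zero> \<otimes> \<sigma> \<zero>" by (rule \<sigma>_smult) auto
    then have "\<tau> a v \<approx> \<sigma> v" unfolding \<tau>_def
      by (intro W_eq[of _ \<zero>]) (use v in auto)
    then have "\<tau> a v \<approx> v" using cong_trans \<sigma>_approx v by simp
    then show "\<one> \<otimes> \<tau> a v \<approx> v" using v by simp
  qed simp
  also have "\<dots> = (\<Oplus>v\<in>B. \<one>)" unfolding trace_def by (intro finsum_cong') (auto simp: c_basis)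
  also have "\<dots> = [card B] \<cdot>\<^bsub>R\<^esub> \<one>" by (rule add.finprod_const) simp
  finally show ?thesis .
qed

end

section \<open>Non-vanishing of the differential\<close>

text \<open>The universal property of the differentials, for the derivation that sends y to T(_,
  \<phi> y). Its target, the additive maps from \<open>B\<close> to itself with \<open>A\<close>
  acting through the argument, is never formed as a module; its elements are evaluated at each
  \<open>x\<close> instead.\<close>

lemma kaehler_d_zeroD:
  assumes "algebra K A" "ring_hom_cring A B \<phi>"
    and T_closed: "\<And>x y. \<lbrakk>x \<in> carrier B; y \<in> carrier B\<rbrakk> \<Longrightarrow> T x y \<in> carrier B"
    and T_left: "\<And>x x' y. \<lbrakk>x \<in> carrier B; x' \<in> carrier B; y \<in> carrier B\<rbrakk> \<Longrightarrow> T (x \<oplus>\<^bsub>B\<^esub> x') y = T x y \<oplus>\<^bsub>B\<^esub> T x' y"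
    and T_right: "\<And>x y y'. \<lbrakk>x \<in> carrier B; y \<in> carrier B; y' \<in> carrier B\<rbrakk> \<Longrightarrow> T x (y \<oplus>\<^bsub>B\<^esub> y') = T x y \<oplus>\<^bsub>B\<^esub> T x y'"
    and T_mult: "\<And>x y z. \<lbrakk>x \<in> carrier B; y \<in> carrier B; z \<in> carrier B\<rbrakk> \<Longrightarrow>
      T x (y \<otimes>\<^bsub>B\<^esub> z) = T (x \<otimes>\<^bsub>B\<^esub> y) z \<oplus>\<^bsub>B\<^esub> T (x \<otimes>\<^bsub>B\<^esub> z) y"
    and T_const: "\<And>x c. \<lbrakk>x \<in> carrier B; c \<in> carrier K\<rbrakk> \<Longrightarrow> T x (\<phi> (c \<odot>\<^bsub>A\<^esub> \<one>\<^bsub>A\<^esub>)) = \<zero>\<^bsub>B\<^esub>"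
    and a: "a \<in> carrier A" "kaehler_d K A a = \<zero>\<^bsub>\<Omega> K A\<^esub>" and x: "x \<in> carrier B"
  shows "T x (\<phi> a) = \<zero>\<^bsub>B\<^esub>"
proof -
  interpret algebra K A by fact
  interpret \<phi>: ring_hom_cring A B \<phi> by fact
  let ?F = "kaehler_free A"
  interpret F: module A ?F by (rule free_mod_module[OF M_cring])
  note b = basis_vec_closed[OF M_cring, where S = "carrier A"]
  \<comment> \<open>The \<open>A\<close>-linear extension of the assignment that sends the symbol d
    y to T(_, \<phi> y), evaluated at \<open>x\<close>. The coefficient \<open>u y\<close> acts by
    multiplying the first argument.\<close>
  define \<Phi> where "\<Phi> x u = (\<Oplus>\<^bsub>B\<^esub>y\<in>{y. u y \<noteq> \<zero>\<^bsub>A\<^esub>}. T (x \<otimes>\<^bsub>B\<^esub> \<phi> (u y)) (\<phi> y))" for x u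
  have uA: "u y \<in> carrier A" if "u \<in> carrier ?F" for u y
    using that by (cases "y \<in> carrier A") (auto simp: free_mod_carrier)
  have supp: "finite {y. u y \<noteq> \<zero>\<^bsub>A\<^esub>}" "{y. u y \<noteq> \<zero>\<^bsub>A\<^esub>} \<subseteq> carrier A" if "u \<in> carrier ?F" for u
    using that by (auto simp: free_mod_carrier)
  have T0: "T \<zero>\<^bsub>B\<^esub> y = \<zero>\<^bsub>B\<^esub>" if "y \<in> carrier B" for y
  proof -
    let ?t = "T \<zero>\<^bsub>B\<^esub> y"
    have t: "?t \<in> carrier B" using that by (intro T_closed) simp_all
    have "?t \<oplus>\<^bsub>B\<^esub> ?t = ?t" using T_left[of "\<zero>\<^bsub>B\<^esub>" "\<zero>\<^bsub>B\<^esub>" y] that by simp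
    then have "\<ominus>\<^bsub>B\<^esub> ?t \<oplus>\<^bsub>B\<^esub> (?t \<oplus>\<^bsub>B\<^esub> ?t) = \<ominus>\<^bsub>B\<^esub> ?t \<oplus>\<^bsub>B\<^esub> ?t" by simp
    then show ?thesis using t by (simp add: \<phi>.S.a_assoc[symmetric] \<phi>.S.l_neg)
  qed
  \<comment> \<open>By \<open>T0\<close> the summands outside the support vanish, so two elements of
    the free module can be summed over a common finite set.\<close>
  have ext: "\<Phi> x u = (\<Oplus>\<^bsub>B\<^esub>y\<in>U. T (x \<otimes>\<^bsub>B\<^esub> \<phi> (u y)) (\<phi> y))"
    if "u \<in> carrier ?F" "x \<in> carrier B" "finite U" "{y. u y \<noteq> \<zero>\<^bsub>A\<^esub>} \<subseteq> U" "U \<subseteq> carrier A" for x u U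
    unfolding \<Phi>_def
    by (rule \<phi>.S.add.finprod_mono_neutral_cong_left)
      (use that uA in \<open>auto simp: T0 intro!: T_closed\<close>)
  have \<Phi>_closed: "\<Phi> x u \<in> carrier B" if "u \<in> carrier ?F" "x \<in> carrier B" for x u
    unfolding \<Phi>_def using that uA supp(2)[OF that(1)] by (intro \<phi>.S.finsum_closed) (auto intro!: T_closed)
  have \<Phi>_add: "\<Phi> x (u \<oplus>\<^bsub>?F\<^esub> v) = \<Phi> x u \<oplus>\<^bsub>B\<^esub> \<Phi> x v"
    if u: "u \<in> carrier ?F" and v: "v \<in> carrier ?F" and x: "x \<in> carrier B" for x u v
  proof -
    let ?U = "{y. u y \<noteq> \<zero>\<^bsub>A\<^esub>} \<union> {y. v y \<noteq> \<zero>\<^bsub>A\<^esub>}"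
    have U: "finite ?U" "?U \<subseteq> carrier A" using supp u v by auto
    have "\<Phi> x (u \<oplus>\<^bsub>?F\<^esub> v) = (\<Oplus>\<^bsub>B\<^esub>y\<in>?U. T (x \<otimes>\<^bsub>B\<^esub> \<phi> ((u \<oplus>\<^bsub>?F\<^esub> v) y)) (\<phi> y))"
      using u v x U F.M.add.m_closed[OF u v] by (intro ext) auto
    also have "\<dots> = (\<Oplus>\<^bsub>B\<^esub>y\<in>?U. T (x \<otimes>\<^bsub>B\<^esub> \<phi> (u y)) (\<phi> y) \<oplus>\<^bsub>B\<^esub> T (x \<otimes>\<^bsub>B\<^esub> \<phi> (v y)) (\<phi> y))"
      using uA[OF u] uA[OF v] x U by (intro \<phi>.S.finsum_cong') (auto simp: \<phi>.S.r_distr T_left intro!: T_closed \<phi>.S.add.m_closed)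
    also have "\<dots> = (\<Oplus>\<^bsub>B\<^esub>y\<in>?U. T (x \<otimes>\<^bsub>B\<^esub> \<phi> (u y)) (\<phi> y)) \<oplus>\<^bsub>B\<^esub> (\<Oplus>\<^bsub>B\<^esub>y\<in>?U. T (x \<otimes>\<^bsub>B\<^esub> \<phi> (v y)) (\<phi> y))"
      using uA[OF u] uA[OF v] x U by (intro \<phi>.S.finsum_addf) (auto intro!: T_closed)
    also have "\<dots> = \<Phi> x u \<oplus>\<^bsub>B\<^esub> \<Phi> x v"
      using ext[OF u x U(1) _ U(2)] ext[OF v x U(1) _ U(2)] by simp
    finally show ?thesis .
  qed
  have \<Phi>_smult: "\<Phi> x (c \<odot>\<^bsub>?F\<^esub> u) = \<Phi> (x \<otimes>\<^bsub>B\<^esub> \<phi> c) u"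
    if u: "u \<in> carrier ?F" and c: "c \<in> carrier A" and x: "x \<in> carrier B" for x u c
  proof -
    let ?U = "{y. u y \<noteq> \<zero>\<^bsub>A\<^esub>}"
    have "\<Phi> x (c \<odot>\<^bsub>?F\<^esub> u) = (\<Oplus>\<^bsub>B\<^esub>y\<in>?U. T (x \<otimes>\<^bsub>B\<^esub> \<phi> ((c \<odot>\<^bsub>?F\<^esub> u) y)) (\<phi> y))"
      using u x c supp[OF u] F.smult_closed[OF c u] by (intro ext) auto
    also have "\<dots> = \<Phi> (x \<otimes>\<^bsub>B\<^esub> \<phi> c) u"
      unfolding \<Phi>_def using uA[OF u] c x supp[OF u]
      by (intro \<phi>.S.finsum_cong') (auto simp: \<phi>.S.m_assoc intro!: T_closed)
    finally show ?thesis .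
  qed
  have \<Phi>_basis: "\<Phi> x (basis_vec A y) = T x (\<phi> y)" if "y \<in> carrier A" "x \<in> carrier B" for x y
  proof -
    have "\<Phi> x (basis_vec A y) = (\<Oplus>\<^bsub>B\<^esub>z\<in>{y}. T (x \<otimes>\<^bsub>B\<^esub> \<phi> (basis_vec A y z)) (\<phi> z))"
      using that b by (intro ext) (auto simp: basis_vec_def)
    also have "\<dots> = T x (\<phi> y)" using that T_closed by (simp add: basis_vec_def)
    finally show ?thesis .
  qed
  have \<Phi>_zero: "\<Phi> x \<zero>\<^bsub>?F\<^esub> = \<zero>\<^bsub>B\<^esub>" for x unfolding \<Phi>_def by simp
  have \<Phi>_diff: "\<Phi> x (u \<ominus>\<^bsub>?F\<^esub> v) = \<zero>\<^bsub>B\<^esub>"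
    if u: "u \<in> carrier ?F" and v: "v \<in> carrier ?F" and x: "x \<in> carrier B" and eq: "\<Phi> x u = \<Phi> x v" for x u v
  proof -
    have "\<Phi> x (u \<ominus>\<^bsub>?F\<^esub> v) = \<Phi> x v \<oplus>\<^bsub>B\<^esub> \<Phi> x (\<ominus>\<^bsub>?F\<^esub> v)"
      using \<Phi>_add[OF u F.M.a_inv_closed[OF v] x] eq by (simp add: a_minus_def del: free_mod_simps)
    also have "\<dots> = \<Phi> x (v \<oplus>\<^bsub>?F\<^esub> \<ominus>\<^bsub>?F\<^esub> v)" using \<Phi>_add[OF v F.M.a_inv_closed[OF v] x] by simp
    also have "v \<oplus>\<^bsub>?F\<^esub> \<ominus>\<^bsub>?F\<^esub> v = \<zero>\<^bsub>?F\<^esub>" by (rule F.M.r_neg[OF v])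
    finally show ?thesis using \<Phi>_zero by simp
  qed
  \<comment> \<open>The common kernel of all \<open>\<Phi> x\<close>. The quantifier over
    \<open>x\<close> makes it stable under scalars, since \<open>\<Phi>_smult\<close> changes
    \<open>x\<close>. As a submodule containing the relations it will contain
    \<open>kaehler_sub K A\<close>.\<close>
  define N where "N = {u \<in> carrier ?F. \<forall>x\<in>carrier B. \<Phi> x u = \<zero>\<^bsub>B\<^esub>}"
  have "submodule N A ?F"
  proof (rule F.submoduleI)
    show "N \<subseteq> carrier ?F" unfolding N_def by blast
    show "\<zero>\<^bsub>?F\<^esub> \<in> N" unfolding N_def using \<Phi>_zero F.M.zero_closed by blast
  next
    fix u assume u: "u \<in> N"
    then have uF: "u \<in> carrier ?F" unfolding N_def by blast
    have "\<Phi> x (\<ominus>\<^bsub>?F\<^esub> u) = \<zero>\<^bsub>B\<^esub>" if x: "x \<in> carrier B" for x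
    proof -
      have "\<Phi> x (\<zero>\<^bsub>?F\<^esub> \<ominus>\<^bsub>?F\<^esub> u) = \<zero>\<^bsub>B\<^esub>"
        using u x \<Phi>_zero unfolding N_def by (intro \<Phi>_diff) (auto simp del: free_mod_simps)
      then show ?thesis using uF by (simp add: a_minus_def del: free_mod_simps)
    qed
    then show "\<ominus>\<^bsub>?F\<^esub> u \<in> N" unfolding N_def using uF F.M.a_inv_closed by blast
    fix v assume v: "v \<in> N"
    then have vF: "v \<in> carrier ?F" unfolding N_def by blast
    have "\<Phi> x (u \<oplus>\<^bsub>?F\<^esub> v) = \<zero>\<^bsub>B\<^esub>" if x: "x \<in> carrier B" for x
      using \<Phi>_add[OF uF vF x] u v x unfolding N_def by simp
    then show "u \<oplus>\<^bsub>?F\<^esub> v \<in> N" unfolding N_def using uF vF F.M.add.m_closed by blast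
  next
    fix c u assume c: "c \<in> carrier A" and u: "u \<in> N"
    then have uF: "u \<in> carrier ?F" unfolding N_def by blast
    have "\<Phi> x (c \<odot>\<^bsub>?F\<^esub> u) = \<zero>\<^bsub>B\<^esub>" if x: "x \<in> carrier B" for x
      using \<Phi>_smult[OF uF c x] u x c unfolding N_def by simp
    then show "c \<odot>\<^bsub>?F\<^esub> u \<in> N" unfolding N_def using uF c F.smult_closed by blast
  qed
  moreover have "kaehler_rels K A \<subseteq> N"
  proof -
    have *: "u \<ominus>\<^bsub>?F\<^esub> v \<in> N" if "u \<in> carrier ?F" "v \<in> carrier ?F" "\<And>x. x \<in> carrier B \<Longrightarrow> \<Phi> x u = \<Phi> x v" for u v
      unfolding N_def using that \<Phi>_diff F.M.minus_closed by blast
    note simps = \<Phi>_add \<Phi>_smult \<Phi>_basis b F.M.add.m_closed F.smult_closed T_right T_mult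
    have 1: "basis_vec A (p \<oplus>\<^bsub>A\<^esub> q) \<ominus>\<^bsub>?F\<^esub> (basis_vec A p \<oplus>\<^bsub>?F\<^esub> basis_vec A q) \<in> N"
      if "p \<in> carrier A" "q \<in> carrier A" for p q
      using that by (intro *) (simp_all add: simps del: free_mod_simps)
    have 2: "basis_vec A (c \<odot>\<^bsub>A\<^esub> p) \<ominus>\<^bsub>?F\<^esub> ((c \<odot>\<^bsub>A\<^esub> \<one>\<^bsub>A\<^esub>) \<odot>\<^bsub>?F\<^esub> basis_vec A p) \<in> N"
      if "c \<in> carrier K" "p \<in> carrier A" for c p
    proof (rule *)
      fix x assume x: "x \<in> carrier B"
      \<comment> \<open>A scalar acts as multiplication by its image in \<open>A\<close>, so
        homogeneity is the product rule with the second term removed by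
        \<open>T_const\<close>.\<close>
      have "c \<odot>\<^bsub>A\<^esub> p = (c \<odot>\<^bsub>A\<^esub> \<one>\<^bsub>A\<^esub>) \<otimes>\<^bsub>A\<^esub> p" using smult_assoc2[of c "\<one>\<^bsub>A\<^esub>" p] that by simp
      then have "T x (\<phi> (c \<odot>\<^bsub>A\<^esub> p)) = T (x \<otimes>\<^bsub>B\<^esub> \<phi> (c \<odot>\<^bsub>A\<^esub> \<one>\<^bsub>A\<^esub>)) (\<phi> p) \<oplus>\<^bsub>B\<^esub> T (x \<otimes>\<^bsub>B\<^esub> \<phi> p) (\<phi> (c \<odot>\<^bsub>A\<^esub> \<one>\<^bsub>A\<^esub>))"
        using that x by (simp add: T_mult)
      also have "\<dots> = T (x \<otimes>\<^bsub>B\<^esub> \<phi> (c \<odot>\<^bsub>A\<^esub> \<one>\<^bsub>A\<^esub>)) (\<phi> p)" using that x T_closed by (simp add: T_const)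
      finally show "\<Phi> x (basis_vec A (c \<odot>\<^bsub>A\<^esub> p)) = \<Phi> x ((c \<odot>\<^bsub>A\<^esub> \<one>\<^bsub>A\<^esub>) \<odot>\<^bsub>?F\<^esub> basis_vec A p)"
        using that x by (simp add: simps del: free_mod_simps)
    qed (use that b in \<open>auto intro!: F.smult_closed simp del: free_mod_simps\<close>)
    have 3: "basis_vec A (p \<otimes>\<^bsub>A\<^esub> q) \<ominus>\<^bsub>?F\<^esub> (p \<odot>\<^bsub>?F\<^esub> basis_vec A q \<oplus>\<^bsub>?F\<^esub> q \<odot>\<^bsub>?F\<^esub> basis_vec A p) \<in> N"
      if "p \<in> carrier A" "q \<in> carrier A" for p q
      using that by (intro *) (simp_all add: simps del: free_mod_simps)
    show ?thesis unfolding kaehler_rels_def Let_def using 1 2 3 by blast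
  qed
  ultimately have "kaehler_sub K A \<subseteq> N" unfolding kaehler_sub_def submod_gen_def by blast
  \<comment> \<open>The differential of \<open>a\<close> vanishes when the coset of
    \<open>basis_vec A a\<close> is the submodule itself, and a coset contains its
    representative.\<close>
  moreover have "basis_vec A a \<in> kaehler_sub K A"
  proof -
    interpret S: abelian_subgroup "kaehler_sub K A" ?F
      by (rule F.submod_abelian_subgroup[OF kaehler_sub_submodule]) fact
    show ?thesis using a(2) S.a_rcos_self[OF b[OF a(1)]] unfolding kaehler_d_def kaehler_def by simp
  qed
  ultimately have "\<Phi> x (basis_vec A a) = \<zero>\<^bsub>B\<^esub>" using x unfolding N_def by blast
  then show ?thesis using \<Phi>_basis a(1) x by simp
qed

lemma (in algebra) scalar_hom: "ring_hom_ring R M (\<lambda>c. c \<odot>\<^bsub>M\<^esub> \<one>\<^bsub>M\<^esub>)"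
proof (rule ring_hom_ringI2)
  show "ring R" "ring M" by (rule R.ring_axioms, rule cring.axioms(1)[OF M_cring])
  show "(\<lambda>c. c \<odot>\<^bsub>M\<^esub> \<one>\<^bsub>M\<^esub>) \<in> ring_hom R M"
  proof (rule ring_hom_memI)
    fix c d assume cd: "c \<in> carrier R" "d \<in> carrier R"
    then show "(c \<otimes> d) \<odot>\<^bsub>M\<^esub> \<one>\<^bsub>M\<^esub> = (c \<odot>\<^bsub>M\<^esub> \<one>\<^bsub>M\<^esub>) \<otimes>\<^bsub>M\<^esub> (d \<odot>\<^bsub>M\<^esub> \<one>\<^bsub>M\<^esub>)"
      by (simp add: smult_assoc1 smult_assoc2)
    show "(c \<oplus> d) \<odot>\<^bsub>M\<^esub> \<one>\<^bsub>M\<^esub> = c \<odot>\<^bsub>M\<^esub> \<one>\<^bsub>M\<^esub> \<oplus>\<^bsub>M\<^esub> d \<odot>\<^bsub>M\<^esub> \<one>\<^bsub>M\<^esub>"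
      using cd by (simp add: smult_l_distr)
  qed auto
qed

theorem kaehler_d_nonzero:
  assumes K: "field K" "char_zero K" and alg: "algebra K A" and noeth: "noetherian_ring A"
    and one: "\<one>\<^bsub>A\<^esub> \<noteq> \<zero>\<^bsub>A\<^esub>" and a: "nilpotent A a"
    and ann: "\<And>z. \<lbrakk>z \<in> carrier A; a \<otimes>\<^bsub>A\<^esub> z = \<zero>\<^bsub>A\<^esub>\<rbrakk> \<Longrightarrow> \<exists>w\<in>carrier A. z = a \<otimes>\<^bsub>A\<^esub> w"
  shows "kaehler_d K A a \<noteq> \<zero>\<^bsub>\<Omega> K A\<^esub>"
proof
  assume da: "kaehler_d K A a = \<zero>\<^bsub>\<Omega> K A\<^esub>"
  interpret K: field K by fact
  interpret algebra K A by fact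
  let ?i = "\<lambda>c. c \<odot>\<^bsub>A\<^esub> \<one>\<^bsub>A\<^esub>"
  interpret i: ring_hom_cring K A ?i
    by (rule ring_hom_cring.intro[OF K.is_cring M_cring ring_hom_cring_axioms.intro[OF ring_hom_ring.homh[OF scalar_hom]]])
  have aA: "a \<in> carrier A" using a by (simp add: nilpotent_def)
  have nat: "[n] \<cdot>\<^bsub>A\<^esub> \<one>\<^bsub>A\<^esub> \<in> Units A" if "0 < n" for n :: nat
  proof -
    have "[n] \<cdot>\<^bsub>K\<^esub> \<one>\<^bsub>K\<^esub> \<noteq> \<zero>\<^bsub>K\<^esub>" using K(2) that unfolding char_zero_def by blast
    then have "[n] \<cdot>\<^bsub>K\<^esub> \<one>\<^bsub>K\<^esub> \<in> Units K" by (simp add: K.field_Units)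
    then have "?i ([n] \<cdot>\<^bsub>K\<^esub> \<one>\<^bsub>K\<^esub>) \<in> Units A" by (rule i.hom_Units)
    then show ?thesis using i.hom_add_pow[of "\<one>\<^bsub>K\<^esub>" n] i.hom_one by simp
  qed
  obtain S where "localization A S" and S0: "\<zero>\<^bsub>A\<^esub> \<notin> S"
    and Smax: "\<And>x. \<lbrakk>x \<in> carrier A; x \<notin> S\<rbrakk> \<Longrightarrow> \<exists>s\<in>S. \<exists>n::nat. s \<otimes>\<^bsub>A\<^esub> x [^]\<^bsub>A\<^esub> n = \<zero>\<^bsub>A\<^esub>"
    using cring.ex_maximal_multiplicative[OF M_cring one] by metis
  then interpret l: localization A S by blast
  define B where "B = cring.loc A S"
  define \<phi> where "\<phi> = l.\<phi>"
  interpret B: nil_local B unfolding B_def by (rule l.nil_local_loc[OF S0 Smax nat])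
  interpret \<phi>: ring_hom_cring A B \<phi> unfolding B_def \<phi>_def by (rule l.\<phi>_hom)
  have B_max: "\<exists>J\<in>\<F>. \<forall>J'\<in>\<F>. J \<subseteq> J' \<longrightarrow> J' = J" if "\<F> \<noteq> {}" "\<And>J. J \<in> \<F> \<Longrightarrow> ideal J B" for \<F>
    using l.loc_maximal_ideal[OF noeth] that unfolding B_def by blast
  have B_ann: "\<exists>w\<in>carrier B. z = \<phi> a \<otimes>\<^bsub>B\<^esub> w" if "z \<in> carrier B" "\<phi> a \<otimes>\<^bsub>B\<^esub> z = \<zero>\<^bsub>B\<^esub>" for z
    using l.loc_annihilator[OF aA ann] that unfolding B_def \<phi>_def by blast
  \<comment> \<open>The coefficient field is grown from the image of \<open>K\<close>, so that
    constants lie in \<open>L\<close>, where \<open>T.T_const\<close> applies to them.\<close>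
  let ?k = "(\<lambda>c. \<phi> (?i c)) ` carrier K"
  have k_subring: "subring ?k B"
  proof -
    have "subring (\<phi> ` (?i ` carrier K)) B"
      by (intro \<phi>.ring.img_is_subring i.ring.img_is_subring K.carrier_is_subring)
    then show ?thesis by (simp add: image_image)
  qed
  have k_nil: "x = \<zero>\<^bsub>B\<^esub>" if x: "x \<in> ?k" "nilpotent B x" for x
  proof -
    obtain c where c: "c \<in> carrier K" "x = \<phi> (?i c)" using x by blast
    have "c = \<zero>\<^bsub>K\<^esub>"
    proof (rule ccontr)
      assume "c \<noteq> \<zero>\<^bsub>K\<^esub>"
      then have "c \<in> Units K" using c by (simp add: K.field_Units)
      then have "x \<in> Units B" using c \<phi>.hom_Units i.hom_Units by simp
      then show False using x B.Units_not_nilpotent by blast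
    qed
    then show ?thesis using c i.hom_zero by simp
  qed
  obtain L where L: "subring L B" "?k \<subseteq> L" "\<And>u. \<lbrakk>u \<in> L; u \<noteq> \<zero>\<^bsub>B\<^esub>\<rbrakk> \<Longrightarrow> u \<in> Units B \<and> inv\<^bsub>B\<^esub> u \<in> L"
    "\<And>x. x \<in> carrier B \<Longrightarrow> \<exists>l\<in>L. nilpotent B (x \<ominus>\<^bsub>B\<^esub> l)"
    using B.coefficient_field[OF k_subring k_nil] by metis
  interpret L: coefficient_field B L
    by (rule coefficient_field.intro[OF B.nil_local_axioms coefficient_field_axioms.intro[OF L(1,3,4)]])
  have aB: "\<phi> a \<in> carrier B" using aA by simp
  have J: "ideal (PIdl\<^bsub>B\<^esub> (\<phi> a)) B" by (rule B.cgenideal_ideal[OF aB])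
  have mem: "j \<in> PIdl\<^bsub>B\<^esub> (\<phi> a) \<longleftrightarrow> (\<exists>w\<in>carrier B. j = \<phi> a \<otimes>\<^bsub>B\<^esub> w)" for j
    unfolding cgenideal_def using aB B.m_comm by blast
  obtain V where V: "finite V" "V \<subseteq> carrier B" "L.lspan (PIdl\<^bsub>B\<^esub> (\<phi> a)) V = carrier B"
    using L.finite_codimension[OF B_max J] by metis
  obtain E where E: "finite E" "E \<subseteq> carrier B"
    "\<forall>z\<in>carrier B. \<exists>c j. (\<forall>v\<in>E. c v \<in> L) \<and> j \<in> PIdl\<^bsub>B\<^esub> (\<phi> a) \<and> z = (\<Oplus>\<^bsub>B\<^esub>v\<in>E. c v \<otimes>\<^bsub>B\<^esub> v) \<oplus>\<^bsub>B\<^esub> j"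
    and indep: "\<forall>c. (\<forall>v\<in>E. c v \<in> L) \<longrightarrow> (\<Oplus>\<^bsub>B\<^esub>v\<in>E. c v \<otimes>\<^bsub>B\<^esub> v) \<in> PIdl\<^bsub>B\<^esub> (\<phi> a) \<longrightarrow> (\<forall>v\<in>E. c v = \<zero>\<^bsub>B\<^esub>)"
    by (rule L.ex_basis_mod[OF J V])
  \<comment> \<open>Coordinates and first-order part are packed into one pair, so that a single
    choice yields matching \<open>c\<close> and \<open>W\<close>.\<close>
  have "\<forall>z\<in>carrier B. \<exists>p. (\<forall>v\<in>E. fst p v \<in> L) \<and> snd p \<in> carrier B \<and>
      z = (\<Oplus>\<^bsub>B\<^esub>v\<in>E. fst p v \<otimes>\<^bsub>B\<^esub> v) \<oplus>\<^bsub>B\<^esub> \<phi> a \<otimes>\<^bsub>B\<^esub> snd p"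
  proof
    fix z assume "z \<in> carrier B"
    then obtain c j where c: "\<forall>v\<in>E. c v \<in> L" "j \<in> PIdl\<^bsub>B\<^esub> (\<phi> a)" "z = (\<Oplus>\<^bsub>B\<^esub>v\<in>E. c v \<otimes>\<^bsub>B\<^esub> v) \<oplus>\<^bsub>B\<^esub> j"
      using E(3) by blast
    then obtain w where "w \<in> carrier B" "j = \<phi> a \<otimes>\<^bsub>B\<^esub> w" using mem by blast
    with c show "\<exists>p. (\<forall>v\<in>E. fst p v \<in> L) \<and> snd p \<in> carrier B \<and>
      z = (\<Oplus>\<^bsub>B\<^esub>v\<in>E. fst p v \<otimes>\<^bsub>B\<^esub> v) \<oplus>\<^bsub>B\<^esub> \<phi> a \<otimes>\<^bsub>B\<^esub> snd p"
      by (intro exI[of _ "(c, w)"]) simp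
  qed
  from bchoice[OF this] obtain p where p: "\<forall>z\<in>carrier B. (\<forall>v\<in>E. fst (p z) v \<in> L) \<and> snd (p z) \<in> carrier B \<and>
      z = (\<Oplus>\<^bsub>B\<^esub>v\<in>E. fst (p z) v \<otimes>\<^bsub>B\<^esub> v) \<oplus>\<^bsub>B\<^esub> \<phi> a \<otimes>\<^bsub>B\<^esub> snd (p z)" by (rule exE)
  define c where "c z = fst (p z)" for z
  define W where "W z = snd (p z)" for z
  have cW: "\<forall>v\<in>E. c z v \<in> L" "W z \<in> carrier B"
      "z = (\<Oplus>\<^bsub>B\<^esub>v\<in>E. c z v \<otimes>\<^bsub>B\<^esub> v) \<oplus>\<^bsub>B\<^esub> \<phi> a \<otimes>\<^bsub>B\<^esub> W z" if "z \<in> carrier B" for z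
    using bspec[OF p that] unfolding c_def W_def by auto
  interpret T: basis_mod B L "\<phi> a" E c W
  proof (intro basis_mod.intro basis_mod_axioms.intro L.coefficient_field_axioms aB B_ann E(1,2))
    fix e w v assume "\<And>v. v \<in> E \<Longrightarrow> e v \<in> L" "w \<in> carrier B"
      "(\<Oplus>\<^bsub>B\<^esub>v\<in>E. e v \<otimes>\<^bsub>B\<^esub> v) = \<phi> a \<otimes>\<^bsub>B\<^esub> w" "v \<in> E"
    then show "e v = \<zero>\<^bsub>B\<^esub>" using indep mem by blast
  qed (use cW in blast)+
  have "T.T \<one>\<^bsub>B\<^esub> (\<phi> a) = \<zero>\<^bsub>B\<^esub>"
  proof (rule kaehler_d_zeroD[OF alg \<phi>.ring_hom_cring_axioms, where T = T.T])
    fix x d assume "x \<in> carrier B" "d \<in> carrier K"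
    then show "T.T x (\<phi> (?i d)) = \<zero>\<^bsub>B\<^esub>" using L(2) by (intro T.T_const) auto
  qed (use T.T_closed T.T_add_left T.T_add_right T.T_mult aA da in auto)
  then have "[card E] \<cdot>\<^bsub>B\<^esub> \<one>\<^bsub>B\<^esub> = \<zero>\<^bsub>B\<^esub>" using T.T_a by simp
  \<comment> \<open>A positive \<open>card E\<close> would be a unit of \<open>B\<close>, hence
    nonzero. An empty basis, on the other hand, means that every element is a multiple of
    \<open>\<phi> a\<close>, and 1 would be nilpotent.\<close>
  then have "\<not> 0 < card E"
    using B.of_nat_Units[of "card E"] B.Units_not_nilpotent[of "\<zero>\<^bsub>B\<^esub>"] B.nilpotent_zero by fastforce
  then have "E = {}" using E(1) by (simp add: card_gt_0_iff)
  then have "\<one>\<^bsub>B\<^esub> = \<phi> a \<otimes>\<^bsub>B\<^esub> W \<one>\<^bsub>B\<^esub>" "W \<one>\<^bsub>B\<^esub> \<in> carrier B"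
    using cW(2,3)[of "\<one>\<^bsub>B\<^esub>"] aB by simp_all
  then have "nilpotent B \<one>\<^bsub>B\<^esub>"
    using B.nilpotent_mult[OF \<phi>.hom_nilpotent[OF a]] B.m_comm aB by metis
  then show False using B.Units_not_nilpotent by blast
qed

section \<open>Nakayama's lemma and the main theorem\<close>

lemma coset_hom:
  assumes alg: "algebra K R" and I: "ideal I R"
  shows "ring_hom_cring R (quot_mod R I) ((+>\<^bsub>R\<^esub>) I)"
proof -
  interpret algebra K R by fact
  interpret I: ideal I R by fact
  have "cring (quot_mod R I)" using quot_algebra[OF assms] by (rule algebra.M_cring)
  moreover have "(+>\<^bsub>R\<^esub>) I \<in> ring_hom R (quot_mod R I)"
  proof (rule ring_hom_memI)
    fix x y assume xy: "x \<in> carrier R" "y \<in> carrier R"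
    show "I +>\<^bsub>R\<^esub> x \<in> carrier (quot_mod R I)" using xy by (auto simp: A_RCOSETS_defs a_r_coset_def)
    show "I +>\<^bsub>R\<^esub> (x \<otimes>\<^bsub>R\<^esub> y) = (I +>\<^bsub>R\<^esub> x) \<otimes>\<^bsub>quot_mod R I\<^esub> (I +>\<^bsub>R\<^esub> y)"
      using I.rcoset_mult_add[OF xy] by simp
    show "I +>\<^bsub>R\<^esub> (x \<oplus>\<^bsub>R\<^esub> y) = (I +>\<^bsub>R\<^esub> x) \<oplus>\<^bsub>quot_mod R I\<^esub> (I +>\<^bsub>R\<^esub> y)"
      using I.a_rcos_sum[OF xy] by simp
  qed simp
  ultimately show ?thesis
    by (intro ring_hom_cring.intro ring_hom_cring_axioms.intro M_cring)
qed

locale noetherian_quotient = ring_hom_cring R "quot_mod R I" "(+>\<^bsub>R\<^esub>) I" + I: ideal I R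
  for R :: "('k, 'r, 'm) module_scheme" and I :: "'r set" +
  assumes noeth: "noetherian_ring (quot_mod R I)"
begin

abbreviation "A \<equiv> quot_mod R I"

lemma coset_cases:
  assumes "z \<in> carrier A" obtains x where "x \<in> carrier R" "z = I +>\<^bsub>R\<^esub> x"
  using assms by (auto simp: A_RCOSETS_defs a_r_coset_def)

lemma coset_eq_zero_iff: "x \<in> carrier R \<Longrightarrow> I +>\<^bsub>R\<^esub> x = \<zero>\<^bsub>A\<^esub> \<longleftrightarrow> x \<in> I"
  using I.a_rcos_self[of x] I.a_rcos_const by auto

lemma ideal_image:
  assumes "ideal J R" shows "ideal ((+>\<^bsub>R\<^esub>) I ` J) A"
proof -
  interpret J: ideal J R by fact
  show ?thesis
  proof (rule idealI)
    show "ring A" by (rule S.ring_axioms)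
    show "subgroup ((+>\<^bsub>R\<^esub>) I ` J) (add_monoid A)"
    proof (rule S.add.subgroupI)
      show "(+>\<^bsub>R\<^esub>) I ` J \<subseteq> carrier A" using J.a_Hcarr by (auto simp del: quot_mod_simps)
      show "(+>\<^bsub>R\<^esub>) I ` J \<noteq> {}" using J.zero_closed by blast
      fix u assume "u \<in> (+>\<^bsub>R\<^esub>) I ` J"
      then obtain x where x: "x \<in> J" "u = I +>\<^bsub>R\<^esub> x" by blast
      have "\<ominus>\<^bsub>A\<^esub> u = I +>\<^bsub>R\<^esub> (\<ominus>\<^bsub>R\<^esub> x)" using x J.a_Hcarr by (simp del: quot_mod_simps)
      then show "\<ominus>\<^bsub>A\<^esub> u \<in> (+>\<^bsub>R\<^esub>) I ` J" using x J.a_inv_closed by blast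
      fix v assume "v \<in> (+>\<^bsub>R\<^esub>) I ` J"
      then obtain y where y: "y \<in> J" "v = I +>\<^bsub>R\<^esub> y" by blast
      have "u \<oplus>\<^bsub>A\<^esub> v = I +>\<^bsub>R\<^esub> (x \<oplus>\<^bsub>R\<^esub> y)" using x y J.a_Hcarr by (simp del: quot_mod_simps)
      then show "u \<oplus>\<^bsub>A\<^esub> v \<in> (+>\<^bsub>R\<^esub>) I ` J" using x y J.a_closed by blast
    qed
    fix u z assume "u \<in> (+>\<^bsub>R\<^esub>) I ` J" "z \<in> carrier A"
    then obtain x y where x: "x \<in> J" "u = I +>\<^bsub>R\<^esub> x" and y: "y \<in> carrier R" "z = I +>\<^bsub>R\<^esub> y"
      by (metis coset_cases imageE)
    have "z \<otimes>\<^bsub>A\<^esub> u = I +>\<^bsub>R\<^esub> (y \<otimes>\<^bsub>R\<^esub> x)" "u \<otimes>\<^bsub>A\<^esub> z = I +>\<^bsub>R\<^esub> (x \<otimes>\<^bsub>R\<^esub> y)"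
      using x y J.a_Hcarr by (simp_all del: quot_mod_simps)
    then show "z \<otimes>\<^bsub>A\<^esub> u \<in> (+>\<^bsub>R\<^esub>) I ` J" "u \<otimes>\<^bsub>A\<^esub> z \<in> (+>\<^bsub>R\<^esub>) I ` J"
      using J.I_l_closed[OF x(1) y(1)] J.I_r_closed[OF x(1) y(1)] by simp_all
  qed
qed

text \<open>For ideals containing \<open>I\<close>, passing to the image in \<open>A\<close> loses
  nothing, as elements with equal image differ by an element of \<open>I\<close>. So the chain
  condition of \<open>A\<close> supplies maximal elements among ideals of \<open>R\<close>.\<close>

lemma ex_maximal:
  assumes "\<F> \<noteq> {}" and F: "\<And>J. J \<in> \<F> \<Longrightarrow> ideal J R \<and> I \<subseteq> J"
  obtains J where "J \<in> \<F>" "\<And>J'. \<lbrakk>J' \<in> \<F>; J \<subseteq> J'\<rbrakk> \<Longrightarrow> J' = J"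
proof (rule noetherian_maximal[OF noeth assms(1), of "(`) ((+>\<^bsub>R\<^esub>) I)"])
  show "ideal ((+>\<^bsub>R\<^esub>) I ` J) A" if "J \<in> \<F>" for J using F[OF that] ideal_image by blast
  fix J J' assume J: "J \<in> \<F>" "J' \<in> \<F>"
  interpret J: ideal J R using F[OF J(1)] by blast
  interpret J': ideal J' R using F[OF J(2)] by blast
  show "(+>\<^bsub>R\<^esub>) I ` J \<subseteq> (+>\<^bsub>R\<^esub>) I ` J' \<longleftrightarrow> J \<subseteq> J'"
  proof
    assume sub: "(+>\<^bsub>R\<^esub>) I ` J \<subseteq> (+>\<^bsub>R\<^esub>) I ` J'"
    show "J \<subseteq> J'"
    proof
      fix x assume x: "x \<in> J"
      then obtain y where y: "y \<in> J'" "I +>\<^bsub>R\<^esub> x = I +>\<^bsub>R\<^esub> y" using sub by blast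
      then have "x \<in> I +>\<^bsub>R\<^esub> y" using I.a_rcos_self[OF J.a_Hcarr[OF x]] by simp
      then obtain i where "i \<in> I" "x = i \<oplus>\<^bsub>R\<^esub> y" by (auto simp: a_r_coset_def')
      then show "x \<in> J'" using y F[OF J(2)] J'.a_closed by blast
    qed
  qed blast
qed (rule that)

text \<open>If \<open>t\<close> were not invertible modulo \<open>I\<close>, the chain condition
  would extend I + tR to an ideal maximal among those avoiding 1. This is a maximal ideal of
  \<open>R\<close> that contains \<open>t\<close>, hence it equals \<open>\<nn>\<close>, a
  contradiction.\<close>

lemma unit_mod:
  assumes loc: "local_ring R \<nn>" and t: "t \<in> carrier R" "t \<notin> \<nn>"
  shows "\<exists>s\<in>carrier R. \<exists>i\<in>I. \<one>\<^bsub>R\<^esub> = s \<otimes>\<^bsub>R\<^esub> t \<oplus>\<^bsub>R\<^esub> i"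
proof (rule ccontr)
  assume no: "\<not> ?thesis"
  let ?J = "I <+>\<^bsub>R\<^esub> PIdl\<^bsub>R\<^esub> t"
  let ?\<F> = "{J. ideal J R \<and> I \<subseteq> J \<and> t \<in> J \<and> \<one>\<^bsub>R\<^esub> \<notin> J}"
  have "?J \<in> ?\<F>"
  proof (intro CollectI conjI R.ideal_add_cgenideal I.ideal_axioms t(1))
    show "\<one>\<^bsub>R\<^esub> \<notin> ?J"
    proof
      assume "\<one>\<^bsub>R\<^esub> \<in> ?J"
      then obtain i s where si: "i \<in> I" "s \<in> carrier R" "\<one>\<^bsub>R\<^esub> = i \<oplus>\<^bsub>R\<^esub> s \<otimes>\<^bsub>R\<^esub> t"
        unfolding set_add_def' cgenideal_def by blast
      then have "\<one>\<^bsub>R\<^esub> = s \<otimes>\<^bsub>R\<^esub> t \<oplus>\<^bsub>R\<^esub> i" using t by (simp add: R.a_comm)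
      then show False using no si by blast
    qed
  qed
  then have "?\<F> \<noteq> {}" by blast
  then obtain J where J: "J \<in> ?\<F>" and max: "\<And>J'. \<lbrakk>J' \<in> ?\<F>; J \<subseteq> J'\<rbrakk> \<Longrightarrow> J' = J"
    by (rule ex_maximal) auto
  have "maximalideal J R"
  proof (rule maximalidealI)
    show "ideal J R" using J by simp
    show "carrier R \<noteq> J" using J by auto
    fix J' assume J': "ideal J' R" "J \<subseteq> J'" "J' \<subseteq> carrier R"
    show "J' = J \<or> J' = carrier R"
    proof (cases "\<one>\<^bsub>R\<^esub> \<in> J'")
      case True
      then show ?thesis using ideal.one_imp_carrier[OF J'(1)] by simp
    next
      case False
      then have "J' \<in> ?\<F>" using J J' by auto
      then show ?thesis using max J'(2) by blast
    qed
  qed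
  then have "J = \<nn>" using loc unfolding local_ring_def by blast
  then show False using J t by simp
qed

lemma colon_ideal_ideal:
  assumes f: "f \<in> carrier R" shows "ideal (colon_ideal R I f) R"
proof (rule idealI[OF R.ring_axioms])
  show "subgroup (colon_ideal R I f) (add_monoid R)"
  proof (rule R.add.subgroupI)
    show "colon_ideal R I f \<subseteq> carrier R" by (auto simp: colon_ideal_def)
    have "\<zero>\<^bsub>R\<^esub> \<in> colon_ideal R I f" using f by (simp add: colon_ideal_def)
    then show "colon_ideal R I f \<noteq> {}" by blast
    fix x assume x: "x \<in> colon_ideal R I f"
    then show "\<ominus>\<^bsub>R\<^esub> x \<in> colon_ideal R I f" using f by (simp add: colon_ideal_def R.l_minus)
    fix y assume "y \<in> colon_ideal R I f"
    then show "x \<oplus>\<^bsub>R\<^esub> y \<in> colon_ideal R I f" using x f by (simp add: colon_ideal_def R.l_distr)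
  qed
  fix x y assume x: "x \<in> colon_ideal R I f" and y: "y \<in> carrier R"
  then have "y \<otimes>\<^bsub>R\<^esub> x \<otimes>\<^bsub>R\<^esub> f = y \<otimes>\<^bsub>R\<^esub> (x \<otimes>\<^bsub>R\<^esub> f)" using f by (simp add: colon_ideal_def R.m_assoc)
  then show yx: "y \<otimes>\<^bsub>R\<^esub> x \<in> colon_ideal R I f"
    using x y I.I_l_closed by (simp add: colon_ideal_def)
  moreover have "x \<otimes>\<^bsub>R\<^esub> y = y \<otimes>\<^bsub>R\<^esub> x" using x y by (simp add: colon_ideal_def R.m_comm)
  ultimately show "x \<otimes>\<^bsub>R\<^esub> y \<in> colon_ideal R I f" by simp
qed

text \<open>Instead of finitely many generators of \<open>N\<close>, the proof uses an ideal that is maximal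
  among those containing \<open>F\<close> but not \<open>N\<close>.\<close>

lemma nakayama:
  assumes loc: "local_ring R \<nn>" and F: "ideal F R" "I \<subseteq> F" and N: "ideal N R"
    and le: "N \<subseteq> F <+>\<^bsub>R\<^esub> (\<nn> \<cdot>\<^bsub>R\<^esub> N)"
  shows "N \<subseteq> F"
proof (rule ccontr)
  assume "\<not> N \<subseteq> F"
  let ?\<F> = "{J. ideal J R \<and> F \<subseteq> J \<and> \<not> N \<subseteq> J}"
  have "?\<F> \<noteq> {}" using F \<open>\<not> N \<subseteq> F\<close> by blast
  then obtain J where J: "J \<in> ?\<F>" and max: "\<And>J'. \<lbrakk>J' \<in> ?\<F>; J \<subseteq> J'\<rbrakk> \<Longrightarrow> J' = J"
    by (rule ex_maximal) (use F in auto)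
  interpret J: ideal J R using J by blast
  interpret N: ideal N R by fact
  interpret \<nn>: maximalideal \<nn> R using loc unfolding local_ring_def by blast
  \<comment> \<open>This gives \<nn>N \<subseteq> J, and then \<open>le\<close> puts
    \<open>N\<close> into \<open>J\<close>. If \<mu>w were outside \<open>J\<close>, maximality
    would yield w = j + r\<mu>w with j in \<open>J\<close>, so (1 - r\<mu>)w lies in
    \<open>J\<close>; and 1 - r\<mu> is invertible modulo \<open>I\<close>, which is contained in
    \<open>J\<close>.\<close>
  have step: "\<mu> \<otimes>\<^bsub>R\<^esub> w \<in> J" if \<mu>: "\<mu> \<in> \<nn>" and w: "w \<in> N" for \<mu> w
  proof (rule ccontr)
    assume no: "\<mu> \<otimes>\<^bsub>R\<^esub> w \<notin> J"
    have c: "\<mu> \<in> carrier R" "w \<in> carrier R" "\<mu> \<otimes>\<^bsub>R\<^esub> w \<in> carrier R"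
      using \<nn>.a_Hcarr[OF \<mu>] N.a_Hcarr[OF w] by auto
    let ?J = "J <+>\<^bsub>R\<^esub> PIdl\<^bsub>R\<^esub> (\<mu> \<otimes>\<^bsub>R\<^esub> w)"
    note J1 = R.ideal_add_cgenideal[OF J.ideal_axioms c(3)]
    have "?J \<noteq> J" using no J1(3) by auto
    then have "N \<subseteq> ?J" using max[of ?J] J1(1,2) J by blast
    then obtain j r where jr: "j \<in> J" "r \<in> carrier R" "w = j \<oplus>\<^bsub>R\<^esub> r \<otimes>\<^bsub>R\<^esub> (\<mu> \<otimes>\<^bsub>R\<^esub> w)"
      using w unfolding set_add_def' cgenideal_def by blast
    note jc = J.a_Hcarr[OF jr(1)]
    let ?t = "\<one>\<^bsub>R\<^esub> \<ominus>\<^bsub>R\<^esub> r \<otimes>\<^bsub>R\<^esub> \<mu>"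
    have tc: "?t \<in> carrier R" using c jr by simp
    have tw: "?t \<otimes>\<^bsub>R\<^esub> w = j"
    proof -
      have "?t \<otimes>\<^bsub>R\<^esub> w = w \<ominus>\<^bsub>R\<^esub> r \<otimes>\<^bsub>R\<^esub> (\<mu> \<otimes>\<^bsub>R\<^esub> w)"
        using c jr(2) by (simp add: a_minus_def R.l_distr R.l_minus R.m_assoc)
      also have "\<dots> = (j \<oplus>\<^bsub>R\<^esub> r \<otimes>\<^bsub>R\<^esub> (\<mu> \<otimes>\<^bsub>R\<^esub> w)) \<ominus>\<^bsub>R\<^esub> r \<otimes>\<^bsub>R\<^esub> (\<mu> \<otimes>\<^bsub>R\<^esub> w)"
        using jr(3) by simp
      also have "\<dots> = j" using c jr(2) jc by (simp add: a_minus_def R.a_assoc R.r_neg)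
      finally show ?thesis .
    qed
    have "?t \<notin> \<nn>"
    proof
      assume "?t \<in> \<nn>"
      then have "?t \<oplus>\<^bsub>R\<^esub> r \<otimes>\<^bsub>R\<^esub> \<mu> \<in> \<nn>" using \<nn>.I_l_closed[OF \<mu> jr(2)] \<nn>.a_closed by blast
      then have "\<one>\<^bsub>R\<^esub> \<in> \<nn>" using c jr(2) by (simp add: a_minus_def R.a_assoc R.l_neg)
      then show False using \<nn>.one_imp_carrier \<nn>.I_notcarr by simp
    qed
    then obtain s i where s: "s \<in> carrier R" "i \<in> I" "\<one>\<^bsub>R\<^esub> = s \<otimes>\<^bsub>R\<^esub> ?t \<oplus>\<^bsub>R\<^esub> i"
      using unit_mod[OF loc tc] by blast
    have ic: "i \<in> carrier R" "i \<in> J" using s(2) I.a_Hcarr F J by auto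
    have "w = (s \<otimes>\<^bsub>R\<^esub> ?t \<oplus>\<^bsub>R\<^esub> i) \<otimes>\<^bsub>R\<^esub> w" using s(3) c by (metis R.l_one)
    also have "\<dots> = s \<otimes>\<^bsub>R\<^esub> (?t \<otimes>\<^bsub>R\<^esub> w) \<oplus>\<^bsub>R\<^esub> i \<otimes>\<^bsub>R\<^esub> w"
      using s(1) tc ic c by (simp add: R.l_distr R.m_assoc)
    also have "\<dots> \<in> J" unfolding tw
      using J.I_l_closed[OF jr(1) s(1)] J.I_r_closed[OF ic(2) c(2)] by simp
    finally show False using no J.I_l_closed c by blast
  qed
  have "y \<in> J" if "y \<in> \<nn> \<cdot>\<^bsub>R\<^esub> N" for y
    using that by (induction rule: ideal_prod.induct) (auto intro: step J.a_closed)
  then have "F <+>\<^bsub>R\<^esub> (\<nn> \<cdot>\<^bsub>R\<^esub> N) \<subseteq> J"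
    using J unfolding set_add_def' by (auto intro!: J.a_closed)
  then show False using le J by blast
qed

end

theorem theorem1p2:
  fixes K :: "('k, 'l) ring_scheme" and R :: "('k, 'r, 'm) module_scheme"
    and \<nn> I :: "'r set" and f :: 'r
  assumes "field K" and "char_zero K"
    and "algebra K R" and "local_ring R \<nn>"
    and "ideal I R" and "I \<noteq> carrier R"
    and "noetherian_ring (quot_mod R I)"
    and "f \<in> carrier R"
    and "nilpotent (quot_mod R I) (I +>\<^bsub>R\<^esub> f)"
    and "kaehler_d K (quot_mod R I) (I +>\<^bsub>R\<^esub> f) = \<zero>\<^bsub>\<Omega> K (quot_mod R I)\<^esub>"
  shows "\<not> colon_ideal R I f \<subseteq>
    (I <+>\<^bsub>R\<^esub> PIdl\<^bsub>R\<^esub> f) <+>\<^bsub>R\<^esub> (\<nn> \<cdot>\<^bsub>R\<^esub> colon_ideal R I f)"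
proof
  assume le: "colon_ideal R I f \<subseteq>
    (I <+>\<^bsub>R\<^esub> PIdl\<^bsub>R\<^esub> f) <+>\<^bsub>R\<^esub> (\<nn> \<cdot>\<^bsub>R\<^esub> colon_ideal R I f)"
  interpret q: noetherian_quotient R I
    using coset_hom[OF assms(3,5)] assms(5,7)
    by (intro noetherian_quotient.intro noetherian_quotient_axioms.intro)
  note f = \<open>f \<in> carrier R\<close>
  let ?A = "quot_mod R I"
  let ?F = "I <+>\<^bsub>R\<^esub> PIdl\<^bsub>R\<^esub> f"
  have sub: "colon_ideal R I f \<subseteq> ?F"
    using q.nakayama[OF assms(4) q.R.ideal_add_cgenideal(1,2)[OF assms(5) f] q.colon_ideal_ideal[OF f] le] .
  have "kaehler_d K ?A (I +>\<^bsub>R\<^esub> f) \<noteq> \<zero>\<^bsub>\<Omega> K ?A\<^esub>"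
  proof (rule kaehler_d_nonzero[OF assms(1,2) quot_algebra[OF assms(3,5)] assms(7) _ assms(9)])
    have "\<one>\<^bsub>R\<^esub> \<notin> I" using q.I.one_imp_carrier assms(6) by blast
    then show "\<one>\<^bsub>?A\<^esub> \<noteq> \<zero>\<^bsub>?A\<^esub>" using q.coset_eq_zero_iff[OF q.R.one_closed] q.hom_one by metis
  next
    \<comment> \<open>The annihilator of the class of \<open>f\<close> is the image of
      \<open>colon_ideal R I f\<close>, and the ideal generated by that class is the image of
      \<open>?F\<close>. So \<open>sub\<close> becomes the annihilator condition.\<close>
    fix z assume z: "z \<in> carrier ?A" "(I +>\<^bsub>R\<^esub> f) \<otimes>\<^bsub>?A\<^esub> z = \<zero>\<^bsub>?A\<^esub>"
    then obtain g where g: "g \<in> carrier R" "z = I +>\<^bsub>R\<^esub> g" by (metis q.coset_cases)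
    have "I +>\<^bsub>R\<^esub> (g \<otimes>\<^bsub>R\<^esub> f) = \<zero>\<^bsub>?A\<^esub>"
      using z g f q.S.m_comm[of "I +>\<^bsub>R\<^esub> f" z] q.hom_mult[OF g(1) f] by (metis q.hom_closed)
    then have "g \<otimes>\<^bsub>R\<^esub> f \<in> I" using q.coset_eq_zero_iff[of "g \<otimes>\<^bsub>R\<^esub> f"] g(1) f by blast
    then have "g \<in> colon_ideal R I f" using g(1) by (simp add: colon_ideal_def)
    then obtain i r where ir: "i \<in> I" "r \<in> carrier R" "g = i \<oplus>\<^bsub>R\<^esub> r \<otimes>\<^bsub>R\<^esub> f"
      using sub unfolding set_add_def' cgenideal_def by blast
    have "z = (I +>\<^bsub>R\<^esub> i) \<oplus>\<^bsub>?A\<^esub> (I +>\<^bsub>R\<^esub> r) \<otimes>\<^bsub>?A\<^esub> (I +>\<^bsub>R\<^esub> f)"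
      unfolding g(2) ir(3) using ir f q.I.a_Hcarr by (simp del: quot_mod_simps)
    also have "I +>\<^bsub>R\<^esub> i = \<zero>\<^bsub>?A\<^esub>" using q.coset_eq_zero_iff ir(1) q.I.a_Hcarr by blast
    finally have "z = (I +>\<^bsub>R\<^esub> f) \<otimes>\<^bsub>?A\<^esub> (I +>\<^bsub>R\<^esub> r)"
      using ir f q.S.m_comm by (simp del: quot_mod_simps)
    then show "\<exists>w\<in>carrier ?A. z = (I +>\<^bsub>R\<^esub> f) \<otimes>\<^bsub>?A\<^esub> w" using ir(2) q.hom_closed by blast
  qed
  then show False using assms(10) by blast
qed

end
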